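(* Consider the sequence of $G/GI/N$ queues described in the context. Let $\bar Q_0^N=Q_0^N/N$, $\bar A^N=\{A^N(t)/N,\ t\ge 0\}$ and $\bar Q^N=\{Q^N(t)/N,\ t\ge 0\}$. If $(\bar Q_0^N,\bar A^N)\Rightarrow(\bar Q_0,\bar A)$ in $(\mathbb{R}\times D[0,\infty),|\cdot|\times d_{J_1})$ as $N\to\infty$, where $\bar A$ is a stochastic process with $\mathbb{P}$-a.s. continuous sample paths, then $\bar Q^N\Rightarrow\bar Q$ as $N\to\infty$, where $\bar Q$ is the unique strong (i.e. pathwise, with paths in $D[0,\infty)$) solution to $$\bar Q(t)=\min(\bar Q_0,1)\bar F_0(t)+(\bar Q_0-1)^+G(t)+\int_0^tG(t-s)\,d\bar A(s)+\int_0^t(\bar Q(t-s)-1)^+\,dF(s),\qquad t\ge 0.$$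
   Context: Conventions. All random elements are defined on a common probability space $(\Omega,\mathcal F,\mathbb P)$. $D[0,\infty)$ is the space of right-continuous real functions on $[0,\infty)$ with left limits, with the Skorohod $J_1$ topology (metric $d_{J_1}$) and its Borel $\sigma$-field; product spaces carry the maximum metric; $\Rightarrow$ denotes convergence in distribution. $x^+=\max(x,0)$. Integrals $\int_0^t$ against $dF$ or against arrival processes are over the closed interval $[0,t]$, mass at $0$ included (integrator taken to be $0$ on $(-\infty,0)$). Distribution functions on $[0,\infty)$ are $0$ on $(-\infty,0)$. Model. For each $N\ge 1$ there is a queue with $N$ servers, operating first-come-first-served and without idling while customers wait. At time $0-$ there are $Q_0^N$ customers (a nonnegative-integer-valued random variable); the first $\min(Q_0^N,N)$ are in service and the other $(Q_0^N-N)^+$ wait. The residual service time of the $i$th customer in service at $0-$ is $\tilde\eta_i$, where $\{\tilde\eta_i\}$ is i.i.d. with distribution function $F_0$, $\bar F_0=1-F_0$. Customers arrive according to the counting process $A^N=\{A^N(t),t\ge0\}$, and $\tau_i^N=\inf\{t\ge 0:A^N(t)\ge i\}$. The $i$th customer to enter service after time $0-$ has service time $\eta_i$, where $\{\eta_i\}$ is i.i.d., nonnegative, with mean $1$ and distribution function $F$ (otherwise arbitrary), $G=1-F$. The pair $(Q_0^N,A^N)$ and the sequences $\{\tilde\eta_i\}$, $\{\eta_i\}$ are mutually independent. Let $w_i^N$ be the waiting time (before service starts) of the $i$th customer to arrive after time $0-$, and $\tilde w_i^N$ the waiting time of the $(N+i)$th initial customer. The total number of customers in the system at time $t$ is $$Q^N(t)=\sum_{i=1}^{\min(Q_0^N,N)}1\{\tilde\eta_i>t\}+\sum_{i=1}^{(Q_0^N-N)^+}1\{\tilde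 w_i^N+\eta_i>t\}+\sum_{i=1}^{A^N(t)}1\{\tau_i^N+w_i^N+\eta_{(Q_0^N-N)^++i}>t\}.$$ *)

theory Defs
  imports "HOL-Probability.Probability"
begin

section \<open>The Skorohod space of paths on the half-line\<close>

definition is_cadlag :: "(real \<Rightarrow> real) \<Rightarrow> bool" where
  "is_cadlag x \<longleftrightarrow>
     (\<forall>t\<ge>0. continuous (at_right t) x) \<and> (\<forall>t>0. \<exists>l. (x \<longlongrightarrow> l) (at_left t))"

text \<open>A path on the half-line is represented by its extension by 0 to the whole real line, so that
  two elements are equal iff they agree at all times \<open>t \<ge> 0\<close>.  This is also the convention under which
  a path is used as an integrator: its jump at time 0 is its value there.\<close>

typedef cadlag = "{x. is_cadlag x \<and> (\<forall>t<0. x t = 0)}"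
  morphisms path_of Abs_cadlag
  by (rule exI[of _ "\<lambda>_. 0"]) (auto simp: is_cadlag_def)

definition cadlag_of :: "(real \<Rightarrow> real) \<Rightarrow> cadlag" where
  "cadlag_of x = Abs_cadlag (\<lambda>t. if t < 0 then 0 else x t)"

lemma is_cadlag_path: "is_cadlag (path_of x)"
  using path_of[of x] by simp

lemma path_neg: "t < 0 \<Longrightarrow> path_of x t = 0"
  using path_of[of x] by simp

lemma is_cadlagD:
  assumes "is_cadlag x"
  shows "t \<ge> 0 \<Longrightarrow> (x \<longlongrightarrow> x t) (at_right t)" and "t > 0 \<Longrightarrow> \<exists>l. (x \<longlongrightarrow> l) (at_left t)"
  using assms by (simp_all add: is_cadlag_def continuous_within)

lemma is_cadlagI:
  assumes "\<And>t. t \<ge> 0 \<Longrightarrow> (x \<longlongrightarrow> x t) (at_right t)" "\<And>t. t > 0 \<Longrightarrow> \<exists>l. (x \<longlongrightarrow> l) (at_left t)"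
  shows "is_cadlag x"
  using assms by (simp add: is_cadlag_def continuous_within)

lemma path_cadlag_of:
  assumes "is_cadlag x"
  shows "path_of (cadlag_of x) = (\<lambda>t. if t < 0 then 0 else x t)"
proof -
  let ?y = "\<lambda>t. if t < 0 then 0 else x t"
  have "is_cadlag ?y"
  proof (rule is_cadlagI)
    fix t :: real assume t: "t \<ge> 0"
    have "\<forall>\<^sub>F s in at_right t. x s = ?y s"
      using t by (simp add: eventually_at_filter)
    with is_cadlagD(1)[OF assms t] have "(?y \<longlongrightarrow> x t) (at_right t)"
      by (rule Lim_transform_eventually)
    then show "(?y \<longlongrightarrow> ?y t) (at_right t)" using t by simp
  next
    fix t :: real assume t: "t > 0"
    from is_cadlagD(2)[OF assms t] obtain l where l: "(x \<longlongrightarrow> l) (at_left t)" ..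
    have "\<forall>\<^sub>F s in at_left t. x s = ?y s"
      using eventually_at_left_real[OF t] by eventually_elim auto
    with l show "\<exists>l. (?y \<longlongrightarrow> l) (at_left t)"
      by (intro exI[of _ l]) (rule Lim_transform_eventually)
  qed
  then show ?thesis
    unfolding cadlag_of_def by (intro Abs_cadlag_inverse) simp
qed

lemma bounded_path: "bounded (path_of x ` {a..b})"
proof (cases "a \<le> b")
  case True
  have right: "(path_of x \<longlongrightarrow> path_of x t) (at_right t)" for t
  proof (cases "t \<ge> 0")
    case True
    then show ?thesis by (rule is_cadlagD(1)[OF is_cadlag_path])
  next
    case False
    then have "\<forall>\<^sub>F s in at_right t. 0 = path_of x s"
      using eventually_at_right_real[of t 0] by (auto elim: eventually_mono simp: path_neg)
    then have "(path_of x \<longlongrightarrow> 0) (at_right t)"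
      by (rule Lim_transform_eventually[OF tendsto_const])
    then show ?thesis using False by (simp add: path_neg)
  qed
  have left: "\<exists>l. (path_of x \<longlongrightarrow> l) (at_left t)" for t
  proof (cases "t > 0")
    case True
    then show ?thesis by (rule is_cadlagD(2)[OF is_cadlag_path])
  next
    case False
    then have "\<forall>\<^sub>F s in at_left t. 0 = path_of x s"
      by (auto simp: eventually_at_filter path_neg)
    then show ?thesis
      by (intro exI[of _ 0]) (rule Lim_transform_eventually[OF tendsto_const])
  qed
  show ?thesis using True
  proof (induction rule: Bolzano)
    case (trans a b c)
    have "{a..c} = {a..b} \<union> {b..c}" using trans by auto
    then show ?case using trans by (simp add: image_Un)
  next
    case (local t)
    from left obtain l where l: "(path_of x \<longlongrightarrow> l) (at_left t)" ..
    have "\<forall>\<^sub>F s in at_left t. dist (path_of x s) l < 1"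
      using l by (rule tendstoD) simp
    then obtain p where p: "p < t" "\<And>s. p < s \<Longrightarrow> s < t \<Longrightarrow> dist (path_of x s) l < 1"
      by (auto simp: eventually_at_left[of "t - 1" t])
    have "\<forall>\<^sub>F s in at_right t. dist (path_of x s) (path_of x t) < 1"
      using right by (rule tendstoD) simp
    then obtain q where q: "t < q" "\<And>s. t < s \<Longrightarrow> s < q \<Longrightarrow> dist (path_of x s) (path_of x t) < 1"
      by (auto simp: eventually_at_right[of t "t + 1"])
    show ?case
    proof (intro exI conjI allI impI)
      show "0 < min (t - p) (q - t)" using p q by simp
    next
      fix u v :: real
      assume uv: "u \<le> t \<and> t \<le> v \<and> v - u < min (t - p) (q - t)"
      have "path_of x ` {u..v} \<subseteq> cball l 1 \<union> cball (path_of x t) 1"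
      proof (rule image_subsetI)
        fix s assume s: "s \<in> {u..v}"
        consider "s < t" | "s = t" | "s > t" by linarith
        then show "path_of x s \<in> cball l 1 \<union> cball (path_of x t) 1"
          using s uv p(2)[of s] q(2)[of s] by cases (auto simp: dist_commute)
      qed
      then show "bounded (path_of x ` {u..v})"
        by (rule bounded_subset[rotated]) simp
    qed
  qed
qed simp

text \<open>Increasing homeomorphisms of \<open>[0, T]\<close>; continuity is automatic for a monotone surjection.\<close>

definition time_changes :: "real \<Rightarrow> (real \<Rightarrow> real) set" where
  "time_changes T = {\<gamma>. strict_mono_on {0..T} \<gamma> \<and> \<gamma> ` {0..T} = {0..T}}"

definition skorohod_cost :: "real \<Rightarrow> (real \<Rightarrow> real) \<Rightarrow> (real \<Rightarrow> real) \<Rightarrow> (real \<Rightarrow> real) \<Rightarrow> real" where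
  "skorohod_cost T x y \<gamma> =
     max (SUP t\<in>{0..T}. \<bar>\<gamma> t - t\<bar>) (SUP t\<in>{0..T}. \<bar>x t - y (\<gamma> t)\<bar>)"

definition skorohod_dist :: "real \<Rightarrow> (real \<Rightarrow> real) \<Rightarrow> (real \<Rightarrow> real) \<Rightarrow> real" where
  "skorohod_dist T x y = (INF \<gamma>\<in>time_changes T. skorohod_cost T x y \<gamma>)"

text \<open>The metric for the \<open>J\<^sub>1\<close> topology on the half-line, following Billingsley (Convergence of Probability
  Measures, 2nd ed., Section 16): the paths are damped linearly to 0 on \<open>[m - 1, m]\<close>, so that a jump
  at the right end point \<open>m\<close> does not matter, and the distances on \<open>[0, m]\<close> are summed with weights.\<close>

definition damped :: "nat \<Rightarrow> (real \<Rightarrow> real) \<Rightarrow> real \<Rightarrow> real" where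
  "damped m x t = max 0 (min 1 (real m - t)) * x t"

lemma time_changesD:
  assumes "\<gamma> \<in> time_changes T"
  shows "strict_mono_on {0..T} \<gamma>" "\<gamma> ` {0..T} = {0..T}" "inj_on \<gamma> {0..T}"
    and "t \<in> {0..T} \<Longrightarrow> \<gamma> t \<in> {0..T}"
proof -
  show *: "strict_mono_on {0..T} \<gamma>" "\<gamma> ` {0..T} = {0..T}"
    using assms by (simp_all add: time_changes_def)
  show "inj_on \<gamma> {0..T}" by (rule strict_mono_on_imp_inj_on[OF *(1)])
  show "t \<in> {0..T} \<Longrightarrow> \<gamma> t \<in> {0..T}" using *(2) by blast
qed

lemma id_time_changes: "(\<lambda>t. t) \<in> time_changes T"
  by (auto simp: time_changes_def strict_mono_on_def)

lemma comp_time_changes: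
  assumes "\<gamma> \<in> time_changes T" "\<delta> \<in> time_changes T"
  shows "\<delta> \<circ> \<gamma> \<in> time_changes T"
proof -
  have "strict_mono_on {0..T} (\<delta> \<circ> \<gamma>)"
    using time_changesD(1,4)[OF assms(1)] time_changesD(1)[OF assms(2)]
    by (auto simp: strict_mono_on_def)
  then show ?thesis
    using time_changesD(2)[OF assms(1)] time_changesD(2)[OF assms(2)]
    unfolding time_changes_def by (simp only: image_comp[symmetric] mem_Collect_eq simp_thms)
qed

lemma inv_time_changes:
  assumes "\<gamma> \<in> time_changes T"
  shows "inv_into {0..T} \<gamma> \<in> time_changes T"
proof -
  note G = time_changesD[OF assms]
  have im: "inv_into {0..T} \<gamma> ` {0..T} = {0..T}"
    using G(2,3) by (metis bij_betw_def bij_betw_inv_into)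
  have "strict_mono_on {0..T} (inv_into {0..T} \<gamma>)"
  proof (rule strict_mono_onI)
    fix r s assume rs: "r \<in> {0..T}" "s \<in> {0..T}" "r < s"
    let ?r = "inv_into {0..T} \<gamma> r" and ?s = "inv_into {0..T} \<gamma> s"
    have mem: "?r \<in> {0..T}" "?s \<in> {0..T}" using rs im by blast+
    have val: "\<gamma> ?r = r" "\<gamma> ?s = s" using rs G(2) by (intro f_inv_into_f; simp)+
    show "?r < ?s"
      using strict_mono_on_less[OF G(1) mem] val rs by simp
  qed
  then show ?thesis using im by (simp add: time_changes_def)
qed

lemma skorohod_bdd:
  fixes x y :: "real \<Rightarrow> real"
  assumes "bounded (x ` {0..T})" "bounded (y ` {0..T})" "\<gamma> \<in> time_changes T"
  shows "bdd_above ((\<lambda>t. \<bar>\<gamma> t - t\<bar>) ` {0..T})" "bdd_above ((\<lambda>t. \<bar>x t - y (\<gamma> t)\<bar>) ` {0..T})"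
proof -
  show "bdd_above ((\<lambda>t. \<bar>\<gamma> t - t\<bar>) ` {0..T})"
  proof (rule bdd_aboveI2)
    fix t assume "t \<in> {0..T}"
    then show "\<bar>\<gamma> t - t\<bar> \<le> T" using time_changesD(4)[OF assms(3), of t] by auto
  qed
  obtain B where B: "\<And>t. t \<in> {0..T} \<Longrightarrow> \<bar>x t\<bar> \<le> B"
    using assms(1) by (fastforce simp: bounded_iff)
  obtain C where C: "\<And>t. t \<in> {0..T} \<Longrightarrow> \<bar>y t\<bar> \<le> C"
    using assms(2) by (fastforce simp: bounded_iff)
  show "bdd_above ((\<lambda>t. \<bar>x t - y (\<gamma> t)\<bar>) ` {0..T})"
  proof (rule bdd_aboveI2)
    fix t assume t: "t \<in> {0..T}"
    show "\<bar>x t - y (\<gamma> t)\<bar> \<le> B + C"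
      using B[OF t] C[OF time_changesD(4)[OF assms(3) t]] by linarith
  qed
qed

lemma skorohod_cost_ge:
  assumes "bounded (x ` {0..T})" "bounded (y ` {0..T})" "\<gamma> \<in> time_changes T" "t \<in> {0..T}"
  shows "\<bar>\<gamma> t - t\<bar> \<le> skorohod_cost T x y \<gamma>" "\<bar>x t - y (\<gamma> t)\<bar> \<le> skorohod_cost T x y \<gamma>"
  unfolding skorohod_cost_def
  using cSUP_upper[OF assms(4) skorohod_bdd(1)[OF assms(1-3)]]
    cSUP_upper[OF assms(4) skorohod_bdd(2)[OF assms(1-3)]] by linarith+

lemma skorohod_cost_le:
  assumes "0 \<le> T" "\<And>t. t \<in> {0..T} \<Longrightarrow> \<bar>\<gamma> t - t\<bar> \<le> c" "\<And>t. t \<in> {0..T} \<Longrightarrow> \<bar>x t - y (\<gamma> t)\<bar> \<le> c"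
  shows "skorohod_cost T x y \<gamma> \<le> c"
  unfolding skorohod_cost_def using assms by (auto intro!: cSUP_least)

lemma skorohod_cost_nonneg:
  assumes "0 \<le> T" "bounded (x ` {0..T})" "bounded (y ` {0..T})" "\<gamma> \<in> time_changes T"
  shows "0 \<le> skorohod_cost T x y \<gamma>"
  using skorohod_cost_ge(1)[OF assms(2-4), of 0] assms(1) by auto

lemma skorohod_dist_le:
  assumes "0 \<le> T" "bounded (x ` {0..T})" "bounded (y ` {0..T})" "\<gamma> \<in> time_changes T"
  shows "skorohod_dist T x y \<le> skorohod_cost T x y \<gamma>"
  unfolding skorohod_dist_def using assms
  by (intro cINF_lower bdd_belowI2[where m = 0] skorohod_cost_nonneg)

lemma skorohod_dist_nonneg:
  assumes "0 \<le> T" "bounded (x ` {0..T})" "bounded (y ` {0..T})"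
  shows "0 \<le> skorohod_dist T x y"
  unfolding skorohod_dist_def using assms id_time_changes[of T]
  by (intro cINF_greatest skorohod_cost_nonneg) auto

lemma skorohod_dist_lessE:
  assumes "skorohod_dist T x y < c"
  obtains \<gamma> where "\<gamma> \<in> time_changes T" "skorohod_cost T x y \<gamma> < c"
proof -
  have "\<exists>z\<in>skorohod_cost T x y ` time_changes T. z < c"
    using assms id_time_changes[of T] unfolding skorohod_dist_def
    by (intro cInf_lessD) auto
  then show ?thesis using that by blast
qed

lemma skorohod_dist_self:
  assumes "0 \<le> T" "bounded (x ` {0..T})"
  shows "skorohod_dist T x x = 0"
proof -
  have "skorohod_cost T x x (\<lambda>t. t) \<le> 0"
    using assms(1) by (intro skorohod_cost_le) auto
  then show ?thesis
    using skorohod_dist_le[OF assms(1,2,2) id_time_changes] skorohod_dist_nonneg[OF assms(1,2,2)]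
    by linarith
qed

lemma skorohod_dist_commute_le:
  assumes "0 \<le> T" "bounded (x ` {0..T})" "bounded (y ` {0..T})"
  shows "skorohod_dist T y x \<le> skorohod_dist T x y"
proof (rule dense_ge)
  fix c assume "skorohod_dist T x y < c"
  then obtain \<gamma> where g: "\<gamma> \<in> time_changes T" and c: "skorohod_cost T x y \<gamma> < c"
    by (rule skorohod_dist_lessE)
  let ?d = "inv_into {0..T} \<gamma>"
  note d = inv_time_changes[OF g]
  have "skorohod_cost T y x ?d \<le> c"
  proof (rule skorohod_cost_le[OF assms(1)])
    fix t assume t: "t \<in> {0..T}"
    then have gd: "\<gamma> (?d t) = t" using time_changesD(2)[OF g] by (intro f_inv_into_f) simp
    note * = skorohod_cost_ge[OF assms(2,3) g time_changesD(4)[OF d t], unfolded gd]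
    show "\<bar>?d t - t\<bar> \<le> c" "\<bar>y t - x (?d t)\<bar> \<le> c"
      using * c by linarith+
  qed
  then show "skorohod_dist T y x \<le> c"
    using skorohod_dist_le[OF assms(1,3,2) d] by linarith
qed

lemma skorohod_dist_triangle:
  assumes "0 \<le> T" "bounded (x ` {0..T})" "bounded (y ` {0..T})" "bounded (z ` {0..T})"
  shows "skorohod_dist T x z \<le> skorohod_dist T x y + skorohod_dist T y z"
proof (rule field_le_epsilon)
  fix e :: real assume "0 < e"
  obtain \<gamma> where g: "\<gamma> \<in> time_changes T" "skorohod_cost T x y \<gamma> < skorohod_dist T x y + e / 2"
    using \<open>0 < e\<close> skorohod_dist_lessE[of T x y "skorohod_dist T x y + e / 2"]
    by (metis half_gt_zero less_add_same_cancel1)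
  obtain \<delta> where d: "\<delta> \<in> time_changes T" "skorohod_cost T y z \<delta> < skorohod_dist T y z + e / 2"
    using \<open>0 < e\<close> skorohod_dist_lessE[of T y z "skorohod_dist T y z + e / 2"]
    by (metis half_gt_zero less_add_same_cancel1)
  have "skorohod_cost T x z (\<delta> \<circ> \<gamma>) \<le> skorohod_cost T x y \<gamma> + skorohod_cost T y z \<delta>"
  proof (rule skorohod_cost_le[OF assms(1)])
    fix t assume t: "t \<in> {0..T}"
    note * = skorohod_cost_ge[OF assms(2,3) g(1) t]
      skorohod_cost_ge[OF assms(3,4) d(1) time_changesD(4)[OF g(1) t]]
    show "\<bar>(\<delta> \<circ> \<gamma>) t - t\<bar> \<le> skorohod_cost T x y \<gamma> + skorohod_cost T y z \<delta>"
      "\<bar>x t - z ((\<delta> \<circ> \<gamma>) t)\<bar> \<le> skorohod_cost T x y \<gamma> + skorohod_cost T y z \<delta>"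
      using * unfolding comp_def by linarith+
  qed
  then show "skorohod_dist T x z \<le> skorohod_dist T x y + skorohod_dist T y z + e"
    using skorohod_dist_le[OF assms(1,2,4) comp_time_changes[OF g(1) d(1)]] g(2) d(2) by linarith
qed

lemma bounded_damped: "bounded (damped m (path_of x) ` {0..b})"
proof -
  obtain B where "\<forall>z\<in>path_of x ` {0..b}. norm z \<le> B"
    using bounded_path[of x 0 b] unfolding bounded_iff by blast
  then have B: "\<bar>path_of x t\<bar> \<le> B" if "t \<in> {0..b}" for t
    using that by simp
  have "\<bar>damped m (path_of x) t\<bar> \<le> B" if "t \<in> {0..b}" for t
  proof -
    have "\<bar>damped m (path_of x) t\<bar> = \<bar>max 0 (min 1 (real m - t))\<bar> * \<bar>path_of x t\<bar>"
      by (simp add: damped_def abs_mult)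
    also have "\<dots> \<le> 1 * \<bar>path_of x t\<bar>" by (intro mult_right_mono) auto
    finally show ?thesis using B[OF that] by simp
  qed
  then show ?thesis by (intro boundedI[of _ B]) auto
qed

lemma skorohod_dist_damped_eq_0:
  assumes eq: "skorohod_dist (real m) (damped m (path_of x)) (damped m (path_of y)) \<le> 0"
    and t: "0 \<le> t" "t + 1 < real m"
  shows "path_of x t = path_of y t"
proof -
  have "\<bar>path_of x t - path_of y t\<bar> \<le> e" if "0 < e" for e :: real
  proof -
    have "\<forall>\<^sub>F s in at_right t. dist (path_of z s) (path_of z t) < e / 3" for z
    proof (rule tendstoD)
      show "(path_of z \<longlongrightarrow> path_of z t) (at_right t)"
        by (rule is_cadlagD(1)[OF is_cadlag_path t(1)])
    qed (use that in simp)
    then have "\<forall>\<^sub>F s in at_right t. dist (path_of x s) (path_of x t) < e / 3 \<and>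
        dist (path_of y s) (path_of y t) < e / 3"
      by (intro eventually_conj)
    then obtain q where q: "t < q" "\<And>s. t < s \<Longrightarrow> s < q \<Longrightarrow> \<bar>path_of x s - path_of x t\<bar> < e / 3"
        "\<And>s. t < s \<Longrightarrow> s < q \<Longrightarrow> \<bar>path_of y s - path_of y t\<bar> < e / 3"
      by (auto simp: eventually_at_right[of t "t + 1"] dist_real_def)
    define h where "h = min (q - t) (real m - 1 - t)"
    have h: "0 < h" "h \<le> q - t" "h \<le> real m - 1 - t" using q t by (auto simp: h_def)
    obtain \<gamma> where g: "\<gamma> \<in> time_changes (real m)"
      and c: "skorohod_cost (real m) (damped m (path_of x)) (damped m (path_of y)) \<gamma> < min (e / 3) (h / 4)"
    proof (rule skorohod_dist_lessE)
      show "skorohod_dist (real m) (damped m (path_of x)) (damped m (path_of y)) < min (e / 3) (h / 4)"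
        using eq h \<open>0 < e\<close> by (simp add: min_def)
    qed
    define s where "s = t + h / 2"
    have s: "t < s" "s < q" "s + 1 < real m" "s \<in> {0..real m}"
      using h t by (auto simp: s_def)
    note * = skorohod_cost_ge[OF bounded_damped[of m x] bounded_damped[of m y] g s(4)]
    have "\<bar>\<gamma> s - s\<bar> < h / 4" using *(1) c by linarith
    then have gs: "t < \<gamma> s" "\<gamma> s < q" "\<gamma> s + 1 < real m"
      using h unfolding s_def by linarith+
    have "damped m (path_of x) s = path_of x s" "damped m (path_of y) (\<gamma> s) = path_of y (\<gamma> s)"
      using s gs by (auto simp: damped_def)
    then have "\<bar>path_of x s - path_of y (\<gamma> s)\<bar> < e / 3" using *(2) c by linarith
    then show ?thesis
      using q(2)[OF s(1,2)] q(3)[OF gs(1,2)] by linarith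
  qed
  then show ?thesis
    using field_le_epsilon[of "\<bar>path_of x t - path_of y t\<bar>" 0] by auto
qed

instantiation cadlag :: metric_space
begin

definition dist_cadlag :: "cadlag \<Rightarrow> cadlag \<Rightarrow> real" where
  "dist_cadlag x y = (\<Sum>m. (1/2) ^ Suc m *
     min 1 (skorohod_dist (real (Suc m)) (damped (Suc m) (path_of x)) (damped (Suc m) (path_of y))))"

definition uniformity_cadlag :: "(cadlag \<times> cadlag) filter" where
  "uniformity_cadlag = (INF e\<in>{0<..}. principal {(x, y). dist x y < e})"

definition open_cadlag :: "cadlag set \<Rightarrow> bool" where
  "open_cadlag U \<longleftrightarrow> (\<forall>x\<in>U. \<forall>\<^sub>F (x', y) in uniformity. x' = x \<longrightarrow> y \<in> U)"

instance
proof
  let ?d = "\<lambda>m x y. skorohod_dist (real (Suc m)) (damped (Suc m) (path_of x)) (damped (Suc m) (path_of y))"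
  let ?s = "\<lambda>x y m. (1/2) ^ Suc m * min 1 (?d m x y) :: real"
  have nonneg: "0 \<le> ?d m x y" for m x y
    by (intro skorohod_dist_nonneg bounded_damped) simp
  have snn: "0 \<le> ?s x y m" for m x y
    using nonneg[of m x y] by simp
  have summ: "summable (?s x y)" for x y
  proof (rule summable_comparison_test')
    show "summable (\<lambda>m. (1/2) ^ Suc m :: real)"
      using summable_mult[OF summable_geometric[of "1/2 :: real"], of "1/2"] by simp
    fix m :: nat
    show "norm (?s x y m) \<le> (1/2) ^ Suc m"
      using snn[of m x y] mult_left_mono[of "min 1 (?d m x y)" 1 "(1/2) ^ Suc m"] by simp
  qed
  have comm: "?d m x y \<le> ?d m y x" for m x y
    by (intro skorohod_dist_commute_le bounded_damped) simp
  have comm: "?d m x y = ?d m y x" for m x y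
    using comm[of m x y] comm[of m y x] by simp
  show "(dist x y = 0) = (x = y)" for x y :: cadlag
  proof
    assume "x = y"
    then have "?d m x y = 0" for m
      by (simp add: skorohod_dist_self bounded_damped del: of_nat_Suc)
    then show "dist x y = 0" by (simp add: dist_cadlag_def del: of_nat_Suc)
  next
    assume "dist x y = 0"
    then have z: "?s x y m = 0" for m
      using suminf_eq_zero_iff[OF summ snn] by (simp add: dist_cadlag_def del: of_nat_Suc)
    have "path_of x t = path_of y t" for t
    proof (cases "t < 0")
      case False
      obtain m where m: "t + 1 < real m" using reals_Archimedean2 by blast
      have "?d m x y \<le> 0" using z[of m] by (simp add: min_def del: of_nat_Suc split: if_splits)
      then show ?thesis
        using m False by (intro skorohod_dist_damped_eq_0[of "Suc m"]) auto
    qed (simp add: path_neg)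
    then show "x = y" by (metis ext path_of_inject)
  qed
  show "dist x y \<le> dist x z + dist y z" for x y z :: cadlag
  proof -
    have tri: "?d m x y \<le> ?d m x z + ?d m y z" for m
      using skorohod_dist_triangle[of "real (Suc m)" "damped (Suc m) (path_of x)"
          "damped (Suc m) (path_of z)" "damped (Suc m) (path_of y)"] comm[of m y z]
      by (simp add: bounded_damped del: of_nat_Suc)
    have "?s x y m \<le> ?s x z m + ?s y z m" for m
    proof -
      have "min 1 (?d m x y) \<le> min 1 (?d m x z) + min 1 (?d m y z)"
        using tri[of m] nonneg[of m x z] nonneg[of m y z] by linarith
      then have "?s x y m \<le> (1/2) ^ Suc m * (min 1 (?d m x z) + min 1 (?d m y z))"
        by (rule mult_left_mono) simp
      then show ?thesis by (simp only: distrib_left)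
    qed
    then have "suminf (?s x y) \<le> (\<Sum>m. ?s x z m + ?s y z m)"
      by (intro suminf_le summ summable_add)
    then show ?thesis
      unfolding dist_cadlag_def by (simp only: suminf_add[OF summ summ])
  qed
qed (simp_all add: uniformity_cadlag_def open_cadlag_def)

end

section \<open>Convergence in distribution and independence\<close>

text \<open>The measurability clauses say that the \<open>X n\<close> and \<open>X'\<close> are random elements with respect to the
  Borel sigma-algebra; without them the Bochner integrals below would be meaningless.\<close>

definition converges_in_distribution ::
  "'w measure \<Rightarrow> (nat \<Rightarrow> 'w \<Rightarrow> 'b::topological_space) \<Rightarrow> ('w \<Rightarrow> 'b) \<Rightarrow> bool" where
  "converges_in_distribution M X X' \<longleftrightarrow>
     (\<forall>n. X n \<in> borel_measurable M) \<and> X' \<in> borel_measurable M \<and>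
     (\<forall>f :: 'b \<Rightarrow> real. continuous_on UNIV f \<longrightarrow> bounded (range f) \<longrightarrow>
        (\<lambda>n. \<integral>\<omega>. f (X n \<omega>) \<partial>M) \<longlonglongrightarrow> (\<integral>\<omega>. f (X' \<omega>) \<partial>M))"

text \<open>Mutual independence of three random elements with values in spaces of different types, which
  the library's \<open>indep_vars\<close> does not cover.\<close>

definition indep_vars3 ::
  "'w measure \<Rightarrow> 'a measure \<Rightarrow> ('w \<Rightarrow> 'a) \<Rightarrow> 'b measure \<Rightarrow> ('w \<Rightarrow> 'b) \<Rightarrow> 'c measure \<Rightarrow> ('w \<Rightarrow> 'c) \<Rightarrow> bool"
where
  "indep_vars3 M S X T Y U Z \<longleftrightarrow>
     X \<in> measurable M S \<and> Y \<in> measurable M T \<and> Z \<in> measurable M U \<and>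
     prob_space.indep_sets M
       (\<lambda>k. [{X -` B \<inter> space M |B. B \<in> sets S},
             {Y -` B \<inter> space M |B. B \<in> sets T},
             {Z -` B \<inter> space M |B. B \<in> sets U}] ! k) {..<3}"

section \<open>The many-server queue, path by path\<close>

text \<open>Sequences of customers are numbered from 1; entries with index 0 are never used.  Batch arrivals,
  and arrivals at time 0, are allowed.\<close>

definition counting_path :: "(real \<Rightarrow> nat) \<Rightarrow> bool" where
  "counting_path a \<longleftrightarrow> mono_on {0..} a \<and> (\<forall>t\<ge>0. continuous (at_right t) a)"

text \<open>Only meaningful for customers that do arrive, i.e. \<open>i \<le> a t\<close> for some \<open>t\<close>.\<close>

definition arrival_time :: "(real \<Rightarrow> nat) \<Rightarrow> nat \<Rightarrow> real" where
  "arrival_time a i = Inf {t. 0 \<le> t \<and> i \<le> a t}"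

text \<open>Arguments: number of servers \<open>n\<close>, initial number of customers \<open>q\<close>, arrival counting path \<open>a\<close>,
  residual service times \<open>r\<close> of the customers initially in service, service times \<open>v\<close> in the order
  of entry into service.

  The customers that are not in service at time \<open>0-\<close> are numbered in the order of their arrival:
  first the \<open>q - n\<close> (truncated subtraction) initially waiting ones, then the later arrivals.  Under
  FCFS this is also the order of entry into service.  As no server idles while customers wait, the
  \<open>j\<close>-th of them starts service at the first time \<open>t\<close> when it is present and fewer than \<open>n\<close> of the
  customers ahead of it are still in the system.\<close>

definition present_from :: "nat \<Rightarrow> nat \<Rightarrow> (real \<Rightarrow> nat) \<Rightarrow> nat \<Rightarrow> real" where
  "present_from n q a j = (if j \<le> q - n then 0 else arrival_time a (j - (q - n)))"

fun service_start ::
  "nat \<Rightarrow> nat \<Rightarrow> (real \<Rightarrow> nat) \<Rightarrow> (nat \<Rightarrow> real) \<Rightarrow> (nat \<Rightarrow> real) \<Rightarrow> nat \<Rightarrow> real" where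
  "service_start n q a r v j =
     Inf {t. present_from n q a j \<le> t \<and>
       (\<Sum>i = 1..min q n. of_bool (r i > t))
         + (\<Sum>l\<in>{1..<j}. of_bool (service_start n q a r v l + v l > t)) < n}"

declare service_start.simps [simp del]

definition initial_wait ::
  "nat \<Rightarrow> nat \<Rightarrow> (real \<Rightarrow> nat) \<Rightarrow> (nat \<Rightarrow> real) \<Rightarrow> (nat \<Rightarrow> real) \<Rightarrow> nat \<Rightarrow> real" where
  "initial_wait n q a r v i = service_start n q a r v i"

definition arrival_wait ::
  "nat \<Rightarrow> nat \<Rightarrow> (real \<Rightarrow> nat) \<Rightarrow> (nat \<Rightarrow> real) \<Rightarrow> (nat \<Rightarrow> real) \<Rightarrow> nat \<Rightarrow> real" where
  "arrival_wait n q a r v i = service_start n q a r v ((q - n) + i) - arrival_time a i"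

definition queue_length ::
  "nat \<Rightarrow> nat \<Rightarrow> (real \<Rightarrow> nat) \<Rightarrow> (nat \<Rightarrow> real) \<Rightarrow> (nat \<Rightarrow> real) \<Rightarrow> real \<Rightarrow> nat" where
  "queue_length n q a r v t =
     (\<Sum>i = 1..min q n. of_bool (r i > t))
     + (\<Sum>i = 1..q - n. of_bool (initial_wait n q a r v i + v i > t))
     + (\<Sum>i = 1..a t. of_bool (arrival_time a i + arrival_wait n q a r v i + v ((q - n) + i) > t))"

text \<open>Both kinds of scaled paths are cadlag, so that \<^const>\<open>cadlag_of\<close> applies to them as intended.\<close>

lemma counting_path_right:
  assumes "counting_path a" "0 \<le> t"
  shows "\<forall>\<^sub>F s in at_right t. a s = a t"
  using assms by (auto simp: counting_path_def continuous_within tendsto_discrete)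

lemma counting_path_left:
  assumes "counting_path a" "0 < t"
  shows "\<exists>k. \<forall>\<^sub>F s in at_left t. a s = k"
proof -
  have mono: "a s \<le> a u" if "0 \<le> s" "s \<le> u" for s u
    using assms(1) that by (auto simp: counting_path_def mono_on_def)
  let ?K = "a ` {0..<t}"
  have fin: "finite ?K"
    by (rule finite_subset[of _ "{..a t}"]) (auto intro: mono)
  have "Max ?K \<in> ?K" using fin assms(2) by (intro Max_in) auto
  then obtain u where u: "0 \<le> u" "u < t" "Max ?K = a u" by auto
  have "a s = Max ?K" if "u < s" "s < t" for s
  proof (rule antisym)
    show "a s \<le> Max ?K" using fin that u by (intro Max_ge) auto
    show "Max ?K \<le> a s" using u that mono[of u s] by simp
  qed
  then show ?thesis
    using eventually_at_left_real[OF u(2)] by (auto elim!: eventually_mono)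
qed

lemma is_cadlag_add:
  assumes "is_cadlag x" "is_cadlag y"
  shows "is_cadlag (\<lambda>t. x t + y t)"
proof (rule is_cadlagI)
  fix t :: real assume t: "t > 0"
  from is_cadlagD(2)[OF assms(1) t] obtain l where l: "(x \<longlongrightarrow> l) (at_left t)" ..
  from is_cadlagD(2)[OF assms(2) t] obtain k where k: "(y \<longlongrightarrow> k) (at_left t)" ..
  from tendsto_add[OF l k] show "\<exists>l. ((\<lambda>t. x t + y t) \<longlongrightarrow> l) (at_left t)" ..
qed (intro tendsto_add is_cadlagD(1)[OF assms(1)] is_cadlagD(1)[OF assms(2)])

lemma is_cadlag_of_bool: "is_cadlag (\<lambda>t. of_bool (c > t))"
proof -
  have "\<exists>e. \<forall>\<^sub>F s in at_left t. of_bool (c > s) = (e :: real)" for t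
  proof (cases "t \<le> c")
    case True
    then show ?thesis by (intro exI[of _ 1]) (auto simp: eventually_at_filter)
  next
    case False
    then show ?thesis
      using eventually_at_left_real[of c t] by (intro exI[of _ 0]) (auto elim: eventually_mono)
  qed
  moreover have "\<forall>\<^sub>F s in at_right t. of_bool (c > s) = (of_bool (c > t) :: real)" for t
  proof (cases "t < c")
    case True
    then show ?thesis using eventually_at_right_real[of t c] by (auto elim: eventually_mono)
  next
    case False
    then show ?thesis by (auto simp: eventually_at_filter)
  qed
  ultimately show ?thesis
    by (intro is_cadlagI) (metis tendsto_eventually)+
qed

lemma is_cadlag_sum:
  "finite I \<Longrightarrow> (\<And>i. i \<in> I \<Longrightarrow> is_cadlag (x i)) \<Longrightarrow> is_cadlag (\<lambda>t. \<Sum>i\<in>I. x i t)"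
proof (induction rule: finite_induct)
  case empty
  show ?case by (auto simp: is_cadlag_def)
next
  case (insert i I)
  have "is_cadlag (\<lambda>t. x i t + (\<Sum>j\<in>I. x j t))"
    using insert by (intro is_cadlag_add) auto
  then show ?case using insert by simp
qed

lemma is_cadlag_counting_sum:
  assumes a: "counting_path a" and x: "\<And>i. is_cadlag (x i)"
  shows "is_cadlag (\<lambda>t. \<Sum>i = 1..a t. x i t)"
proof -
  have c: "is_cadlag (\<lambda>t. \<Sum>i = 1..k. x i t)" for k :: nat
    by (intro is_cadlag_sum x) auto
  have "((\<lambda>s. \<Sum>i = 1..a s. x i s) \<longlongrightarrow> (\<Sum>i = 1..a t. x i t)) (at_right t)" if "0 \<le> t" for t
  proof (rule Lim_transform_eventually)
    show "((\<lambda>s. \<Sum>i = 1..a t. x i s) \<longlongrightarrow> (\<Sum>i = 1..a t. x i t)) (at_right t)"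
      using c[of "a t"] that by (simp add: is_cadlag_def continuous_within)
    show "\<forall>\<^sub>F s in at_right t. (\<Sum>i = 1..a t. x i s) = (\<Sum>i = 1..a s. x i s)"
      using counting_path_right[OF a that] by eventually_elim simp
  qed
  moreover have "\<exists>l. ((\<lambda>s. \<Sum>i = 1..a s. x i s) \<longlongrightarrow> l) (at_left t)" if "0 < t" for t
  proof -
    obtain k where k: "\<forall>\<^sub>F s in at_left t. a s = k" using counting_path_left[OF a \<open>0 < t\<close>] by blast
    from is_cadlagD(2)[OF c[of k] \<open>0 < t\<close>]
    obtain l where l: "((\<lambda>s. \<Sum>i = 1..k. x i s) \<longlongrightarrow> l) (at_left t)" ..
    have "\<forall>\<^sub>F s in at_left t. (\<Sum>i = 1..k. x i s) = (\<Sum>i = 1..a s. x i s)"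
      using k by eventually_elim simp
    with l show ?thesis by (intro exI[of _ l]) (rule Lim_transform_eventually)
  qed
  ultimately show ?thesis by (simp add: is_cadlag_def continuous_within)
qed

lemma is_cadlag_divide:
  assumes "is_cadlag x"
  shows "is_cadlag (\<lambda>t. x t / c)"
proof (rule is_cadlagI)
  fix t :: real assume t: "t \<ge> 0"
  from tendsto_mult_right[OF is_cadlagD(1)[OF assms t], of "inverse c"]
  show "((\<lambda>t. x t / c) \<longlongrightarrow> x t / c) (at_right t)" by (simp add: divide_inverse)
next
  fix t :: real assume t: "t > 0"
  from is_cadlagD(2)[OF assms t] obtain l where "(x \<longlongrightarrow> l) (at_left t)" ..
  from tendsto_mult_right[OF this, of "inverse c"]
  show "\<exists>l. ((\<lambda>t. x t / c) \<longlongrightarrow> l) (at_left t)" unfolding divide_inverse ..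
qed

lemma path_scaled_arrivals:
  assumes "counting_path a"
  shows "path_of (cadlag_of (\<lambda>t. real (a t) / c)) = (\<lambda>t. if t < 0 then 0 else real (a t) / c)"
proof -
  have "is_cadlag (\<lambda>t. \<Sum>i = 1..a t. 1)"
    by (rule is_cadlag_counting_sum[OF assms]) (auto simp: is_cadlag_def)
  then show ?thesis by (intro path_cadlag_of is_cadlag_divide) simp
qed

lemma path_scaled_queue_length:
  assumes "counting_path a"
  shows "path_of (cadlag_of (\<lambda>t. real (queue_length n q a r v t) / c)) =
     (\<lambda>t. if t < 0 then 0 else real (queue_length n q a r v t) / c)"
  unfolding queue_length_def of_nat_add of_nat_sum of_nat_of_bool
  by (intro path_cadlag_of is_cadlag_divide is_cadlag_add is_cadlag_sum
      is_cadlag_counting_sum[OF assms] is_cadlag_of_bool) auto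

section \<open>The fluid equation\<close>

text \<open>Arguments: distribution functions \<open>F\<^sub>0\<close> and \<open>F\<close>, initial value \<open>q\<close>, cumulative arrivals \<open>a\<close>.
  \<^const>\<open>interval_measure\<close> is the Lebesgue-Stieltjes measure of a nondecreasing right-continuous
  function; as \<open>F\<close> and \<^term>\<open>path_of a\<close> vanish on the negative half-line, an atom at 0 is included.\<close>

definition fluid_solution ::
  "(real \<Rightarrow> real) \<Rightarrow> (real \<Rightarrow> real) \<Rightarrow> real \<Rightarrow> cadlag \<Rightarrow> cadlag \<Rightarrow> bool" where
  "fluid_solution F\<^sub>0 F q a x \<longleftrightarrow> (\<forall>t\<ge>0.
     path_of x t = min q 1 * (1 - F\<^sub>0 t) + max (q - 1) 0 * (1 - F t)
       + (LINT s:{0..t}|interval_measure (path_of a). 1 - F (t - s))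
       + (LINT s:{0..t}|interval_measure F. max (path_of x (t - s) - 1) 0))"

end

theory Submission
  imports Defs
begin

text \<open>The proof is pathwise apart from laws of large numbers for the service times.

  Let \<open>k\<^sub>j\<close> be the time when the \<open>j\<close>-th of the customers not initially in service starts service,
  and \<open>v\<^sub>j\<close> its service time.  Under FCFS the \<open>k\<^sub>j\<close> increase with \<open>j\<close>, and as no server idles while
  customers wait, the number that have entered service by time \<open>t\<close> is the number that have appeared
  less the excess of the queue length over \<open>N\<close> (\<open>entered_add_waiting\<close>).  Replace each indicator of
  \<open>k\<^sub>j + v\<^sub>j \<le> t\<close> by \<open>F (t - k\<^sub>j)\<close>.  The resulting sum averages, over the law \<open>F\<close> of \<open>s\<close>, the number
  that have entered service by time \<open>t - s\<close>, which is expressed through arrivals and queue length.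
  So the scaled queue length solves the fluid equation driven by the scaled initial state and
  arrivals, up to the replacement error and a similar error for the residual service times
  (\<open>queue_fluid_error\<close>).

  The replacement error is uniformly small whatever the starting times are, even though these depend
  on the service times.  Cut the sequence of customers into finitely many long blocks.
  Within a block all \<open>k\<^sub>j\<close> lie in one interval, so that the law of large numbers for the block leaves
  an error of the length of the block times the mass that \<open>F\<close> gives to a shifted copy of that interval;
  these copies are disjoint for different blocks, so the masses add up to at most 1
  (\<open>ordered_empirical_bound\<close>).  Atoms of \<open>F\<close> and simultaneous starts of many customers do no harm.

  The fluid equation is well posed for every cadlag arrival path, once the integral of \<open>G\<close> against the
  arrivals is integrated by parts (\<open>integral_survival_arrivals\<close>).  In the norm with weight \<open>exp (- t)\<close>
  its right-hand side is a contraction with factor equal to the expectation of \<open>exp (- s)\<close>, which is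
  below 1 because the mean of \<open>F\<close> is positive.  This gives existence by Picard iteration and a
  stability estimate, uniform on bounded time intervals (\<open>fluid_stability\<close>, \<open>fluid_existence\<close>).
  Hence the solution map is continuous at continuous arrival paths, near which \<open>J\<^sub>1\<close> closeness is
  uniform closeness on bounded intervals (\<open>isCont_fluid_map\<close>), and the queue is close to the solution for its
  own initial state and arrivals.  The mapping theorem \<open>converges_in_distribution_map\<close> combines the two.

  Measurability is needed in the Borel sets of the Skorohod space: evaluations are Borel
  (\<open>borel_measurable_eval\<close>), and they determine Borel measurability (\<open>borel_measurable_cadlagI\<close>).\<close>

section \<open>Convergence in distribution via Lipschitz minorants\<close>

text \<open>For \<open>k \<ge> 0\<close> the largest \<open>k\<close>-Lipschitz function below \<open>g\<close>: a continuous test function even if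
  \<open>g\<close> itself is discontinuous.\<close>

definition lipschitz_minorant :: "('a::metric_space \<Rightarrow> real) \<Rightarrow> real \<Rightarrow> 'a \<Rightarrow> real" where
  "lipschitz_minorant g k s = (INF s'. g s' + k * dist s s')"

context
  fixes g :: "'a::metric_space \<Rightarrow> real" and B k :: real
  assumes bound: "\<And>s. \<bar>g s\<bar> \<le> B" and k: "0 \<le> k"
begin

lemma lipschitz_minorant_bdd: "bdd_below (range (\<lambda>s'. g s' + k * dist s s'))"
proof (rule bdd_belowI2[where m = "- B"])
  fix s'
  show "- B \<le> g s' + k * dist s s'"
    using bound[of s'] mult_nonneg_nonneg[OF k zero_le_dist[of s s']] by linarith
qed

lemma lipschitz_minorant_le: "lipschitz_minorant g k s \<le> g s"
  unfolding lipschitz_minorant_def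
  using cINF_lower[OF lipschitz_minorant_bdd[of s], of s] by simp

lemma lipschitz_minorant_bounded: "\<bar>lipschitz_minorant g k s\<bar> \<le> B"
proof -
  have "- B \<le> lipschitz_minorant g k s"
    unfolding lipschitz_minorant_def
  proof (rule cINF_greatest)
    fix s'
    show "- B \<le> g s' + k * dist s s'"
      using bound[of s'] mult_nonneg_nonneg[OF k zero_le_dist[of s s']] by linarith
  qed simp
  then show ?thesis using lipschitz_minorant_le[of s] bound[of s] by linarith
qed

lemma lipschitz_minorant_lipschitz:
  "\<bar>lipschitz_minorant g k s - lipschitz_minorant g k u\<bar> \<le> k * dist s u"
proof -
  have "lipschitz_minorant g k s - k * dist s u \<le> lipschitz_minorant g k u" for s u
    unfolding lipschitz_minorant_def[of g k u]
  proof (rule cINF_greatest)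
    fix s'
    have "lipschitz_minorant g k s \<le> g s' + k * dist s s'"
      unfolding lipschitz_minorant_def by (rule cINF_lower[OF lipschitz_minorant_bdd]) simp
    moreover have "k * dist s s' \<le> k * (dist s u + dist u s')"
      by (intro mult_left_mono dist_triangle k)
    ultimately show "lipschitz_minorant g k s - k * dist s u \<le> g s' + k * dist u s'"
      by (simp add: distrib_left)
  qed simp
  from this[of s u] this[of u s] show ?thesis by (simp add: dist_commute abs_le_iff)
qed

lemma continuous_lipschitz_minorant: "continuous_on UNIV (lipschitz_minorant g k)"
proof -
  have "k-lipschitz_on UNIV (lipschitz_minorant g k)"
    using k lipschitz_minorant_lipschitz by (auto simp: lipschitz_on_def dist_real_def)
  then show ?thesis by (rule lipschitz_on_continuous_on)
qed

end

text \<open>Points near \<open>s\<close> hardly lower the infimum, by continuity; distant points do not lower it at all once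
  the penalty \<open>k\<close> times the distance exceeds the oscillation \<open>2 B\<close> of \<open>g\<close>.\<close>

lemma tendsto_lipschitz_minorant:
  fixes g :: "'a::metric_space \<Rightarrow> real"
  assumes bound: "\<And>s. \<bar>g s\<bar> \<le> B" and cont: "isCont g s"
  shows "(\<lambda>k. lipschitz_minorant g (real k) s) \<longlonglongrightarrow> g s"
proof (rule tendstoI)
  fix e :: real assume "0 < e"
  then obtain d where d: "0 < d" "\<And>u. dist u s < d \<Longrightarrow> dist (g u) (g s) < e / 2"
    using cont by (metis (no_types) continuous_at_eps_delta half_gt_zero)
  have "\<forall>\<^sub>F k in sequentially. 2 * B / d \<le> real k"
    using filterlim_real_sequentially by (simp add: filterlim_at_top)
  then show "\<forall>\<^sub>F k in sequentially. dist (lipschitz_minorant g (real k) s) (g s) < e"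
  proof eventually_elim
    case (elim k)
    have "g s - e / 2 \<le> lipschitz_minorant g (real k) s"
      unfolding lipschitz_minorant_def
    proof (rule cINF_greatest)
      fix u
      show "g s - e / 2 \<le> g u + real k * dist s u"
      proof (cases "dist u s < d")
        case True
        have "\<bar>g u - g s\<bar> < e / 2" using d(2)[OF True] by (simp add: dist_real_def)
          then have "g s - e / 2 \<le> g u" by linarith
        then show ?thesis by (simp add: add_increasing2)
      next
        case False
        have "2 * B \<le> real k * d" using elim d(1) by (simp add: field_simps)
        also have "\<dots> \<le> real k * dist s u" using False by (intro mult_left_mono) (auto simp: dist_commute)
        finally show ?thesis using bound[of s] bound[of u] \<open>0 < e\<close> by linarith
      qed
    qed simp
    then show ?case
      using lipschitz_minorant_le[where g = g and s = s and k = "real k", OF bound] \<open>0 < e\<close> by (simp add: dist_real_def)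
  qed
qed

context prob_space
begin

text \<open>Up to probability \<open>e\<close> the property holds for all large \<open>n\<close>.  The exceptional points are enclosed in
  an event because the property need not define a measurable set.\<close>

definition mostly :: "real \<Rightarrow> (nat \<Rightarrow> 'a \<Rightarrow> bool) \<Rightarrow> bool" where
  "mostly e P \<longleftrightarrow> (\<exists>bad. (\<forall>n. bad n \<in> events) \<and> (\<forall>\<^sub>F n in sequentially. prob (bad n) \<le> e) \<and>
     (\<forall>\<^sub>F n in sequentially. \<forall>\<omega>\<in>space M - bad n. P n \<omega>))"

lemma mostlyI:
  assumes "\<And>n. bad n \<in> events" "\<forall>\<^sub>F n in sequentially. prob (bad n) \<le> e"
    "\<forall>\<^sub>F n in sequentially. \<forall>\<omega>\<in>space M - bad n. P n \<omega>"
  shows "mostly e P"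
  using assms unfolding mostly_def by blast

lemma mostly_always:
  assumes "0 \<le> e" "\<And>n \<omega>. \<omega> \<in> space M \<Longrightarrow> P n \<omega>"
  shows "mostly e P"
  by (rule mostlyI[of "\<lambda>_. {}"]) (use assms in auto)

lemma mostly_mono:
  assumes "mostly e P" "e \<le> e'" and imp: "\<And>n \<omega>. \<omega> \<in> space M \<Longrightarrow> P n \<omega> \<Longrightarrow> Q n \<omega>"
  shows "mostly e' Q"
proof -
  from assms(1) obtain bad where bad: "\<And>n. bad n \<in> events" "\<forall>\<^sub>F n in sequentially. prob (bad n) \<le> e"
    "\<forall>\<^sub>F n in sequentially. \<forall>\<omega>\<in>space M - bad n. P n \<omega>"
    unfolding mostly_def by blast
  show ?thesis
  proof (rule mostlyI[OF bad(1)])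
    show "\<forall>\<^sub>F n in sequentially. prob (bad n) \<le> e'"
      using bad(2) by eventually_elim (use assms(2) in simp)
    show "\<forall>\<^sub>F n in sequentially. \<forall>\<omega>\<in>space M - bad n. Q n \<omega>"
      using bad(3) by eventually_elim (use imp in blast)
  qed
qed

lemma mostly_Suc:
  assumes "mostly e P" shows "mostly e (\<lambda>n. P (Suc n))"
proof -
  from assms obtain bad where "\<And>n. bad n \<in> events" "\<forall>\<^sub>F n in sequentially. prob (bad n) \<le> e"
    "\<forall>\<^sub>F n in sequentially. \<forall>\<omega>\<in>space M - bad n. P n \<omega>"
    unfolding mostly_def by blast
  then show ?thesis
    by (intro mostlyI[of "\<lambda>n. bad (Suc n)"])
      (simp_all only: eventually_sequentially_Suc[of "\<lambda>n. prob (bad n) \<le> e"]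
        eventually_sequentially_Suc[of "\<lambda>n. \<forall>\<omega>\<in>space M - bad n. P n \<omega>"])
qed

lemma mostly_conj:
  assumes "mostly d P" "mostly e Q"
  shows "mostly (d + e) (\<lambda>n \<omega>. P n \<omega> \<and> Q n \<omega>)"
proof -
  from assms(1) obtain A where A: "\<And>n. A n \<in> events" "\<forall>\<^sub>F n in sequentially. prob (A n) \<le> d"
    "\<forall>\<^sub>F n in sequentially. \<forall>\<omega>\<in>space M - A n. P n \<omega>"
    unfolding mostly_def by blast
  from assms(2) obtain B where B: "\<And>n. B n \<in> events" "\<forall>\<^sub>F n in sequentially. prob (B n) \<le> e"
    "\<forall>\<^sub>F n in sequentially. \<forall>\<omega>\<in>space M - B n. Q n \<omega>"
    unfolding mostly_def by blast
  show ?thesis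
  proof (rule mostlyI[of "\<lambda>n. A n \<union> B n"])
    show "A n \<union> B n \<in> events" for n using A(1) B(1) by blast
    show "\<forall>\<^sub>F n in sequentially. prob (A n \<union> B n) \<le> d + e"
      using A(2) B(2)
    proof eventually_elim
      case (elim n)
      then show ?case using measure_Un_le[OF A(1)[of n] B(1)[of n]] by linarith
    qed
    show "\<forall>\<^sub>F n in sequentially. \<forall>\<omega>\<in>space M - (A n \<union> B n). P n \<omega> \<and> Q n \<omega>"
      using A(3) B(3) by eventually_elim blast
  qed
qed

lemma integrable_bounded:
  fixes f :: "'a \<Rightarrow> real"
  assumes "f \<in> borel_measurable M" "\<And>\<omega>. \<bar>f \<omega>\<bar> \<le> B"
  shows "integrable M f"
  using assms by (intro integrable_const_bound[where B = B]) auto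

text \<open>The variable \<open>Y\<close> is a measurable version of \<open>g \<circ> X\<close>, which need not itself be measurable.\<close>

lemma expectation_lipschitz_minorant:
  fixes g :: "'s::metric_space \<Rightarrow> real"
  assumes X: "X \<in> borel_measurable M"
    and bound: "\<And>s. \<bar>g s\<bar> \<le> B" and cont: "AE \<omega> in M. isCont g (X \<omega>)"
    and Y: "Y \<in> borel_measurable M" "AE \<omega> in M. Y \<omega> = g (X \<omega>)"
  shows "(\<lambda>k. expectation (\<lambda>\<omega>. lipschitz_minorant g (real k) (X \<omega>))) \<longlonglongrightarrow> expectation Y"
proof (rule integral_dominated_convergence)
  show "integrable M (\<lambda>_. B)" by simp
  show "(\<lambda>\<omega>. lipschitz_minorant g (real k) (X \<omega>)) \<in> borel_measurable M" for k
    using continuous_lipschitz_minorant[OF bound, of "real k"] X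
    by (intro measurable_compose[OF X] borel_measurable_continuous_onI) auto
  show "AE \<omega> in M. norm (lipschitz_minorant g (real k) (X \<omega>)) \<le> B" for k
    using lipschitz_minorant_bounded[where g = g and k = "real k", OF bound] by simp
  show "AE \<omega> in M. (\<lambda>k. lipschitz_minorant g (real k) (X \<omega>)) \<longlonglongrightarrow> Y \<omega>"
    using cont Y(2) by eventually_elim (use tendsto_lipschitz_minorant[of g, OF bound] in simp)
qed (rule Y(1))

text \<open>One half of the mapping theorem.  A Lipschitz minorant of \<open>g\<close> whose expectation at the limit almost
  reaches that of \<open>g\<close> is an admissible test function, and \<open>h n\<close> nearly dominates it at \<open>X n\<close>; so only
  the minorant, never \<open>g\<close> itself, is integrated along the sequence.\<close>

lemma converges_in_distribution_lower_bound:
  fixes X :: "nat \<Rightarrow> 'a \<Rightarrow> 's::metric_space" and g :: "'s \<Rightarrow> real"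
  assumes cd: "converges_in_distribution M X X'"
    and bound: "\<And>s. \<bar>g s\<bar> \<le> B" and cont: "AE \<omega> in M. isCont g (X' \<omega>)"
    and Y: "Y \<in> borel_measurable M" "AE \<omega> in M. Y \<omega> = g (X' \<omega>)"
    and h: "\<And>n. h n \<in> borel_measurable M" "\<And>n \<omega>. \<bar>h n \<omega>\<bar> \<le> B"
    and close: "\<And>e. 0 < e \<Longrightarrow> mostly e (\<lambda>n \<omega>. g (X n \<omega>) - e \<le> h n \<omega>)"
    and e: "0 < e"
  shows "\<forall>\<^sub>F n in sequentially. expectation Y - e < expectation (h n)"
proof -
  have X: "\<And>n. X n \<in> borel_measurable M" "X' \<in> borel_measurable M"
    using cd by (auto simp: converges_in_distribution_def)
  have B: "0 \<le> B" using bound[of undefined] by linarith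
  have "\<forall>\<^sub>F k in sequentially. expectation Y - e / 4
      < expectation (\<lambda>\<omega>. lipschitz_minorant g (real k) (X' \<omega>))"
    using e by (intro order_tendstoD(1)[OF expectation_lipschitz_minorant[OF X(2) bound cont Y]]) simp
  then obtain k where k: "expectation Y - e / 4
      < expectation (\<lambda>\<omega>. lipschitz_minorant g (real k) (X' \<omega>))"
    by (auto dest: eventually_happens)
  let ?f = "lipschitz_minorant g (real k)"
  have fc: "continuous_on UNIV ?f" by (intro continuous_lipschitz_minorant[OF bound]) simp
  have fb: "\<bar>?f s\<bar> \<le> B" for s by (intro lipschitz_minorant_bounded[OF bound]) simp
  have fm: "(\<lambda>\<omega>. ?f (X n \<omega>)) \<in> borel_measurable M" for n
    by (intro measurable_compose[OF X(1)] borel_measurable_continuous_onI fc)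
  have "(\<lambda>n. expectation (\<lambda>\<omega>. ?f (X n \<omega>))) \<longlonglongrightarrow> expectation (\<lambda>\<omega>. ?f (X' \<omega>))"
  proof -
    have "bounded (range ?f)" using fb by (intro boundedI[of _ B]) auto
    then show ?thesis using cd fc unfolding converges_in_distribution_def by blast
  qed
  from order_tendstoD(1)[OF this k]
  have ev1: "\<forall>\<^sub>F n in sequentially.
    expectation Y - e / 4 < expectation (\<lambda>\<omega>. ?f (X n \<omega>))" .
  define d where "d = min (e / 4) (e / (8 * (B + 1)))"
  have d: "0 < d" "d \<le> e / 4" "2 * B * d \<le> e / 4"
  proof -
    show "0 < d" using e B by (simp add: d_def)
    show "d \<le> e / 4" unfolding d_def by (rule min.cobounded1)
    have "2 * B * d \<le> 2 * (B + 1) * (e / (8 * (B + 1)))"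
      using B e by (intro mult_mono) (auto simp: d_def)
    also have "\<dots> = e / 4" using B by (simp add: field_simps)
    finally show "2 * B * d \<le> e / 4" .
  qed
  obtain bad where bad: "\<And>n. bad n \<in> events" "\<forall>\<^sub>F n in sequentially. prob (bad n) \<le> d"
     "\<forall>\<^sub>F n in sequentially. \<forall>\<omega>\<in>space M - bad n. g (X n \<omega>) - d \<le> h n \<omega>"
    using close[OF d(1)] unfolding mostly_def by blast
  show ?thesis using ev1 bad(2,3)
  proof eventually_elim
    case (elim n)
    have "expectation (\<lambda>\<omega>. ?f (X n \<omega>)) \<le> expectation (\<lambda>\<omega>. h n \<omega> + d + 2 * B * indicator (bad n) \<omega>)"
    proof (rule integral_mono)
      show "integrable M (\<lambda>\<omega>. ?f (X n \<omega>))" using fm fb by (rule integrable_bounded)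
      show "integrable M (\<lambda>\<omega>. h n \<omega> + d + 2 * B * indicator (bad n) \<omega>)"
        using bad(1)[of n] h by (intro Bochner_Integration.integrable_add integrable_bounded integrable_mult_right)
          (auto simp: emeasure_eq_measure)
      fix \<omega> assume w: "\<omega> \<in> space M"
      show "?f (X n \<omega>) \<le> h n \<omega> + d + 2 * B * indicator (bad n) \<omega>"
      proof (cases "\<omega> \<in> bad n")
        case True
        then show ?thesis using fb[of "X n \<omega>"] h(2)[of n \<omega>] d(1) by simp
      next
        case False
        then show ?thesis
          using elim(3) w lipschitz_minorant_le[where g = g and s = "X n \<omega>" and k = "real k", OF bound] by force
      qed
    qed
    also have "\<dots> = expectation (h n) + d + 2 * B * prob (bad n)"
    proof -
      have "integrable M (h n)" using h by (rule integrable_bounded)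
      moreover have "integrable M (indicator (bad n) :: _ \<Rightarrow> real)"
        using bad(1)[of n] by (simp add: emeasure_eq_measure)
      ultimately show ?thesis
        using bad(1)[of n] by (simp add: prob_space Int_absorb2 sets.sets_into_space)
    qed
    also have "\<dots> \<le> expectation (h n) + d + 2 * B * d"
      using elim(2) B by (intro add_left_mono mult_left_mono) auto
    finally show ?case using elim(1) d by linarith
  qed
qed

text \<open>The continuous mapping theorem and Slutsky's lemma in one.  Lipschitz minorants enter twice: a test
  function \<open>f\<close> on the target is first replaced by one, so that closeness of points gives closeness of
  values; its composition with \<open>\<Phi>\<close> is then bounded below along the sequence as above.  The upper bound
  is the lower bound for \<open>- f\<close>.\<close>

theorem converges_in_distribution_map:
  fixes X :: "nat \<Rightarrow> 'a \<Rightarrow> 's::metric_space" and \<Phi> :: "'s \<Rightarrow> 't::metric_space"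
  assumes cd: "converges_in_distribution M X X'"
    and W: "\<And>n. W n \<in> borel_measurable M" and W': "W' \<in> borel_measurable M"
    and eq: "AE \<omega> in M. W' \<omega> = \<Phi> (X' \<omega>)"
    and cont: "AE \<omega> in M. isCont \<Phi> (X' \<omega>)"
    and close: "\<And>e. 0 < e \<Longrightarrow> mostly e (\<lambda>n \<omega>. dist (W n \<omega>) (\<Phi> (X n \<omega>)) \<le> e)"
  shows "converges_in_distribution M W W'"
proof -
  have lower: "\<forall>\<^sub>F n in sequentially. expectation (\<lambda>\<omega>. f (W' \<omega>)) - e < expectation (\<lambda>\<omega>. f (W n \<omega>))"
    if f: "continuous_on UNIV f" "\<And>t. \<bar>f t\<bar> \<le> B" and e: "0 < e" for f :: "'t \<Rightarrow> real" and B e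
  proof -
    have W'_lim: "(\<lambda>k. expectation (\<lambda>\<omega>. lipschitz_minorant f (real k) (W' \<omega>))) \<longlonglongrightarrow> expectation (\<lambda>\<omega>. f (W' \<omega>))"
      using f by (intro expectation_lipschitz_minorant[OF W' f(2)] measurable_compose[OF W'] borel_measurable_continuous_onI)
        (auto simp: continuous_on_eq_continuous_at)
    have "\<forall>\<^sub>F k in sequentially. expectation (\<lambda>\<omega>. f (W' \<omega>)) - e / 2
        < expectation (\<lambda>\<omega>. lipschitz_minorant f (real k) (W' \<omega>))"
      using e by (intro order_tendstoD(1)[OF W'_lim]) simp
    then obtain k where k: "expectation (\<lambda>\<omega>. f (W' \<omega>)) - e / 2
        < expectation (\<lambda>\<omega>. lipschitz_minorant f (real k) (W' \<omega>))"
      by (auto dest: eventually_happens)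
    let ?f = "lipschitz_minorant f (real k)"
    have fc: "continuous_on UNIV ?f" by (intro continuous_lipschitz_minorant[OF f(2)]) simp
    have fb: "\<bar>?f s\<bar> \<le> B" for s by (intro lipschitz_minorant_bounded[OF f(2)]) simp
    have fm: "(\<lambda>\<omega>. ?f (Z \<omega>)) \<in> borel_measurable M" if "Z \<in> borel_measurable M" for Z
      by (intro measurable_compose[OF that] borel_measurable_continuous_onI fc)
    have eq': "AE \<omega> in M. ?f (W' \<omega>) = ?f (\<Phi> (X' \<omega>))" using eq by eventually_elim simp
    have int: "integrable M (\<lambda>\<omega>. ?f (Z \<omega>))" if "Z \<in> borel_measurable M" for Z
      using fm[OF that] fb by (rule integrable_bounded)
    have le: "expectation (\<lambda>\<omega>. ?f (W n \<omega>)) \<le> expectation (\<lambda>\<omega>. f (W n \<omega>))" for n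
    proof (rule integral_mono[OF int[OF W]])
      show "integrable M (\<lambda>\<omega>. f (W n \<omega>))"
        using f by (intro integrable_bounded[of _ B] measurable_compose[OF W] borel_measurable_continuous_onI) auto
      show "?f (W n \<omega>) \<le> f (W n \<omega>)" for \<omega>
        by (rule lipschitz_minorant_le[OF f(2)]) simp
    qed
    have "\<forall>\<^sub>F n in sequentially. expectation (\<lambda>\<omega>. ?f (W' \<omega>)) - e / 2 < expectation (\<lambda>\<omega>. ?f (W n \<omega>))"
    proof (rule converges_in_distribution_lower_bound[OF cd, where g = "\<lambda>s. ?f (\<Phi> s)" and B = B])
      show "AE \<omega> in M. isCont (\<lambda>s. ?f (\<Phi> s)) (X' \<omega>)"
        using cont
      proof eventually_elim
        case (elim \<omega>)
        then show ?case
          using fc by (intro isCont_o2[of _ \<Phi> ?f]) (auto simp: continuous_on_eq_continuous_at)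
      qed
      show "mostly d (\<lambda>n \<omega>. ?f (\<Phi> (X n \<omega>)) - d \<le> ?f (W n \<omega>))" if "0 < d" for d
      proof -
        define d' where "d' = min d (d / (real k + 1))"
        have d': "0 < d'" "d' \<le> d" "real k * d' \<le> d"
        proof -
          show "0 < d'" "d' \<le> d" using that by (simp_all add: d'_def)
          have "real k * d' \<le> (real k + 1) * (d / (real k + 1))"
            using that by (intro mult_mono) (auto simp: d'_def)
          then show "real k * d' \<le> d" by simp
        qed
        have "?f (\<Phi> (X n \<omega>)) - d \<le> ?f (W n \<omega>)" if "dist (W n \<omega>) (\<Phi> (X n \<omega>)) \<le> d'" for n \<omega>
        proof -
          have "\<bar>?f (W n \<omega>) - ?f (\<Phi> (X n \<omega>))\<bar> \<le> real k * dist (W n \<omega>) (\<Phi> (X n \<omega>))"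
            by (rule lipschitz_minorant_lipschitz[OF f(2)]) simp
          also have "\<dots> \<le> real k * d'" using that by (rule mult_left_mono) simp
          finally show ?thesis using d'(3) by linarith
        qed
        then show ?thesis by (rule mostly_mono[OF close[OF d'(1)] d'(2)])
      qed
      show "\<bar>?f (\<Phi> s)\<bar> \<le> B" "\<bar>?f (W n \<omega>)\<bar> \<le> B" for s n \<omega> by (rule fb)+
      show "(\<lambda>\<omega>. ?f (W n \<omega>)) \<in> borel_measurable M" for n by (rule fm[OF W])
      show "0 < e / 2" using e by simp
    qed (fact fm[OF W'] eq')+
    then show ?thesis
    proof eventually_elim
      case (elim n)
      then show ?case using k le[of n] by linarith
    qed
  qed
  show ?thesis
    unfolding converges_in_distribution_def
  proof (intro conjI allI impI W W')
    fix f :: "'t \<Rightarrow> real" assume f: "continuous_on UNIV f" "bounded (range f)"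
    then obtain B where B: "\<And>t. \<bar>f t\<bar> \<le> B" by (auto simp: bounded_iff)
    show "(\<lambda>n. expectation (\<lambda>\<omega>. f (W n \<omega>))) \<longlonglongrightarrow> expectation (\<lambda>\<omega>. f (W' \<omega>))"
    proof (rule order_tendstoI)
      fix a assume "a < expectation (\<lambda>\<omega>. f (W' \<omega>))"
      then show "\<forall>\<^sub>F n in sequentially. a < expectation (\<lambda>\<omega>. f (W n \<omega>))"
        using lower[OF f(1) B, of "expectation (\<lambda>\<omega>. f (W' \<omega>)) - a"] by simp
    next
      fix a assume "expectation (\<lambda>\<omega>. f (W' \<omega>)) < a"
      then show "\<forall>\<^sub>F n in sequentially. expectation (\<lambda>\<omega>. f (W n \<omega>)) < a"
        using lower[of "\<lambda>t. - f t" B "a - expectation (\<lambda>\<omega>. f (W' \<omega>))"] f(1) B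
        by (auto intro: continuous_intros)
    qed
  qed
qed

end

section \<open>The Skorohod topology near continuous paths\<close>

lemma path_tendsto_right: "(path_of x \<longlongrightarrow> path_of x t) (at_right t)"
proof (cases "0 \<le> t")
  case False
  then have "\<forall>\<^sub>F s in at_right t. path_of x s = 0"
    using eventually_at_right_real[of t 0] by (auto elim: eventually_mono simp: path_neg)
  then show ?thesis using False by (simp add: path_neg tendsto_eventually)
qed (rule is_cadlagD(1)[OF is_cadlag_path])

lemma path_tendsto_left: "\<exists>l. (path_of x \<longlongrightarrow> l) (at_left t)"
proof (cases "0 < t")
  case False
  then have "\<forall>\<^sub>F s in at_left t. path_of x s = 0"
    by (auto simp: eventually_at_filter path_neg)
  then show ?thesis by (intro exI[of _ 0] tendsto_eventually)
qed (rule is_cadlagD(2)[OF is_cadlag_path])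

lemma path_bounded_by: obtains B where "0 \<le> B" "\<And>t. t \<le> T \<Longrightarrow> \<bar>path_of x t\<bar> \<le> B"
proof -
  obtain B where B: "\<And>t. t \<in> {0..T} \<Longrightarrow> \<bar>path_of x t\<bar> \<le> B"
    using bounded_path[of x 0 T] by (fastforce simp: bounded_iff)
  show thesis
  proof
    show "0 \<le> max B 0" by simp
    show "\<bar>path_of x t\<bar> \<le> max B 0" if "t \<le> T" for t
      using B[of t] that by (cases "t < 0") (auto simp: path_neg)
  qed
qed

text \<open>A path with right limits is the pointwise limit of its evaluations at the next grid point
  strictly to the right, each of which is a function of the integer part.\<close>

lemma borel_measurable_path [measurable]: "path_of x \<in> borel_measurable borel"
proof (rule borel_measurable_LIMSEQ_real)
  let ?g = "\<lambda>(n::nat) t::real. (real_of_int \<lfloor>t * Suc n\<rfloor> + 1) / Suc n"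
  show "(\<lambda>n. path_of x (?g n t)) \<longlonglongrightarrow> path_of x t" for t
  proof (rule filterlim_compose[OF path_tendsto_right])
    have b: "t < ?g n t" "?g n t \<le> t + 1 / Suc n" for n
    proof -
      show "t < ?g n t"
        using floor_correct[of "t * Suc n"] by (simp add: pos_less_divide_eq del: of_nat_Suc)
      have "?g n t \<le> (t * Suc n + 1) / Suc n"
        using floor_correct[of "t * Suc n"] by (intro divide_right_mono) auto
      also have "\<dots> = t + 1 / Suc n" by (simp add: add_divide_distrib del: of_nat_Suc)
      finally show "?g n t \<le> t + 1 / Suc n" .
    qed
    have "(\<lambda>n. ?g n t) \<longlonglongrightarrow> t"
    proof (rule tendsto_sandwich[of "\<lambda>_. t" _ _ "\<lambda>n. t + 1 / Suc n"])
      show "(\<lambda>n. t + 1 / Suc n) \<longlonglongrightarrow> t"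
        using LIMSEQ_inverse_real_of_nat_add[of t] by (simp add: inverse_eq_divide)
      show "\<forall>\<^sub>F n in sequentially. t \<le> ?g n t" "\<forall>\<^sub>F n in sequentially. ?g n t \<le> t + 1 / Suc n"
        using b by (auto intro!: always_eventually less_imp_le simp del: of_nat_Suc)
    qed simp
    then show "LIM n sequentially. ?g n t :> at_right t"
      unfolding filterlim_at using b(1)[THEN less_imp_neq] b(1)
      by (intro conjI always_eventually allI) (auto simp: eq_commute[of _ t] simp del: of_nat_Suc)
  qed
  show "(\<lambda>t. path_of x (?g n t)) \<in> borel_measurable borel" for n
    by (rule measurable_compose[where g = "\<lambda>i. path_of x ((real_of_int i + 1) / Suc n)" and N = "count_space UNIV"])
      (auto simp del: of_nat_Suc)
qed

lemma cadlag_dist_summable: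
  "summable (\<lambda>m. (1/2) ^ Suc m *
     min 1 (skorohod_dist (real (Suc m)) (damped (Suc m) (path_of x)) (damped (Suc m) (path_of y))))"
  (is "summable ?s")
proof (rule summable_comparison_test')
  show "summable (\<lambda>m. (1/2) ^ Suc m :: real)"
    using summable_mult[OF summable_geometric[of "1/2 :: real"], of "1/2"] by simp
  fix m :: nat
  have "0 \<le> skorohod_dist (real (Suc m)) (damped (Suc m) (path_of x)) (damped (Suc m) (path_of y))"
    by (intro skorohod_dist_nonneg bounded_damped) simp
  then show "norm (?s m) \<le> (1/2) ^ Suc m"
    by (simp add: abs_mult del: of_nat_Suc)
qed

lemma skorohod_dist_le_cadlag_dist:
  assumes "dist x y < (1/2) ^ Suc m * e" "e \<le> 1"
  shows "skorohod_dist (real (Suc m)) (damped (Suc m) (path_of x)) (damped (Suc m) (path_of y)) < e"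
proof -
  let ?s = "\<lambda>m. (1/2) ^ Suc m *
     min 1 (skorohod_dist (real (Suc m)) (damped (Suc m) (path_of x)) (damped (Suc m) (path_of y)))"
  have nn: "0 \<le> ?s m" for m
    using skorohod_dist_nonneg[of "real (Suc m)" "damped (Suc m) (path_of x)" "damped (Suc m) (path_of y)"]
    by (simp add: bounded_damped del: of_nat_Suc)
  have "?s m \<le> dist x y"
    unfolding dist_cadlag_def
    using sum_le_suminf[OF cadlag_dist_summable, of "{m}" x y] nn by (simp del: of_nat_Suc power_Suc)
  then have "?s m < (1/2) ^ Suc m * e" using assms(1) by linarith
  then have "min 1 (skorohod_dist (real (Suc m)) (damped (Suc m) (path_of x)) (damped (Suc m) (path_of y))) < e"
    by (rule mult_left_less_imp_less) simp
  then show ?thesis using assms(2) by (simp add: min_def del: of_nat_Suc split: if_splits)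
qed

text \<open>Damping to the horizon \<open>Suc m\<close> does not affect times before \<open>m\<close>; the margin of 2 leaves room for the
  displacement by the time change.\<close>

lemma cadlag_dist_lessE:
  assumes close: "dist x y < (1/2) ^ Suc m * d" and d: "d \<le> 1" and t: "0 \<le> t" "t + 2 \<le> real m"
  obtains s where "0 \<le> s" "\<bar>s - t\<bar> < d" "\<bar>path_of x t - path_of y s\<bar> < d"
proof -
  obtain \<gamma> where g: "\<gamma> \<in> time_changes (real (Suc m))"
    and c: "skorohod_cost (real (Suc m)) (damped (Suc m) (path_of x)) (damped (Suc m) (path_of y)) \<gamma> < d"
    using skorohod_dist_lessE[OF skorohod_dist_le_cadlag_dist[OF close d]] by blast
  have t': "t \<in> {0..real (Suc m)}" using t by auto
  note * = skorohod_cost_ge[OF bounded_damped bounded_damped g t', of "Suc m" x "Suc m" y]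
  show thesis
  proof
    show "0 \<le> \<gamma> t" using time_changesD(4)[OF g t'] by simp
    show near: "\<bar>\<gamma> t - t\<bar> < d" using * c by linarith
    then have "damped (Suc m) (path_of x) t = path_of x t" "damped (Suc m) (path_of y) (\<gamma> t) = path_of y (\<gamma> t)"
      using d t by (auto simp: damped_def)
    then show "\<bar>path_of x t - path_of y (\<gamma> t)\<bar> < d" using * c by linarith
  qed
qed

text \<open>The terms beyond index \<open>M\<close> of the series contribute at most the tail of the geometric series.\<close>

lemma cadlag_dist_le:
  assumes "0 \<le> e"
    and "\<And>m. m < M \<Longrightarrow>
      skorohod_dist (real (Suc m)) (damped (Suc m) (path_of x)) (damped (Suc m) (path_of y)) \<le> e"
  shows "dist x y \<le> e + (1/2) ^ M"
proof -
  let ?s = "\<lambda>m. (1/2) ^ Suc m *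
     min 1 (skorohod_dist (real (Suc m)) (damped (Suc m) (path_of x)) (damped (Suc m) (path_of y)))"
  have geo: "summable (\<lambda>m. (1/2) ^ Suc m :: real)" "(\<Sum>m. (1/2) ^ Suc m :: real) = 1"
    using sums_mult[OF geometric_sums[of "1/2 :: real"], of "1/2"] by (auto simp: sums_iff)
  have "dist x y = suminf ?s" by (simp add: dist_cadlag_def)
  also have "\<dots> = (\<Sum>m. ?s (m + M)) + sum ?s {..<M}"
    by (rule suminf_split_initial_segment[OF cadlag_dist_summable])
  also have "(\<Sum>m. ?s (m + M)) \<le> (\<Sum>m. (1/2) ^ M * (1/2) ^ Suc m)"
  proof (rule suminf_le)
    show "summable (\<lambda>m. ?s (m + M))" using cadlag_dist_summable[of x y] by (subst summable_iff_shift)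
    show "summable (\<lambda>m. (1/2) ^ M * (1/2) ^ Suc m :: real)" using geo(1) by (rule summable_mult)
    show "?s (m + M) \<le> (1/2) ^ M * (1/2) ^ Suc m" for m
    proof -
      have "?s (m + M) \<le> (1/2) ^ Suc (m + M) * 1" by (intro mult_left_mono) auto
      then show ?thesis by (simp add: power_add)
    qed
  qed
  also have "(\<Sum>m. (1/2) ^ M * (1/2) ^ Suc m :: real) = (1/2) ^ M"
    using suminf_mult[OF geo(1), of "(1/2) ^ M"] geo(2) by simp
  also have "sum ?s {..<M} \<le> sum (\<lambda>m. (1/2) ^ Suc m * e) {..<M}"
    using assms by (intro sum_mono mult_left_mono) (auto simp: min_le_iff_disj simp del: of_nat_Suc)
  also have "\<dots> = e * sum (\<lambda>m. (1/2) ^ Suc m) {..<M}" by (simp add: sum_distrib_left mult.commute)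
  also have "\<dots> \<le> e * 1"
  proof (intro mult_left_mono assms)
    show "sum (\<lambda>m. (1/2) ^ Suc m :: real) {..<M} \<le> 1"
      using sum_le_suminf[OF geo(1), of "{..<M}"] geo(2) by simp
  qed
  finally show ?thesis by simp
qed

lemma cadlag_dist_le_uniform:
  assumes "\<And>t. 0 \<le> t \<Longrightarrow> t \<le> real M \<Longrightarrow> \<bar>path_of x t - path_of y t\<bar> \<le> e"
  shows "dist x y \<le> e + (1/2) ^ M"
proof (rule cadlag_dist_le)
  show e: "0 \<le> e" using assms[of 0] by simp
  fix m assume m: "m < M"
  have "skorohod_cost (real (Suc m)) (damped (Suc m) (path_of x)) (damped (Suc m) (path_of y)) (\<lambda>t. t) \<le> e"
  proof (rule skorohod_cost_le)
    fix t assume t: "t \<in> {0..real (Suc m)}"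
    have "\<bar>damped (Suc m) (path_of x) t - damped (Suc m) (path_of y) t\<bar>
        = max 0 (min 1 (real (Suc m) - t)) * \<bar>path_of x t - path_of y t\<bar>"
      unfolding damped_def by (simp add: abs_mult flip: right_diff_distrib)
    also have "\<dots> \<le> 1 * e" using assms[of t] t m by (intro mult_mono) auto
    finally show "\<bar>damped (Suc m) (path_of x) t - damped (Suc m) (path_of y) t\<bar> \<le> e" by simp
  qed (use e in auto)
  then show "skorohod_dist (real (Suc m)) (damped (Suc m) (path_of x)) (damped (Suc m) (path_of y)) \<le> e"
    using skorohod_dist_le[OF _ bounded_damped bounded_damped id_time_changes, of "Suc m" "Suc m" x "Suc m" y]
    by (simp del: of_nat_Suc)
qed

text \<open>The time change moves times by little, and uniform continuity of the limit path absorbs this.\<close>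

lemma uniformly_close_near_continuous:
  assumes a: "continuous_on {0..} (path_of a)" and e: "0 < e"
  obtains d where "0 < d"
    "\<And>y t. dist y a < d \<Longrightarrow> t \<le> T \<Longrightarrow> \<bar>path_of y t - path_of a t\<bar> \<le> e"
proof -
  obtain m where m: "T + 2 < real m" using reals_Archimedean2 by blast
  have "uniformly_continuous_on {0..real (Suc m)} (path_of a)"
    by (intro compact_uniformly_continuous continuous_on_subset[OF a]) auto
  then obtain d where d: "0 < d"
    "\<And>s t. s \<in> {0..real (Suc m)} \<Longrightarrow> t \<in> {0..real (Suc m)} \<Longrightarrow> dist t s < d
       \<Longrightarrow> dist (path_of a t) (path_of a s) < e / 2"
    using e unfolding uniformly_continuous_on_def by (metis half_gt_zero)
  define d' where "d' = min (min d 1) (e / 2)"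
  have d': "0 < d'" "d' \<le> d" "d' \<le> 1" "d' \<le> e / 2" using d e by (auto simp: d'_def)
  show thesis
  proof
    show "0 < (1/2) ^ Suc m * d'" using d' by simp
    fix y t assume y: "dist y a < (1/2) ^ Suc m * d'" and t: "t \<le> T"
    show "\<bar>path_of y t - path_of a t\<bar> \<le> e"
    proof (cases "t < 0")
      case True then show ?thesis using e by (simp add: path_neg)
    next
      case False
      have "t + 2 \<le> real m" using t m by simp
      from cadlag_dist_lessE[OF y d'(3) _ this]
      obtain u where u: "0 \<le> u" "\<bar>u - t\<bar> < d'" "\<bar>path_of y t - path_of a u\<bar> < d'" using False by auto
      have "dist (path_of a u) (path_of a t) < e / 2"
        using u d' False t m by (intro d(2)) (auto simp: dist_real_def)
      moreover have "\<bar>path_of y t - path_of a u\<bar> < e / 2" using u(3) d'(4) by linarith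
      ultimately show ?thesis unfolding dist_real_def by linarith
    qed
  qed
qed

text \<open>A value exceeding \<open>c\<close> inside an open time interval survives a small change of path and
  time, so the supremum over the interval is lower semicontinuous; right continuity recovers the
  value at a time from such suprema.\<close>

lemma open_exceeds: "open {x. \<exists>s\<in>{t<..<u}. 0 \<le> s \<and> c < path_of x s}"
proof (subst open_dist, safe)
  fix x s assume s: "s \<in> {t<..<u}" "0 \<le> s" and c: "c < path_of x s"
  obtain s' where s': "s \<le> s'" "s' \<in> {max t 0<..<u}" "c < path_of x s'"
  proof -
    have "\<forall>\<^sub>F r in at_right s. c < path_of x r"
      using c by (rule order_tendstoD(1)[OF path_tendsto_right])
    moreover have "\<forall>\<^sub>F r in at_right s. r \<in> {s<..<u}" using s by (intro eventually_at_right_real) simp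
    ultimately have "\<forall>\<^sub>F r in at_right s. c < path_of x r \<and> r \<in> {s<..<u}" by (rule eventually_conj)
    from eventually_happens'[OF trivial_limit_at_right_real this]
    obtain r where "c < path_of x r" "r < u" "s < r" by auto
    then show thesis using s by (intro that[of r]) auto
  qed
  obtain m where m: "s' + 2 < real m" using reals_Archimedean2 by blast
  define d where "d = min (min 1 (path_of x s' - c)) (min (s' - max t 0) (u - s'))"
  have d: "0 < d" "d \<le> 1" "d \<le> path_of x s' - c" "d \<le> s' - max t 0" "d \<le> u - s'"
    using s' by (auto simp: d_def)
  show "\<exists>e>0. \<forall>y. dist y x < e \<longrightarrow> y \<in> {x. \<exists>s\<in>{t<..<u}. 0 \<le> s \<and> c < path_of x s}"
  proof (intro exI[of _ "(1/2) ^ Suc m * d"] conjI allI impI)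
    show "0 < (1/2) ^ Suc m * d" using d by simp
    fix y assume "dist y x < (1/2) ^ Suc m * d"
    then have y: "dist x y < (1/2) ^ Suc m * d" by (simp add: dist_commute)
    have "s' + 2 \<le> real m" "0 \<le> s'" using m s' by auto
    then obtain w where w: "0 \<le> w" "\<bar>w - s'\<bar> < d" "\<bar>path_of x s' - path_of y w\<bar> < d"
      using cadlag_dist_lessE[OF y d(2)] by metis
    have "c < path_of y w" using w(3) d(3) by linarith
    moreover have "w \<in> {t<..<u}" using w(2) d(4,5) by (auto simp: abs_less_iff)
    moreover note w(1)
    ultimately show "y \<in> {x. \<exists>s\<in>{t<..<u}. 0 \<le> s \<and> c < path_of x s}" by blast
  qed
qed

lemma borel_measurable_eval [measurable]: "(\<lambda>x. path_of x t) \<in> borel_measurable borel"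
proof (cases "t < 0")
  case True then show ?thesis by (simp add: path_neg)
next
  case False
  have "{x. c < path_of x t} =
     (\<Union>k. \<Inter>n. {x. \<exists>s\<in>{t<..<t + 1 / Suc n}. 0 \<le> s \<and> c + 1 / Suc k < path_of x s})"
    (is "?L = (\<Union>k. \<Inter>n. ?R k n)") for c
  proof (intro set_eqI iffI)
    fix x assume "x \<in> ?L"
    then have "0 < path_of x t - c" by simp
    from reals_Archimedean[OF this] obtain k where k: "inverse (real (Suc k)) < path_of x t - c" ..
    have "x \<in> ?R k n" for n
    proof -
      have "c + 1 / Suc k < path_of x t" using k by (simp add: inverse_eq_divide del: of_nat_Suc)
      then have "\<forall>\<^sub>F r in at_right t. c + 1 / Suc k < path_of x r"
        by (rule order_tendstoD(1)[OF path_tendsto_right])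
      moreover have "\<forall>\<^sub>F r in at_right t. r \<in> {t<..<t + 1 / Suc n}"
        by (intro eventually_at_right_real) simp
      ultimately have "\<forall>\<^sub>F r in at_right t. c + 1 / Suc k < path_of x r \<and> r \<in> {t<..<t + 1 / Suc n}"
        by (rule eventually_conj)
      from eventually_happens'[OF trivial_limit_at_right_real this]
      obtain r where r: "c + 1 / Suc k < path_of x r" "r \<in> {t<..<t + 1 / Suc n}" by blast
      moreover have "0 \<le> r" using False r(2) by simp
      ultimately show ?thesis by blast
    qed
    then show "x \<in> (\<Union>k. \<Inter>n. ?R k n)" by blast
  next
    fix x assume "x \<in> (\<Union>k. \<Inter>n. ?R k n)"
    then obtain k where k: "\<And>n. x \<in> ?R k n" by blast
    have "c + 1 / Suc k \<le> path_of x t"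
    proof (rule ccontr)
      assume "\<not> c + 1 / Suc k \<le> path_of x t"
      then have "path_of x t < c + 1 / Suc k" by simp
      then have "\<forall>\<^sub>F r in at_right t. path_of x r < c + 1 / Suc k"
        by (rule order_tendstoD(2)[OF path_tendsto_right])
      then obtain b where b: "t < b" "\<And>r. t < r \<Longrightarrow> r < b \<Longrightarrow> path_of x r < c + 1 / Suc k"
        unfolding eventually_at_right[OF less_add_one[of t]] by blast
      have "0 < b - t" using b(1) by simp
      from reals_Archimedean[OF this] obtain n where n: "inverse (real (Suc n)) < b - t" ..
      from k[of n] obtain s where s: "t < s" "s < t + 1 / Suc n" "c + 1 / Suc k < path_of x s" by auto
      have "s < b" using n s(2) by (simp add: inverse_eq_divide del: of_nat_Suc)
      from b(2)[OF s(1) this] s(3) show False by linarith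
    qed
    moreover have "0 < 1 / real (Suc k)" by simp
    ultimately have "c < path_of x t" by linarith
    then show "x \<in> ?L" by simp
  qed
  moreover have "(\<Union>k. \<Inter>n. {x. \<exists>s\<in>{t<..<t + 1 / Suc n}. 0 \<le> s \<and> c + 1 / Suc k < path_of x s}) \<in> sets borel" for c
    by (intro sets.countable_UN sets.countable_INT) (use borel_open[OF open_exceeds] in blast)+
  ultimately have "{x. c < path_of x t} \<in> sets borel" for c by (simp only:)
  then show ?thesis by (simp add: borel_measurable_iff_greater)
qed

section \<open>The fluid equation\<close>

lemma is_cadlag_diff:
  assumes "is_cadlag x" "is_cadlag y"
  shows "is_cadlag (\<lambda>t. x t - y t)"
proof (rule is_cadlagI)
  show "((\<lambda>t. x t - y t) \<longlongrightarrow> x t - y t) (at_right t)" if "0 \<le> t" for t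
    using that by (intro tendsto_diff is_cadlagD(1) assms)
  show "\<exists>l. ((\<lambda>t. x t - y t) \<longlongrightarrow> l) (at_left t)" if "0 < t" for t
    using is_cadlagD(2)[OF assms(1) that] is_cadlagD(2)[OF assms(2) that] by (blast intro: tendsto_diff)
qed

lemma is_cadlag_cmult:
  assumes "is_cadlag x"
  shows "is_cadlag (\<lambda>t. c * x t)"
proof (rule is_cadlagI)
  show "((\<lambda>t. c * x t) \<longlongrightarrow> c * x t) (at_right t)" if "0 \<le> t" for t
    using that by (intro tendsto_mult_left is_cadlagD(1) assms)
  show "\<exists>l. ((\<lambda>t. c * x t) \<longlongrightarrow> l) (at_left t)" if "0 < t" for t
    using is_cadlagD(2)[OF assms that] by (blast intro: tendsto_mult_left)
qed

lemma is_cadlag_const: "is_cadlag (\<lambda>_. c)"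
  by (auto simp: is_cadlag_def)

text \<open>Right limits pass to a uniform limit since their values are known; left limits, with unknown values,
  come from the Cauchy criterion.\<close>

lemma is_cadlag_uniform_limit:
  assumes f: "\<And>n. is_cadlag (f n)" and lim: "\<And>T. uniform_limit {0..T} f x sequentially"
  shows "is_cadlag x"
proof (rule is_cadlagI)
  fix t :: real assume t: "0 \<le> t"
  show "(x \<longlongrightarrow> x t) (at_right t)"
  proof (rule swap_uniform_limit'[OF _ _ lim])
    show "\<forall>\<^sub>F n in sequentially. (f n \<longlongrightarrow> f n t) (at_right t)"
      using is_cadlagD(1)[OF f t] by simp
    show "(\<lambda>n. f n t) \<longlonglongrightarrow> x t"
      by (rule tendsto_uniform_limitI[OF lim[of t]]) (use t in simp)
    show "\<forall>\<^sub>F s in at_right t. s \<in> {0..t + 1}"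
      using eventually_at_right_real[OF less_add_one[of t]] by eventually_elim (use t in auto)
  qed simp
next
  fix t :: real assume t: "0 < t"
  have "cauchy_filter (filtermap x (at_left t))"
    unfolding cauchy_filter_metric_filtermap
  proof (intro allI impI)
    fix e :: real assume "0 < e"
    then have "\<forall>\<^sub>F n in sequentially. \<forall>s\<in>{0..t}. dist (f n s) (x s) < e / 4"
      by (intro uniform_limitD[OF lim]) simp
    from eventually_happens'[OF sequentially_bot this]
    obtain n where n: "\<And>s. s \<in> {0..t} \<Longrightarrow> dist (f n s) (x s) < e / 4" by blast
    from is_cadlagD(2)[OF f t] obtain l where "(f n \<longlongrightarrow> l) (at_left t)" ..
    then have "\<forall>\<^sub>F s in at_left t. dist (f n s) l < e / 4" by (rule tendstoD) (use \<open>0 < e\<close> in simp)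
    then have "\<forall>\<^sub>F s in at_left t. dist (x s) l < e / 2"
      using eventually_at_left_real[OF t]
    proof eventually_elim
      case (elim s)
      have "dist (x s) l \<le> dist (f n s) (x s) + dist (f n s) l" by (rule dist_triangle3)
      then show ?case using n[of s] elim by simp
    qed
    moreover have "dist (x s) (x u) < e" if "dist (x s) l < e / 2 \<and> dist (x u) l < e / 2" for s u
      using dist_triangle2[of "x s" "x u" l] that by linarith
    ultimately show "\<exists>P. eventually P (at_left t) \<and> (\<forall>s u. P s \<and> P u \<longrightarrow> dist (x s) (x u) < e)"
      by blast
  qed
  moreover have "filtermap x (at_left t) \<noteq> bot"
    by (simp add: filtermap_bot_iff)
  ultimately show "\<exists>l. (x \<longlongrightarrow> l) (at_left t)"
    using complete_UNIV[where 'a = real] unfolding complete_uniform filterlim_def by auto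
qed

text \<open>The fluid waiting for service when the servers have total capacity 1.\<close>

definition excess :: "cadlag \<Rightarrow> cadlag" where
  "excess x = cadlag_of (\<lambda>t. max (path_of x t - 1) 0)"

lemma path_excess: "path_of (excess x) t = max (path_of x t - 1) 0"
proof -
  have "is_cadlag (\<lambda>t. max (path_of x t - 1) 0)"
  proof (rule is_cadlagI)
    fix t :: real
    show "((\<lambda>t. max (path_of x t - 1) 0) \<longlongrightarrow> max (path_of x t - 1) 0) (at_right t)"
      by (intro tendsto_intros path_tendsto_right)
    obtain l where "(path_of x \<longlongrightarrow> l) (at_left t)" using path_tendsto_left by blast
    then have "((\<lambda>t. max (path_of x t - 1) 0) \<longlongrightarrow> max (l - 1) 0) (at_left t)"
      by (intro tendsto_intros)
    then show "\<exists>l. ((\<lambda>t. max (path_of x t - 1) 0) \<longlongrightarrow> l) (at_left t)" by blast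
  qed
  then show ?thesis by (simp add: excess_def path_cadlag_of path_neg)
qed

text \<open>Integration over the whole line equals integration over \<open>[0, t]\<close> for a law on the half-line and a path
  that vanishes at negative times.\<close>

definition convolution :: "real measure \<Rightarrow> (real \<Rightarrow> real) \<Rightarrow> real \<Rightarrow> real" where
  "convolution \<nu> f t = (LINT s|\<nu>. f (t - s))"

locale service_law = real_distribution \<nu> for \<nu> :: "real measure" +
  assumes nonneg: "AE s in \<nu>. 0 \<le> s" and nontrivial: "\<not> (AE s in \<nu>. s = 0)"
begin

lemma conv_integrable:
  fixes f :: "real \<Rightarrow> real"
  assumes [measurable]: "f \<in> borel_measurable borel" and "\<And>u. u \<le> t \<Longrightarrow> \<bar>f u\<bar> \<le> B"
  shows "integrable \<nu> (\<lambda>s. f (t - s))"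
proof (rule integrable_const_bound[where B = B])
  show "AE s in \<nu>. norm (f (t - s)) \<le> B"
    using nonneg by eventually_elim (use assms(2) in auto)
qed measurable

lemma conv_path_integrable: "integrable \<nu> (\<lambda>s. path_of x (t - s))"
proof -
  obtain B where "\<And>u. u \<le> t \<Longrightarrow> \<bar>path_of x u\<bar> \<le> B" using path_bounded_by[of t x] by blast
  then show ?thesis by (intro conv_integrable) auto
qed

text \<open>Convolution with \<open>\<nu>\<close> multiplies the function \<open>exp\<close> by this factor, which is below 1 unless
  \<open>\<nu>\<close> is the point mass at 0: it is the contraction factor in the norm with weight \<open>exp (- t)\<close>.\<close>

definition discount :: real where
  "discount = (LINT s|\<nu>. exp (- s))"

lemma integrable_exp: "integrable \<nu> (\<lambda>s. exp (- s))"
  by (rule integrable_const_bound[where B = 1]) (use nonneg in auto)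

lemma discount_nonneg: "0 \<le> discount"
  unfolding discount_def by simp

lemma discount_less_1: "discount < 1"
proof -
  have nn: "AE s in \<nu>. 0 \<le> 1 - exp (- s)" using nonneg by eventually_elim simp
  have int: "integrable \<nu> (\<lambda>s. 1 - exp (- s))" using integrable_exp by simp
  have eq: "(LINT s|\<nu>. 1 - exp (- s)) = 1 - discount"
    using integrable_exp by (simp add: discount_def prob_space[unfolded space_eq_univ])
  have "(LINT s|\<nu>. 1 - exp (- s)) \<noteq> 0"
    using integral_nonneg_eq_0_iff_AE[OF int nn] nontrivial by simp
  moreover have "0 \<le> (LINT s|\<nu>. 1 - exp (- s))" using nn by (rule integral_nonneg_AE)
  ultimately show ?thesis using eq by linarith
qed

lemma conv_discounted_bound:
  assumes [measurable]: "f \<in> borel_measurable borel" and f: "\<And>u. u \<le> t \<Longrightarrow> \<bar>f u\<bar> \<le> c * exp u"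
  shows "\<bar>convolution \<nu> f t\<bar> \<le> discount * c * exp t"
proof -
  have e: "exp (t - s) = exp t * exp (- s)" for s by (simp flip: exp_add)
  have c: "0 \<le> c"
    using f[of t] abs_ge_zero[of "f t"] by (smt (verit) exp_gt_zero zero_le_mult_iff)
  have "integrable \<nu> (\<lambda>s. f (t - s))"
  proof (rule conv_integrable)
    fix u assume u: "u \<le> t"
    have "\<bar>f u\<bar> \<le> c * exp u" using f[OF u] .
    also have "\<dots> \<le> c * exp t" using u c by (intro mult_left_mono) auto
    finally show "\<bar>f u\<bar> \<le> c * exp t" .
  qed measurable
  have "\<bar>convolution \<nu> f t\<bar> \<le> (LINT s|\<nu>. \<bar>f (t - s)\<bar>)"
    unfolding convolution_def by (rule integral_abs_bound)
  also have "\<dots> \<le> (LINT s|\<nu>. c * exp (t - s))"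
  proof (rule integral_mono_AE)
    show "integrable \<nu> (\<lambda>s. \<bar>f (t - s)\<bar>)" by (rule integrable_abs) fact
    show "integrable \<nu> (\<lambda>s. c * exp (t - s))"
      unfolding e using integrable_exp by (intro integrable_mult_right) auto
    show "AE s in \<nu>. \<bar>f (t - s)\<bar> \<le> c * exp (t - s)" using nonneg by eventually_elim (use f in auto)
  qed
  also have "\<dots> = discount * c * exp t" unfolding e by (simp add: discount_def)
  finally show ?thesis .
qed

lemma convolution_excess_contraction:
  assumes d: "\<And>u. u \<le> t \<Longrightarrow> \<bar>path_of x u - path_of y u\<bar> \<le> c * exp u"
  shows "\<bar>convolution \<nu> (path_of (excess x)) t - convolution \<nu> (path_of (excess y)) t\<bar> \<le> discount * c * exp t"
proof -
  have "convolution \<nu> (path_of (excess x)) t - convolution \<nu> (path_of (excess y)) t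
      = convolution \<nu> (\<lambda>u. path_of (excess x) u - path_of (excess y) u) t"
    unfolding convolution_def by (intro Bochner_Integration.integral_diff[symmetric] conv_path_integrable)
  moreover have "\<bar>convolution \<nu> (\<lambda>u. path_of (excess x) u - path_of (excess y) u) t\<bar> \<le> discount * c * exp t"
  proof (rule conv_discounted_bound)
    fix u assume "u \<le> t"
    then show "\<bar>path_of (excess x) u - path_of (excess y) u\<bar> \<le> c * exp u"
      using d[of u] by (simp add: path_excess)
  qed measurable
  ultimately show ?thesis by simp
qed

lemma conv_diff_bound:
  assumes e: "\<And>u. u \<le> t \<Longrightarrow> \<bar>path_of x u - path_of y u\<bar> \<le> e"
  shows "\<bar>convolution \<nu> (path_of x) t - convolution \<nu> (path_of y) t\<bar> \<le> e"
proof -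
  have int: "integrable \<nu> (\<lambda>s. path_of x (t - s) - path_of y (t - s))"
    by (intro Bochner_Integration.integrable_diff conv_path_integrable)
  have "convolution \<nu> (path_of x) t - convolution \<nu> (path_of y) t = (LINT s|\<nu>. path_of x (t - s) - path_of y (t - s))"
    unfolding convolution_def by (intro Bochner_Integration.integral_diff[symmetric] conv_path_integrable)
  also have "\<bar>\<dots>\<bar> \<le> (LINT s|\<nu>. \<bar>path_of x (t - s) - path_of y (t - s)\<bar>)" by (rule integral_abs_bound)
  also have "\<dots> \<le> (LINT s|\<nu>. e)"
  proof (rule integral_mono_AE)
    show "integrable \<nu> (\<lambda>s. \<bar>path_of x (t - s) - path_of y (t - s)\<bar>)" using int by (rule integrable_abs)
    show "AE s in \<nu>. \<bar>path_of x (t - s) - path_of y (t - s)\<bar> \<le> e"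
      using nonneg by eventually_elim (use e in auto)
  qed simp
  finally show ?thesis by (simp add: prob_space[unfolded space_eq_univ])
qed

text \<open>Dominated convergence: up to a fixed time a path is bounded, and \<open>\<nu>\<close> does not charge negative shifts.\<close>

lemma conv_path_tendsto:
  assumes lim: "\<And>s. (\<lambda>n. path_of x (T n - s)) \<longlonglongrightarrow> g s" and le: "\<And>n. T n \<le> t"
  shows "(\<lambda>n. convolution \<nu> (path_of x) (T n)) \<longlonglongrightarrow> (LINT s|\<nu>. g s)"
proof -
  obtain B where B: "\<And>u. u \<le> t \<Longrightarrow> \<bar>path_of x u\<bar> \<le> B" using path_bounded_by[of t x] by blast
  show ?thesis unfolding convolution_def
  proof (rule integral_dominated_convergence)
    show "g \<in> borel_measurable \<nu>"
      by (rule borel_measurable_LIMSEQ_real[OF lim]) measurable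
    show "AE s in \<nu>. norm (path_of x (T n - s)) \<le> B" for n
      using nonneg by eventually_elim (use B le[of n] in \<open>auto simp: order_trans\<close>)
    show "integrable \<nu> (\<lambda>_. B)" by simp
  qed (use lim in auto)
qed

lemma is_cadlag_conv: "is_cadlag (convolution \<nu> (path_of x))"
proof (rule is_cadlagI)
  fix t :: real
  show "(convolution \<nu> (path_of x) \<longlongrightarrow> convolution \<nu> (path_of x) t) (at_right t)"
    unfolding convolution_def[of \<nu> "path_of x" t]
  proof (rule tendsto_at_right_sequentially[OF less_add_one])
    fix T :: "nat \<Rightarrow> real" assume T: "\<And>n. t < T n" "\<And>n. T n < t + 1" "T \<longlonglongrightarrow> t"
    show "(\<lambda>n. convolution \<nu> (path_of x) (T n)) \<longlonglongrightarrow> (LINT s|\<nu>. path_of x (t - s))"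
    proof (rule conv_path_tendsto)
      fix s
      show "(\<lambda>n. path_of x (T n - s)) \<longlonglongrightarrow> path_of x (t - s)"
        using T by (intro filterlim_compose[OF path_tendsto_right])
          (auto simp: filterlim_at less_imp_neq[OF T(1), symmetric] intro!: tendsto_intros always_eventually)
      show "T n \<le> t + 1" for n using T(2)[of n] by simp
    qed
  qed
next
  fix t :: real
  obtain l where l: "\<And>u. (path_of x \<longlongrightarrow> l u) (at_left u)" using path_tendsto_left[of x] by metis
  have "(convolution \<nu> (path_of x) \<longlongrightarrow> (LINT s|\<nu>. l (t - s))) (at_left t)"
  proof (rule tendsto_at_left_sequentially)
    show "t - 1 < t" by simp
    fix T :: "nat \<Rightarrow> real" assume T: "\<And>n. T n < t" "T \<longlonglongrightarrow> t"
    show "(\<lambda>n. convolution \<nu> (path_of x) (T n)) \<longlonglongrightarrow> (LINT s|\<nu>. l (t - s))"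
    proof (rule conv_path_tendsto)
      fix s
      show "(\<lambda>n. path_of x (T n - s)) \<longlonglongrightarrow> l (t - s)"
        using T by (intro filterlim_compose[OF l])
          (auto simp: filterlim_at less_imp_neq[OF T(1)] intro!: tendsto_intros always_eventually)
      show "T n \<le> t" for n using T(1)[of n] by simp
    qed
  qed
  then show "\<exists>l. (convolution \<nu> (path_of x) \<longlongrightarrow> l) (at_left t)" ..
qed

text \<open>With \<open>D\<close> the distance of \<open>x\<close> and \<open>y\<close> on \<open>[0, T]\<close> in the weighted norm, the contraction property gives
  \<open>D \<le> e + discount * D\<close>; the factor \<open>exp T\<close> is the price for returning to the uniform norm.\<close>

lemma fluid_stability:
  assumes e: "\<And>t. 0 \<le> t \<Longrightarrow> t \<le> T \<Longrightarrow>
      \<bar>(path_of x t - convolution \<nu> (path_of (excess x)) t) - (path_of y t - convolution \<nu> (path_of (excess y)) t)\<bar> \<le> e"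
    and t: "t \<le> T" and T: "0 \<le> T"
  shows "\<bar>path_of x t - path_of y t\<bar> \<le> exp T / (1 - discount) * e"
proof -
  let ?d = "\<lambda>t. \<bar>path_of x t - path_of y t\<bar>"
  have e0: "0 \<le> e" using e[of 0] T by linarith
  define D where "D = (SUP t\<in>{0..T}. exp (- t) * ?d t)"
  obtain B where B: "\<And>u. u \<le> T \<Longrightarrow> \<bar>path_of x u\<bar> \<le> B" using path_bounded_by[of T x] by blast
  obtain C where C: "\<And>u. u \<le> T \<Longrightarrow> \<bar>path_of y u\<bar> \<le> C" using path_bounded_by[of T y] by blast
  have bdd: "bdd_above ((\<lambda>t. exp (- t) * ?d t) ` {0..T})"
  proof (rule bdd_aboveI2)
    fix t assume t: "t \<in> {0..T}"
    have "exp (- t) * ?d t \<le> 1 * ?d t" using t by (intro mult_right_mono) auto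
    also have "\<dots> \<le> B + C" using B[of t] C[of t] t by auto
    finally show "exp (- t) * ?d t \<le> B + C" .
  qed
  have D: "?d t \<le> D * exp t" if "t \<le> T" for t
  proof (cases "t < 0")
    case True
    have "exp (- 0) * ?d 0 \<le> D" unfolding D_def by (rule cSUP_upper[OF _ bdd]) (use T in auto)
    then have "0 \<le> D" by (smt (verit) exp_zero mult_cancel_right1)
    then show ?thesis using True by (simp add: path_neg)
  next
    case False
    then have "exp (- t) * ?d t \<le> D" unfolding D_def by (intro cSUP_upper bdd) (use that in auto)
    then show ?thesis by (simp add: exp_minus field_simps)
  qed
  have "D \<le> e + discount * D"
  proof -
    have "(SUP t\<in>{0..T}. exp (- t) * ?d t) \<le> e + discount * D"
    proof (rule cSUP_least)
      fix t assume t: "t \<in> {0..T}"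
      have "\<bar>convolution \<nu> (path_of (excess x)) t - convolution \<nu> (path_of (excess y)) t\<bar> \<le> discount * D * exp t"
        using t by (intro convolution_excess_contraction D) auto
      then have "?d t \<le> e + discount * D * exp t" using e[of t] t by auto
      then have "exp (- t) * ?d t \<le> exp (- t) * (e + discount * D * exp t)" by (intro mult_left_mono) auto
      also have "\<dots> = exp (- t) * e + discount * D" by (simp add: algebra_simps flip: exp_add)
      also have "\<dots> \<le> 1 * e + discount * D" using t e0 by (intro add_right_mono mult_right_mono) auto
      finally show "exp (- t) * ?d t \<le> e + discount * D" by simp
    qed (use T in auto)
    then show ?thesis by (simp add: D_def)
  qed
  then have D': "D \<le> e / (1 - discount)"
    using discount_less_1 by (simp add: field_simps)
  have "?d t \<le> D * exp t" by (rule D[OF t])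
  also have "\<dots> \<le> e / (1 - discount) * exp T"
    using D' t e0 discount_less_1 by (intro mult_mono) auto
  finally show ?thesis by (simp add: mult.commute)
qed

definition picard_step :: "(real \<Rightarrow> real) \<Rightarrow> cadlag \<Rightarrow> cadlag" where
  "picard_step b x = cadlag_of (\<lambda>t. b t + convolution \<nu> (path_of (excess x)) t)"

lemma path_picard_step:
  assumes "is_cadlag b"
  shows "path_of (picard_step b x) t = (if t < 0 then 0 else b t + convolution \<nu> (path_of (excess x)) t)"
  unfolding picard_step_def by (subst path_cadlag_of[OF is_cadlag_add[OF assms is_cadlag_conv]]) simp

lemma picard_step_contraction:
  assumes b: "is_cadlag b" and d: "\<And>u. u \<le> T \<Longrightarrow> \<bar>path_of x u - path_of y u\<bar> \<le> c * exp u" and t: "t \<le> T"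
  shows "\<bar>path_of (picard_step b x) t - path_of (picard_step b y) t\<bar> \<le> discount * c * exp t"
proof -
  have "\<bar>convolution \<nu> (path_of (excess x)) t - convolution \<nu> (path_of (excess y)) t\<bar> \<le> discount * c * exp t"
    using t by (intro convolution_excess_contraction d) simp
  then show ?thesis using order_trans[OF abs_ge_zero] by (auto simp: path_picard_step[OF b])
qed

text \<open>Successive Picard iterates differ by a geometric sequence in the weighted norm up to each \<open>T\<close>, so
  they converge uniformly on half-lines bounded above, and the limit is again cadlag.\<close>

lemma fluid_existence:
  assumes b: "is_cadlag b"
  shows "\<exists>x. \<forall>t\<ge>0. path_of x t = b t + convolution \<nu> (path_of (excess x)) t"
proof -
  define zero where "zero = cadlag_of (\<lambda>_. 0)"
  have zero: "path_of zero t = 0" for t by (simp add: zero_def path_cadlag_of is_cadlag_const)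
  define X where "X n = (picard_step b ^^ n) zero" for n
  have X0: "path_of (X 0) t = 0" for t by (simp add: X_def zero)
  have XS: "X (Suc n) = picard_step b (X n)" for n by (simp add: X_def)
  define x where "x t = (\<Sum>n. path_of (X (Suc n)) t - path_of (X n) t)" for t
  have lim: "uniform_limit {..T} (\<lambda>n. path_of (X n)) x sequentially" for T
  proof -
    obtain B where B: "0 \<le> B" "\<And>u. u \<le> T \<Longrightarrow> \<bar>path_of (X 1) u\<bar> \<le> B" using path_bounded_by[of T "X 1"] by blast
    have diff: "\<bar>path_of (X (Suc n)) t - path_of (X n) t\<bar> \<le> discount ^ n * B * exp t" if "t \<le> T" for n t
      using that
    proof (induction n arbitrary: t)
      case 0
      show ?case
      proof (cases "t < 0")
        case True then show ?thesis using B(1) by (simp add: path_neg)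
      next
        case False
        have "\<bar>path_of (X 1) t\<bar> \<le> B * 1" using B(2)[OF 0] by simp
        also have "\<dots> \<le> B * exp t" using False B(1) by (intro mult_left_mono) auto
        finally show ?thesis by (simp add: X0)
      qed
    next
      case (Suc n)
      have "\<bar>path_of (picard_step b (X (Suc n))) t - path_of (picard_step b (X n)) t\<bar>
          \<le> discount * (discount ^ n * B) * exp t"
        by (rule picard_step_contraction[OF b Suc.IH Suc.prems])
      then show ?case by (simp add: XS[of "Suc n"] XS[of n] mult.assoc)
    qed
    have "uniform_limit {..T} (\<lambda>n t. \<Sum>i<n. path_of (X (Suc i)) t - path_of (X i) t) x sequentially"
      unfolding x_def
    proof (rule Weierstrass_m_test)
      fix n t assume t: "t \<in> {..T}"
      have "\<bar>path_of (X (Suc n)) t - path_of (X n) t\<bar> \<le> discount ^ n * B * exp t" using t by (intro diff) simp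
      also have "\<dots> \<le> discount ^ n * B * exp T"
        using t B(1) discount_nonneg by (intro mult_left_mono) auto
      finally show "norm (path_of (X (Suc n)) t - path_of (X n) t) \<le> B * exp T * discount ^ n"
        by (simp add: ac_simps)
    next
      show "summable (\<lambda>n. B * exp T * discount ^ n)"
        using discount_nonneg discount_less_1 by (intro summable_mult summable_geometric) auto
    qed
    then show ?thesis
      unfolding sum_lessThan_telescope[of "\<lambda>n. path_of (X n) t" for t] X0 by simp
  qed
  have xc: "is_cadlag x"
    by (rule is_cadlag_uniform_limit[OF is_cadlag_path uniform_limit_on_subset[OF lim]]) auto
  have x_neg: "x t = 0" if "t < 0" for t using that by (simp add: x_def path_neg)
  have px: "path_of (cadlag_of x) = x" unfolding path_cadlag_of[OF xc] using x_neg by auto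
  have "x t = b t + convolution \<nu> (path_of (excess (cadlag_of x))) t" if t: "0 \<le> t" for t
  proof (rule LIMSEQ_unique)
    show "(\<lambda>n. path_of (X (Suc n)) t) \<longlonglongrightarrow> x t"
      by (rule LIMSEQ_Suc) (rule tendsto_uniform_limitI[OF lim[of t]], simp)
    have "(\<lambda>n. convolution \<nu> (path_of (excess (X n))) t) \<longlonglongrightarrow> convolution \<nu> (path_of (excess (cadlag_of x))) t"
    proof (rule LIMSEQ_I)
      fix e :: real assume "0 < e"
      then have "\<forall>\<^sub>F n in sequentially. \<forall>u\<in>{..t}. dist (path_of (X n) u) (x u) < e / 2"
        by (intro uniform_limitD[OF lim]) simp
      then obtain N where N: "\<And>n u. N \<le> n \<Longrightarrow> u \<le> t \<Longrightarrow> \<bar>path_of (X n) u - x u\<bar> < e / 2"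
        by (auto simp: eventually_sequentially dist_real_def)
      have "\<bar>convolution \<nu> (path_of (excess (X n))) t - convolution \<nu> (path_of (excess (cadlag_of x))) t\<bar> \<le> e / 2"
        if n: "N \<le> n" for n
      proof (rule conv_diff_bound)
        fix u assume "u \<le> t"
        then show "\<bar>path_of (excess (X n)) u - path_of (excess (cadlag_of x)) u\<bar> \<le> e / 2"
          using N[OF n, of u] unfolding path_excess px by linarith
      qed
      then show "\<exists>N. \<forall>n\<ge>N. norm (convolution \<nu> (path_of (excess (X n))) t - convolution \<nu> (path_of (excess (cadlag_of x))) t) < e"
        using \<open>0 < e\<close> by (intro exI[of _ N]) force
    qed
    then show "(\<lambda>n. path_of (X (Suc n)) t) \<longlonglongrightarrow> b t + convolution \<nu> (path_of (excess (cadlag_of x))) t"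
      using t by (simp add: XS path_picard_step[OF b] tendsto_intros)
  qed
  then show ?thesis by (metis px)
qed

end

lemma (in real_distribution) is_cadlag_cdf: "is_cadlag (cdf M)"
  unfolding is_cadlag_def using cdf_is_right_cont cdf_at_left by blast

text \<open>The mass at 0 is the value of the path there: the path jumps to it from 0, and the measure is null
  on the negative half-line.\<close>

lemma
  assumes mono: "\<And>s t. s \<le> t \<Longrightarrow> path_of a s \<le> path_of a t"
  shows sigma_finite_interval_measure_path: "sigma_finite_measure (interval_measure (path_of a))"
    and emeasure_interval_measure_path:
      "emeasure (interval_measure (path_of a)) {0..t} = ennreal (path_of a t)"
proof -
  have right: "continuous (at_right u) (path_of a)" for u
    using path_tendsto_right by (simp add: continuous_within)
  note Ioc = emeasure_interval_measure_Ioc_eq[of "path_of a", OF mono right]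
  show "sigma_finite_measure (interval_measure (path_of a))"
    by (rule sigma_finite_interval_measure[OF mono right])
  have nonneg: "0 \<le> path_of a u" for u
    using mono[of "min u (- 1)" u] by (simp add: path_neg)
  show "emeasure (interval_measure (path_of a)) {0..t} = ennreal (path_of a t)"
  proof (cases "t < 0")
    case True then show ?thesis by (simp add: path_neg)
  next
    case False
    have "{-1<..<0} = (\<Union>n. {-1<..- inverse (real (Suc n))})"
    proof (intro set_eqI iffI)
      fix u :: real assume u: "u \<in> {-1<..<0}"
      then have "0 < - u" by simp
      from reals_Archimedean[OF this] obtain n where "inverse (real (Suc n)) < - u" ..
      then have "u \<in> {-1<..- inverse (real (Suc n))}" using u by simp
      then show "u \<in> (\<Union>n. {-1<..- inverse (real (Suc n))})" by blast
    next
      fix u :: real assume "u \<in> (\<Union>n. {-1<..- inverse (real (Suc n))})"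
      then obtain n where n: "-1 < u" "u \<le> - inverse (real (Suc n))" by auto
      have "0 < inverse (real (Suc n))" by simp
      then have "u < 0" using n by linarith
      then show "u \<in> {-1<..<0}" using n by simp
    qed
    moreover have "{-1<..- inverse (real (Suc n))} \<in> null_sets (interval_measure (path_of a))" for n
      by (simp add: null_sets_def Ioc path_neg del: of_nat_Suc)
    ultimately have null: "{-1<..<0} \<in> null_sets (interval_measure (path_of a))"
      using null_sets_UN'[of UNIV "\<lambda>n. {-1<..- inverse (real (Suc n))}" "interval_measure (path_of a)"] by simp
    have "{-1<..t} = {0..t} \<union> {-1<..<0}" using False by auto
    then have "emeasure (interval_measure (path_of a)) {0..t} = emeasure (interval_measure (path_of a)) {-1<..t}"
      using emeasure_Un_null_set[OF _ null, of "{0..t}"] by simp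
    then show ?thesis using False by (simp add: Ioc path_neg)
  qed
qed

context service_law
begin

text \<open>Integration by parts, by Fubini for the pairs of an arrival time and a service time with sum at
  most \<open>t\<close>.  The right-hand side makes sense for every path, monotone or not.\<close>

lemma integral_survival_arrivals:
  assumes mono: "\<And>s t. s \<le> t \<Longrightarrow> path_of a s \<le> path_of a t" and t: "0 \<le> t"
  shows "(LINT s:{0..t}|interval_measure (path_of a). 1 - cdf \<nu> (t - s))
     = path_of a t - convolution \<nu> (path_of a) t"
proof -
  let ?\<alpha> = "interval_measure (path_of a)"
  interpret \<alpha>: sigma_finite_measure ?\<alpha> by (rule sigma_finite_interval_measure_path[OF mono])
  interpret pair_sigma_finite ?\<alpha> \<nu> ..
  note em = emeasure_interval_measure_path[OF mono]
  have nn: "0 \<le> path_of a u" for u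
    using mono[of "min u (- 1)" u] by (simp add: path_neg)
  have ind: "integrable ?\<alpha> (indicator {0..t} :: real \<Rightarrow> real)"
    by (simp add: em)
  have [measurable]: "cdf \<nu> \<in> borel_measurable borel"
    by (intro borel_measurable_mono monoI cdf_nondecreasing)
  have cdf_int: "integrable ?\<alpha> (\<lambda>s. indicator {0..t} s * cdf \<nu> (t - s))"
  proof (rule Bochner_Integration.integrable_bound[OF ind])
    show "AE s in ?\<alpha>. norm (indicator {0..t} s * cdf \<nu> (t - s)) \<le> norm (indicator {0..t} s :: real)"
      by (intro AE_I2) (auto simp: indicator_def cdf_nonneg cdf_bounded_prob)
  qed measurable
  let ?f = "\<lambda>s u. indicator {(s, u). 0 \<le> s \<and> s \<le> t \<and> s + u \<le> t} (s, u) :: ennreal"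
  have "(\<integral>\<^sup>+ u. (\<integral>\<^sup>+ s. ?f s u \<partial>?\<alpha>) \<partial>\<nu>) = (\<integral>\<^sup>+ s. (\<integral>\<^sup>+ u. ?f s u \<partial>\<nu>) \<partial>?\<alpha>)"
    by (rule Fubini') measurable
  moreover have "(\<integral>\<^sup>+ u. ?f s u \<partial>\<nu>) = ennreal (indicator {0..t} s * cdf \<nu> (t - s))" for s
  proof -
    have "(\<integral>\<^sup>+ u. ?f s u \<partial>\<nu>) = (\<integral>\<^sup>+ u. indicator {0..t} s * indicator {..t - s} u \<partial>\<nu>)"
      by (intro nn_integral_cong) (auto simp: indicator_def)
    also have "\<dots> = indicator {0..t} s * emeasure \<nu> {..t - s}"
      by (simp add: nn_integral_cmult)
    finally show ?thesis
      by (simp add: emeasure_eq_measure cdf_def ennreal_mult indicator_def)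
  qed
  moreover have "(\<integral>\<^sup>+ u. (\<integral>\<^sup>+ s. ?f s u \<partial>?\<alpha>) \<partial>\<nu>) = (\<integral>\<^sup>+ u. ennreal (path_of a (t - u)) \<partial>\<nu>)"
  proof (rule nn_integral_cong_AE)
    show "AE u in \<nu>. (\<integral>\<^sup>+ s. ?f s u \<partial>?\<alpha>) = ennreal (path_of a (t - u))"
      using nonneg
    proof eventually_elim
      case (elim u)
      have "(\<integral>\<^sup>+ s. ?f s u \<partial>?\<alpha>) = (\<integral>\<^sup>+ s. indicator {0..t - u} s \<partial>?\<alpha>)"
        using elim by (intro nn_integral_cong) (auto simp: indicator_def)
      then show ?case by (simp add: em)
    qed
  qed
  ultimately have eq: "(\<integral>\<^sup>+ s. ennreal (indicator {0..t} s * cdf \<nu> (t - s)) \<partial>?\<alpha>) = (\<integral>\<^sup>+ u. ennreal (path_of a (t - u)) \<partial>\<nu>)"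
    by simp
  have "(LINT s|?\<alpha>. indicator {0..t} s * cdf \<nu> (t - s)) = convolution \<nu> (path_of a) t"
    unfolding convolution_def
    by (subst (1 2) integral_eq_nn_integral) (auto simp: eq nn cdf_nonneg)
  moreover have "(LINT s|?\<alpha>. indicator {0..t} s) = path_of a t"
    using nn by (simp add: em measure_def)
  moreover have "(LINT s:{0..t}|?\<alpha>. 1 - cdf \<nu> (t - s))
      = (LINT s|?\<alpha>. indicator {0..t} s - indicator {0..t} s * cdf \<nu> (t - s))"
    unfolding set_lebesgue_integral_def by (simp add: right_diff_distrib)
  ultimately show ?thesis using ind cdf_int by simp
qed

lemma integral_excess:
  "(LINT s:{0..t}|\<nu>. max (path_of x (t - s) - 1) 0) = convolution \<nu> (path_of (excess x)) t"
  unfolding convolution_def set_lebesgue_integral_def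
proof (rule integral_cong_AE)
  show "AE s in \<nu>. indicator {0..t} s *\<^sub>R max (path_of x (t - s) - 1) 0 = path_of (excess x) (t - s)"
    using nonneg by eventually_elim (auto simp: indicator_def path_excess path_neg)
qed measurable

definition fluid_input :: "(real \<Rightarrow> real) \<Rightarrow> real \<Rightarrow> cadlag \<Rightarrow> real \<Rightarrow> real" where
  "fluid_input F\<^sub>0 q a t = min q 1 * (1 - F\<^sub>0 t) + max (q - 1) 0 * (1 - cdf \<nu> t)
     + (path_of a t - convolution \<nu> (path_of a) t)"

lemma is_cadlag_fluid_input:
  assumes "is_cadlag F\<^sub>0" shows "is_cadlag (fluid_input F\<^sub>0 q a)"
  unfolding fluid_input_def
  by (intro is_cadlag_add is_cadlag_diff is_cadlag_cmult is_cadlag_const assms is_cadlag_cdf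
      is_cadlag_path is_cadlag_conv)

lemma fluid_solution_iff:
  assumes mono: "\<And>s t. s \<le> t \<Longrightarrow> path_of a s \<le> path_of a t"
  shows "fluid_solution F\<^sub>0 (cdf \<nu>) q a x \<longleftrightarrow>
    (\<forall>t\<ge>0. path_of x t = fluid_input F\<^sub>0 q a t + convolution \<nu> (path_of (excess x)) t)"
proof -
  have "interval_measure (cdf \<nu>) = \<nu>"
  proof (rule cdf_unique)
    show "real_distribution (interval_measure (cdf \<nu>))"
      by (intro real_distribution_interval_measure cdf_nondecreasing cdf_is_right_cont cdf_lim_at_bot
          cdf_lim_at_top_prob)
    show "cdf (interval_measure (cdf \<nu>)) = cdf \<nu>"
      by (intro cdf_interval_measure cdf_nondecreasing cdf_is_right_cont cdf_lim_at_bot)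
    show "real_distribution \<nu>" ..
  qed
  then show ?thesis
    unfolding fluid_solution_def fluid_input_def
    by (simp add: integral_survival_arrivals[OF mono] integral_excess)
qed

text \<open>Defined for all cadlag arrival paths, also where the integral against the arrivals makes no sense, so
  that continuity in the whole Skorohod space can be discussed.\<close>

definition fluid_map :: "(real \<Rightarrow> real) \<Rightarrow> real \<Rightarrow> cadlag \<Rightarrow> cadlag" where
  "fluid_map F\<^sub>0 q a =
    (SOME x. \<forall>t\<ge>0. path_of x t = fluid_input F\<^sub>0 q a t + convolution \<nu> (path_of (excess x)) t)"

context
  fixes F\<^sub>0 :: "real \<Rightarrow> real"
  assumes F0: "is_cadlag F\<^sub>0" "\<And>t. 0 \<le> F\<^sub>0 t" "\<And>t. F\<^sub>0 t \<le> 1"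
begin

lemma path_fluid_map:
  assumes "0 \<le> t"
  shows "path_of (fluid_map F\<^sub>0 q a) t = fluid_input F\<^sub>0 q a t + convolution \<nu> (path_of (excess (fluid_map F\<^sub>0 q a))) t"
proof -
  have "\<exists>x. \<forall>t\<ge>0. path_of x t = fluid_input F\<^sub>0 q a t + convolution \<nu> (path_of (excess x)) t"
    by (intro fluid_existence is_cadlag_fluid_input F0)
  from someI_ex[OF this] show ?thesis
    unfolding fluid_map_def[symmetric] using assms by blast
qed

lemma fluid_map_stability:
  assumes "\<And>t. 0 \<le> t \<Longrightarrow> t \<le> T \<Longrightarrow>
      \<bar>path_of x t - (fluid_input F\<^sub>0 q a t + convolution \<nu> (path_of (excess x)) t)\<bar> \<le> e"
    and "t \<le> T" "0 \<le> T"
  shows "\<bar>path_of x t - path_of (fluid_map F\<^sub>0 q a) t\<bar> \<le> exp T / (1 - discount) * e"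
proof (rule fluid_stability)
  fix t assume t: "0 \<le> t" "t \<le> T"
  show "\<bar>path_of x t - convolution \<nu> (path_of (excess x)) t - (path_of (fluid_map F\<^sub>0 q a) t
      - convolution \<nu> (path_of (excess (fluid_map F\<^sub>0 q a))) t)\<bar> \<le> e"
    using assms(1)[OF t] path_fluid_map[OF t(1), of q a] by (simp add: algebra_simps)
qed fact+

lemma fluid_map_unique:
  assumes "\<And>t. 0 \<le> t \<Longrightarrow> path_of x t = fluid_input F\<^sub>0 q a t + convolution \<nu> (path_of (excess x)) t"
  shows "x = fluid_map F\<^sub>0 q a"
proof -
  have "path_of x t = path_of (fluid_map F\<^sub>0 q a) t" for t
  proof -
    have "\<bar>path_of x t - path_of (fluid_map F\<^sub>0 q a) t\<bar> \<le> exp (max t 0) / (1 - discount) * 0"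
      using assms by (intro fluid_map_stability) auto
    then show ?thesis by simp
  qed
  then show ?thesis by (metis ext path_of_inject)
qed

lemma fluid_solution_iff_fluid_map:
  assumes "\<And>s t. s \<le> t \<Longrightarrow> path_of a s \<le> path_of a t"
  shows "fluid_solution F\<^sub>0 (cdf \<nu>) q a x \<longleftrightarrow> x = fluid_map F\<^sub>0 q a"
proof (subst fluid_solution_iff[OF assms], assumption, rule iffI)
  assume "\<forall>t\<ge>0. path_of x t = fluid_input F\<^sub>0 q a t + convolution \<nu> (path_of (excess x)) t"
  then show "x = fluid_map F\<^sub>0 q a" by (intro fluid_map_unique) blast
next
  assume x: "x = fluid_map F\<^sub>0 q a"
  show "\<forall>t\<ge>0. path_of x t = fluid_input F\<^sub>0 q a t + convolution \<nu> (path_of (excess x)) t"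
    unfolding x using path_fluid_map by blast
qed

lemma fluid_map_close:
  assumes e: "\<And>t. t \<le> T \<Longrightarrow> \<bar>path_of a t - path_of b t\<bar> \<le> e" and T: "0 \<le> T" and t: "t \<le> T"
  shows "\<bar>path_of (fluid_map F\<^sub>0 q a) t - path_of (fluid_map F\<^sub>0 r b) t\<bar>
    \<le> exp T / (1 - discount) * (2 * \<bar>q - r\<bar> + 2 * e)"
proof (rule fluid_map_stability[OF _ t T])
  fix t assume t: "0 \<le> t" "t \<le> T"
  have "\<bar>(min q 1 - min r 1) * (1 - F\<^sub>0 t)\<bar> \<le> \<bar>q - r\<bar> * 1"
    unfolding abs_mult using F0(2,3)[of t] by (intro mult_mono) (auto simp: min_def)
  moreover have "\<bar>(max (q - 1) 0 - max (r - 1) 0) * (1 - cdf \<nu> t)\<bar> \<le> \<bar>q - r\<bar> * 1"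
    unfolding abs_mult using cdf_nonneg[of t] cdf_bounded_prob[of t] by (intro mult_mono) (auto simp: max_def)
  moreover have "\<bar>path_of a t - path_of b t\<bar> \<le> e" using t by (intro e)
  moreover have "\<bar>convolution \<nu> (path_of a) t - convolution \<nu> (path_of b) t\<bar> \<le> e"
    using t by (intro conv_diff_bound e) simp
  moreover have "fluid_input F\<^sub>0 q a t - fluid_input F\<^sub>0 r b t =
      (min q 1 - min r 1) * (1 - F\<^sub>0 t) + (max (q - 1) 0 - max (r - 1) 0) * (1 - cdf \<nu> t)
      + (path_of a t - path_of b t) - (convolution \<nu> (path_of a) t - convolution \<nu> (path_of b) t)"
    by (simp add: fluid_input_def algebra_simps)
  moreover have "\<bar>A + B + C - D\<bar> \<le> x + x + e + e"
    if "\<bar>A\<bar> \<le> x * 1" "\<bar>B\<bar> \<le> x * 1" "\<bar>C\<bar> \<le> e" "\<bar>D\<bar> \<le> e" for A B C D x :: real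
    using that by linarith
  ultimately have "\<bar>fluid_input F\<^sub>0 q a t - fluid_input F\<^sub>0 r b t\<bar> \<le> \<bar>q - r\<bar> + \<bar>q - r\<bar> + e + e"
    by metis
  then show "\<bar>path_of (fluid_map F\<^sub>0 q a) t - (fluid_input F\<^sub>0 r b t
      + convolution \<nu> (path_of (excess (fluid_map F\<^sub>0 q a))) t)\<bar> \<le> 2 * \<bar>q - r\<bar> + 2 * e"
    unfolding path_fluid_map[OF t(1), of q a] by simp
qed

text \<open>A bounded time interval on which the paths are uniformly close suffices, since later times contribute
  little to the distance of solutions.\<close>

lemma isCont_fluid_map:
  assumes a: "continuous_on {0..} (path_of a)"
  shows "isCont (\<lambda>(q, a). fluid_map F\<^sub>0 q a) (q, a)"
  unfolding continuous_at_eps_delta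
proof (intro allI impI)
  fix e :: real assume e: "0 < e"
  obtain M where M: "(1/2) ^ M < e / 2" using real_arch_pow_inv[of "e / 2" "1/2"] e by auto
  define c where "c = exp (real M) / (1 - discount)"
  have c: "0 < c" using discount_less_1 by (simp add: c_def)
  define h where "h = e / (16 * c)"
  have h: "0 < h" using e c by (simp add: h_def)
  obtain d where d: "0 < d"
    "\<And>y t. dist y a < d \<Longrightarrow> t \<le> real M \<Longrightarrow> \<bar>path_of y t - path_of a t\<bar> \<le> h"
    using uniformly_close_near_continuous[OF a h, of "real M"] by blast
  show "\<exists>d>0. \<forall>z. dist z (q, a) < d \<longrightarrow> dist (case z of (q, a) \<Rightarrow> fluid_map F\<^sub>0 q a) (case (q, a) of (q, a) \<Rightarrow> fluid_map F\<^sub>0 q a) < e"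
  proof (intro exI[of _ "min d h"] conjI allI impI)
    show "0 < min d h" using d h by simp
    fix z assume z: "dist z (q, a) < min d h"
    obtain r b where zeq: "z = (r, b)" by (cases z)
    have "dist r q \<le> dist z (q, a)" "dist b a \<le> dist z (q, a)"
      using dist_fst_le[of z "(q, a)"] dist_snd_le[of z "(q, a)"] by (simp_all add: zeq)
    then have r: "\<bar>r - q\<bar> \<le> h" and b: "dist b a < d" using z by (auto simp: dist_real_def)
    have "dist (fluid_map F\<^sub>0 r b) (fluid_map F\<^sub>0 q a) \<le> e / 4 + (1/2) ^ M"
    proof (rule cadlag_dist_le_uniform)
      fix t assume "0 \<le> t" "t \<le> real M"
      then have "\<bar>path_of (fluid_map F\<^sub>0 r b) t - path_of (fluid_map F\<^sub>0 q a) t\<bar> \<le> c * (2 * \<bar>r - q\<bar> + 2 * h)"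
        unfolding c_def by (intro fluid_map_close d(2) b) auto
      also have "\<dots> \<le> c * (4 * h)" using r c by (intro mult_left_mono) auto
      also have "\<dots> = e / 4" using c by (simp add: h_def)
      finally show "\<bar>path_of (fluid_map F\<^sub>0 r b) t - path_of (fluid_map F\<^sub>0 q a) t\<bar> \<le> e / 4" .
    qed
    then show "dist (case z of (q, a) \<Rightarrow> fluid_map F\<^sub>0 q a) (case (q, a) of (q, a) \<Rightarrow> fluid_map F\<^sub>0 q a) < e"
      using M e by (simp add: zeq)
  qed
qed

end

end

section \<open>Measurability of random paths\<close>

lemma is_cadlag_floor: "is_cadlag (\<lambda>t. h \<lfloor>t * k\<rfloor>)" if k: "0 < k"
proof (rule is_cadlagI)
  fix t :: real
  have "t < (\<lfloor>t * k\<rfloor> + 1) / k" using k by (simp add: pos_less_divide_eq)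
  from eventually_at_right_real[OF this]
  have "\<forall>\<^sub>F s in at_right t. h \<lfloor>s * k\<rfloor> = h \<lfloor>t * k\<rfloor>"
  proof eventually_elim
    case (elim s)
    have "t * k \<le> s * k" using elim k by (intro mult_right_mono) auto
    moreover have "s * k < \<lfloor>t * k\<rfloor> + 1" using elim k by (simp add: pos_less_divide_eq)
    ultimately have "\<lfloor>s * k\<rfloor> = \<lfloor>t * k\<rfloor>" by (intro floor_unique) linarith+
    then show ?case by simp
  qed
  then show "((\<lambda>t. h \<lfloor>t * k\<rfloor>) \<longlongrightarrow> h \<lfloor>t * k\<rfloor>) (at_right t)" by (rule tendsto_eventually)
  have "(\<lceil>t * k\<rceil> - 1) / k < t" using k by (simp add: pos_divide_less_eq) linarith
  from eventually_at_left_real[OF this]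
  have "\<forall>\<^sub>F s in at_left t. h \<lfloor>s * k\<rfloor> = h (\<lceil>t * k\<rceil> - 1)"
  proof eventually_elim
    case (elim s)
    have "s * k < t * k" using elim k by (intro mult_strict_right_mono) auto
    moreover have "\<lceil>t * k\<rceil> - 1 < s * k" using elim k by (simp add: pos_divide_less_eq)
    ultimately have "\<lfloor>s * k\<rfloor> = \<lceil>t * k\<rceil> - 1" by (intro floor_unique) linarith+
    then show ?case by simp
  qed
  then show "\<exists>l. ((\<lambda>t. h \<lfloor>t * k\<rfloor>) \<longlongrightarrow> l) (at_left t)" by (intro exI tendsto_eventually)
qed

definition grid_path :: "nat \<Rightarrow> int list \<Rightarrow> cadlag" where
  "grid_path k l = cadlag_of (\<lambda>t. (\<lambda>i. if 0 \<le> i \<and> i < int (k * k) then real_of_int (l ! nat i) / real k else 0) \<lfloor>t * real k\<rfloor>)"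

text \<open>Sampling at finitely many times and rounding leaves only countably many possible paths, given by
  lists of integers.\<close>

definition discretise :: "nat \<Rightarrow> cadlag \<Rightarrow> cadlag" where
  "discretise k x = grid_path k (map (\<lambda>i. \<lfloor>path_of x (real i / real k) * real k\<rfloor>) [0..<k * k])"

lemma path_discretise:
  assumes k: "0 < k" and t: "0 \<le> t" "t < real k"
  shows "path_of (discretise k x) t = \<lfloor>path_of x (\<lfloor>t * real k\<rfloor> / real k) * real k\<rfloor> / real k"
proof -
  have "0 \<le> \<lfloor>t * real k\<rfloor>" using t by simp
  moreover have "\<lfloor>t * real k\<rfloor> < int (k * k)"
    using t k by (simp add: floor_less_iff mult_strict_right_mono)
  moreover have "nat \<lfloor>t * real k\<rfloor> < k * k" using calculation by linarith
  ultimately show ?thesis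
    unfolding discretise_def grid_path_def
    by (subst path_cadlag_of[OF is_cadlag_floor]) (use k t in auto)
qed

text \<open>A time change, up to a horizon \<open>b\<close>, after which sampling the path \<open>x\<close> at the last grid point costs
  at most \<open>e\<close>.  The horizon is moved up to the next grid point, so that intervals can be glued.\<close>

definition aligned :: "(real \<Rightarrow> real) \<Rightarrow> real \<Rightarrow> nat \<Rightarrow> real \<Rightarrow> (real \<Rightarrow> real) \<Rightarrow> bool" where
  "aligned x e k b \<gamma> \<longleftrightarrow> strict_mono_on {0..b} \<gamma> \<and> \<gamma> ` {0..b} = {0..\<lceil>b * real k\<rceil> / real k} \<and>
     (\<forall>s\<in>{0..b}. \<bar>\<gamma> s - s\<bar> \<le> 1 / real k) \<and>
     (\<forall>s\<in>{0..<b}. \<bar>x s - x (\<lfloor>\<gamma> s * real k\<rfloor> / real k)\<bar> \<le> e)"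

lemma strict_mono_on_right_end:
  fixes \<gamma> :: "real \<Rightarrow> real"
  assumes "strict_mono_on {0..b} \<gamma>" "\<gamma> ` {0..b} = {0..c}" "0 \<le> b"
  shows "\<gamma> b = c"
proof (rule antisym)
  have "0 \<le> c" using assms(2,3) by (metis atLeastAtMost_iff atLeastatMost_empty_iff image_is_empty order_refl)
  then obtain u where u: "u \<in> {0..b}" "\<gamma> u = c" using assms(2) by (metis atLeastAtMost_iff image_iff order_refl)
  show "c \<le> \<gamma> b" using strict_mono_on_leD[OF assms(1) u(1), of b] u assms(3) by auto
  show "\<gamma> b \<le> c" using assms(2,3) by (metis atLeastAtMost_iff imageI order_refl)
qed

text \<open>The new interval is stretched linearly between the rounded end points.  A grid point in \<open>[ub, uc)\<close> lies
  in \<open>[b, c)\<close>, where the path hardly varies; if \<open>b\<close> were not moved, the last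
  grid point before it might precede a jump at \<open>b\<close>.\<close>

lemma aligned_extend:
  assumes \<gamma>: "aligned x e k b \<gamma>" and b: "0 \<le> b" "b < c"
    and osc: "\<And>s s'. s \<in> {b..<c} \<Longrightarrow> s' \<in> {b..<c} \<Longrightarrow> \<bar>x s - x s'\<bar> \<le> e"
    and k: "1 / (c - b) < real k"
  shows "\<exists>\<gamma>. aligned x e k c \<gamma>"
proof -
  have g: "strict_mono_on {0..b} \<gamma>" "\<gamma> ` {0..b} = {0..\<lceil>b * real k\<rceil> / real k}"
    "\<And>s. s \<in> {0..b} \<Longrightarrow> \<bar>\<gamma> s - s\<bar> \<le> 1 / real k"
    "\<And>s. s \<in> {0..<b} \<Longrightarrow> \<bar>x s - x (\<lfloor>\<gamma> s * real k\<rfloor> / real k)\<bar> \<le> e"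
    using \<gamma> by (auto simp: aligned_def)
  have "0 < 1 / (c - b)" using b by simp
  then have k0: "0 < real k" using k by linarith
  define ub uc where "ub = \<lceil>b * real k\<rceil> / real k" and "uc = \<lceil>c * real k\<rceil> / real k"
  have gap: "b * real k + 1 < c * real k" using k b by (simp add: field_simps)
  have u: "ub < uc" unfolding ub_def uc_def using gap k0 by (intro divide_strict_right_mono) linarith+
  have ubb: "b \<le> ub" "ub \<le> b + 1 / real k" and ucc: "c \<le> uc" "uc \<le> c + 1 / real k"
    using k0 le_of_int_ceiling[of "b * real k"] le_of_int_ceiling[of "c * real k"]
      of_int_ceiling_le_add_one[of "b * real k"] of_int_ceiling_le_add_one[of "c * real k"]
    by (simp_all add: ub_def uc_def field_simps)
  have gb: "\<gamma> b = ub" unfolding ub_def by (rule strict_mono_on_right_end[OF g(1,2) b(1)])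
  define p where "p = (uc - ub) / (c - b)"
  have p: "0 < p" using u b by (simp add: p_def)
  have pc: "(c - b) * p = uc - ub" using b by (simp add: p_def)
  define \<delta> where "\<delta> s = (if s \<le> b then \<gamma> s else ub + (s - b) * p)" for s
  have d_b: "\<delta> s = \<gamma> s" if "s \<le> b" for s using that by (simp add: \<delta>_def)
  have d_c: "\<delta> s = ub + (s - b) * p" if "b \<le> s" for s using that by (cases "s = b") (simp_all add: \<delta>_def gb)
  have mono: "strict_mono_on {0..c} \<delta>"
  proof (rule strict_mono_onI)
    fix s s' assume s: "s \<in> {0..c}" "s' \<in> {0..c}" "s < s'"
    consider "s' \<le> b" | "s \<le> b" "b < s'" | "b < s" by linarith
    then show "\<delta> s < \<delta> s'"
    proof cases
      case 1
      then show ?thesis using s strict_mono_onD[OF g(1), of s s'] by (simp add: d_b)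
    next
      case 2
      have "\<gamma> s \<le> ub" using strict_mono_on_leD[OF g(1), of s b] s 2 b by (simp add: gb)
      moreover have "0 < (s' - b) * p" using 2 p by simp
      ultimately show ?thesis using 2 by (simp add: d_b d_c)
    next
      case 3
      then show ?thesis using s p by (simp add: d_c mult_strict_right_mono)
    qed
  qed
  have range_c: "ub \<le> \<delta> s \<and> \<delta> s \<le> uc \<and> (s < c \<longrightarrow> \<delta> s < uc)" if s: "s \<in> {b..c}" for s
  proof -
    have "(s - b) * p \<le> (c - b) * p" using s p by (intro mult_right_mono) auto
    moreover have "(s - b) * p < (c - b) * p" if "s < c" using that p by (intro mult_strict_right_mono) auto
    moreover have "0 \<le> (s - b) * p" using s p by simp
    ultimately show ?thesis using s pc by (auto simp: d_c)
  qed
  have "\<delta> ` {b..c} = {ub..uc}"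
  proof (intro equalityI subsetI)
    fix y assume "y \<in> \<delta> ` {b..c}"
    then show "y \<in> {ub..uc}" using range_c by auto
  next
    fix y assume y: "y \<in> {ub..uc}"
    let ?s = "b + (y - ub) / p"
    have "b \<le> ?s" using y p by simp
    moreover have "(y - ub) / p \<le> c - b" using y p pc by (simp add: pos_divide_le_eq)
    moreover have "\<delta> ?s = y" using calculation(1) p by (simp add: d_c)
    ultimately show "y \<in> \<delta> ` {b..c}" by (intro image_eqI[of _ _ ?s]) auto
  qed
  moreover have "\<delta> ` {0..b} = {0..ub}"
  proof -
    have "\<delta> ` {0..b} = \<gamma> ` {0..b}" by (intro image_cong) (auto simp: d_b)
    then show ?thesis using g(2) by (simp add: ub_def)
  qed
  moreover have "{0..c} = {0..b} \<union> {b..c}" "{0..ub} \<union> {ub..uc} = {0..uc}"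
    using b u ubb by auto
  ultimately have im: "\<delta> ` {0..c} = {0..uc}" by (simp add: image_Un)
  have near: "\<bar>\<delta> s - s\<bar> \<le> 1 / real k" if s: "s \<in> {0..c}" for s
  proof (cases "s \<le> b")
    case True
    then show ?thesis using g(3)[of s] s by (simp add: d_b)
  next
    case False
    define w where "w = (s - b) / (c - b)"
    have w: "0 \<le> w" "w \<le> 1" using False s b by (auto simp: w_def)
    have sw: "s - b = w * (c - b)" using b by (simp add: w_def)
    have "(s - b) * p = w * (uc - ub)" using b by (simp add: w_def p_def)
    then have "\<delta> s - s = (ub + w * (uc - ub)) - (b + w * (c - b))"
      using False sw d_c[of s] by linarith
    then have "\<delta> s - s = (1 - w) * (ub - b) + w * (uc - c)"
      by (simp add: algebra_simps)
    moreover have "0 \<le> (1 - w) * (ub - b)" "0 \<le> w * (uc - c)" using w ubb ucc by auto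
    moreover have "(1 - w) * (ub - b) \<le> (1 - w) * (1 / real k)" "w * (uc - c) \<le> w * (1 / real k)"
      using w ubb ucc by (intro mult_left_mono; simp)+
    moreover have "(1 - w) * (1 / real k) + w * (1 / real k) = 1 / real k" by (simp add: diff_divide_distrib)
    ultimately show ?thesis by linarith
  qed
  have "\<bar>x s - x (\<lfloor>\<delta> s * real k\<rfloor> / real k)\<bar> \<le> e" if s: "s \<in> {0..<c}" for s
  proof (cases "s < b")
    case True
    then show ?thesis using g(4)[of s] s by (simp add: d_b)
  next
    case False
    have r: "ub \<le> \<delta> s" "\<delta> s < uc" using range_c[of s] s False by auto
    have "ub * real k \<le> \<delta> s * real k" using r k0 by (intro mult_right_mono) auto
    then have "\<lceil>b * real k\<rceil> \<le> \<lfloor>\<delta> s * real k\<rfloor>" using k0 by (simp add: ub_def le_floor_iff)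
    then have lo: "b * real k \<le> \<lfloor>\<delta> s * real k\<rfloor>" by linarith
    have "\<delta> s * real k < uc * real k" using r k0 by (intro mult_strict_right_mono) auto
    then have "\<lfloor>\<delta> s * real k\<rfloor> < \<lceil>c * real k\<rceil>" using k0 by (simp add: uc_def floor_less_iff)
    then have hi: "\<lfloor>\<delta> s * real k\<rfloor> < c * real k" by linarith
    show ?thesis
      using lo hi k0 s False by (intro osc) (auto simp: field_simps)
  qed
  then show ?thesis using mono im near by (auto simp: aligned_def uc_def)
qed

text \<open>Around each time there are intervals on the left and on the right on which a cadlag path hardly varies;
  bisection glues finitely many of them.\<close>

lemma aligned_exists:
  assumes e: "0 < e" and T: "0 \<le> T"
  shows "\<forall>\<^sub>F k in sequentially. \<exists>\<gamma>. aligned (path_of x) e k T \<gamma>"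
proof -
  define good where "good b \<longleftrightarrow> (\<forall>\<^sub>F k in sequentially. \<exists>\<gamma>. aligned (path_of x) e k b \<gamma>)" for b
  have extend: "good c" if "good b" "0 \<le> b" "b \<le> c"
    and osc: "\<And>s s'. s \<in> {b..<c} \<Longrightarrow> s' \<in> {b..<c} \<Longrightarrow> \<bar>path_of x s - path_of x s'\<bar> \<le> e" for b c
  proof (cases "b = c")
    case False
    then have "b < c" using that(3) by simp
    have "\<forall>\<^sub>F k in sequentially. 1 / (c - b) < real k"
      using filterlim_real_sequentially by (simp add: filterlim_at_top_dense)
    then show ?thesis
      using that(1) unfolding good_def
    proof eventually_elim
      case (elim k)
      then obtain \<gamma> where "aligned (path_of x) e k b \<gamma>" by blast
      then show ?case by (rule aligned_extend[OF _ \<open>0 \<le> b\<close> \<open>b < c\<close> osc elim(1)])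
    qed
  qed (use that in simp)
  have "(0 :: real) \<le> 0 \<longrightarrow> good 0 \<longrightarrow> good T"
    using T
  proof (induction rule: Bolzano[where P = "\<lambda>b c. 0 \<le> b \<longrightarrow> good b \<longrightarrow> good c"])
    case (trans a b c)
    then show ?case by auto
  next
    case (local t)
    obtain l where l: "(path_of x \<longlongrightarrow> l) (at_left t)" using path_tendsto_left by blast
    have "\<forall>\<^sub>F s in at_left t. dist (path_of x s) l < e / 2" using l by (rule tendstoD) (use e in simp)
    then obtain p where p: "p < t" "\<And>s. p < s \<Longrightarrow> s < t \<Longrightarrow> dist (path_of x s) l < e / 2"
      unfolding eventually_at_left[of "t - 1" t, simplified] by blast
    have "\<forall>\<^sub>F s in at_right t. dist (path_of x s) (path_of x t) < e / 2"
      using path_tendsto_right by (rule tendstoD) (use e in simp)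
    then obtain q where q: "t < q" "\<And>s. t < s \<Longrightarrow> s < q \<Longrightarrow> dist (path_of x s) (path_of x t) < e / 2"
      unfolding eventually_at_right[OF less_add_one[of t]] by blast
    show ?case
    proof (intro exI[of _ "min (t - p) (q - t)"] conjI allI impI)
      show "0 < min (t - p) (q - t)" using p q by simp
      fix b c :: real
      assume bc: "b \<le> t \<and> t \<le> c \<and> c - b < min (t - p) (q - t)" and b: "0 \<le> b" "good b"
      have "good t"
      proof (rule extend[OF b(2,1)])
        fix s s' assume s: "s \<in> {b..<t}" "s' \<in> {b..<t}"
        have "dist (path_of x s) l < e / 2" "dist (path_of x s') l < e / 2"
          using p(2)[of s] p(2)[of s'] s bc by auto
        then show "\<bar>path_of x s - path_of x s'\<bar> \<le> e" unfolding dist_real_def by linarith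
      qed (use bc in simp)
      then show "good c"
      proof (rule extend)
        fix s s' assume s: "s \<in> {t..<c}" "s' \<in> {t..<c}"
        have "dist (path_of x u) (path_of x t) < e / 2" if "u \<in> {t..<c}" for u
          using that bc q(2)[of u] e by (cases "u = t") auto
        from this[OF s(1)] this[OF s(2)] show "\<bar>path_of x s - path_of x s'\<bar> \<le> e"
          unfolding dist_real_def by linarith
      qed (use bc b in auto)
    qed
  qed
  moreover have "good 0"
    unfolding good_def using e
    by (intro always_eventually allI exI[of _ "\<lambda>t. t"]) (auto simp: aligned_def strict_mono_on_def)
  ultimately show ?thesis by (simp add: good_def)
qed

lemma skorohod_dist_discretise:
  assumes e: "0 < e"
  shows "\<forall>\<^sub>F k in sequentially.
    skorohod_dist (real m) (damped m (path_of x)) (damped m (path_of (discretise k x))) \<le> e"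
proof -
  obtain B where B: "0 \<le> B" "\<And>t. t \<le> real m \<Longrightarrow> \<bar>path_of x t\<bar> \<le> B" using path_bounded_by[of "real m" x] by blast
  have "\<forall>\<^sub>F k in sequentially. \<exists>\<gamma>. aligned (path_of x) (e / 2) k (real m) \<gamma>"
    using e by (intro aligned_exists) auto
  moreover have "\<forall>\<^sub>F k in sequentially. 2 * (B + 1) / e < real k"
    using filterlim_real_sequentially by (simp add: filterlim_at_top_dense)
  ultimately show ?thesis
    using eventually_ge_at_top[of "Suc m"]
  proof eventually_elim
    case (elim k)
    then obtain \<gamma> where al: "aligned (path_of x) (e / 2) k (real m) \<gamma>" by blast
    have k: "m < k" "0 < real k" using elim by auto
    have "\<lceil>real m * real k\<rceil> = int (m * k)" by (metis ceiling_of_nat of_nat_mult)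
    then have "\<lceil>real m * real k\<rceil> / real k = real m" using k by simp
    then have g: "strict_mono_on {0..real m} \<gamma>" "\<gamma> ` {0..real m} = {0..real m}"
      "\<And>s. s \<in> {0..real m} \<Longrightarrow> \<bar>\<gamma> s - s\<bar> \<le> 1 / real k"
      "\<And>s. s \<in> {0..<real m} \<Longrightarrow> \<bar>path_of x s - path_of x (\<lfloor>\<gamma> s * real k\<rfloor> / real k)\<bar> \<le> e / 2"
      using al by (auto simp: aligned_def)
    have gt: "\<gamma> \<in> time_changes (real m)" using g by (simp add: time_changes_def)
    have Bk: "(B + 1) / real k \<le> e / 2" using elim(2) e k B(1) by (simp add: field_simps)
    have "skorohod_cost (real m) (damped m (path_of x)) (damped m (path_of (discretise k x))) \<gamma> \<le> e"
    proof (rule skorohod_cost_le)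
      fix s assume s: "s \<in> {0..real m}"
      have "1 / real k \<le> (B + 1) / real k" using k B(1) by (intro divide_right_mono) auto
      then show "\<bar>\<gamma> s - s\<bar> \<le> e" using g(3)[OF s] Bk e by linarith
      show "\<bar>damped m (path_of x) s - damped m (path_of (discretise k x)) (\<gamma> s)\<bar> \<le> e"
      proof (cases "s = real m")
        case True
        have "\<gamma> s = real m" using strict_mono_on_right_end[OF g(1,2)] True by simp
        then show ?thesis using True e by (simp add: damped_def)
      next
        case False
        then have s': "s \<in> {0..<real m}" using s by auto
        have gs: "\<gamma> s \<in> {0..real m}" by (rule time_changesD(4)[OF gt s])
        let ?y = "path_of x (\<lfloor>\<gamma> s * real k\<rfloor> / real k)" and ?\<phi> = "\<lambda>s. max 0 (min 1 (real m - s))"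
        have "path_of (discretise k x) (\<gamma> s) = \<lfloor>?y * real k\<rfloor> / real k"
          using gs k by (intro path_discretise) auto
        moreover have "?y - 1 / real k \<le> \<lfloor>?y * real k\<rfloor> / real k" "\<lfloor>?y * real k\<rfloor> / real k \<le> ?y"
        proof -
          have "(?y * real k - 1) / real k \<le> \<lfloor>?y * real k\<rfloor> / real k"
            using k by (intro divide_right_mono) linarith+
          then show "?y - 1 / real k \<le> \<lfloor>?y * real k\<rfloor> / real k" using k by (simp add: diff_divide_distrib)
          have "\<lfloor>?y * real k\<rfloor> / real k \<le> (?y * real k) / real k" using k by (intro divide_right_mono) auto
          then show "\<lfloor>?y * real k\<rfloor> / real k \<le> ?y" using k by simp
        qed
        ultimately have y: "\<bar>path_of x s - path_of (discretise k x) (\<gamma> s)\<bar> \<le> e / 2 + 1 / real k"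
          using g(4)[OF s'] by linarith
        have split: "damped m (path_of x) s - damped m (path_of (discretise k x)) (\<gamma> s)
            = (?\<phi> s - ?\<phi> (\<gamma> s)) * path_of x s
              + ?\<phi> (\<gamma> s) * (path_of x s - path_of (discretise k x) (\<gamma> s))"
          by (simp add: damped_def algebra_simps)
        have A: "\<bar>(?\<phi> s - ?\<phi> (\<gamma> s)) * path_of x s\<bar> \<le> (1 / real k) * B"
          unfolding abs_mult using g(3)[OF s] B(2)[of s] s by (intro mult_mono) auto
        have "\<bar>?\<phi> (\<gamma> s) * (path_of x s - path_of (discretise k x) (\<gamma> s))\<bar> \<le> 1 * (e / 2 + 1 / real k)"
          unfolding abs_mult using y by (intro mult_mono) auto
        from add_mono[OF A this]
        have "\<bar>damped m (path_of x) s - damped m (path_of (discretise k x)) (\<gamma> s)\<bar>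
            \<le> (1 / real k) * B + 1 * (e / 2 + 1 / real k)"
          unfolding split by (rule order_trans[OF abs_triangle_ineq])
        also have "\<dots> = e / 2 + (B + 1) / real k" by (simp add: add_divide_distrib)
        finally show ?thesis using Bk by linarith
      qed
    qed simp
    then show ?case
      using skorohod_dist_le[OF _ bounded_damped bounded_damped gt, of m x m "discretise k x"] by simp
  qed
qed

lemma discretise_tendsto: "(\<lambda>k. discretise k x) \<longlonglongrightarrow> x"
proof (rule tendstoI)
  fix e :: real assume e: "0 < e"
  obtain M where M: "(1/2) ^ M < e / 2" using real_arch_pow_inv[of "e / 2" "1/2"] e by auto
  have "\<forall>\<^sub>F k in sequentially. \<forall>m\<in>{..<M}. skorohod_dist (real (Suc m)) (damped (Suc m) (path_of x))
      (damped (Suc m) (path_of (discretise k x))) \<le> e / 2"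
    using e by (intro eventually_ball_finite ballI skorohod_dist_discretise) auto
  then show "\<forall>\<^sub>F k in sequentially. dist (discretise k x) x < e"
  proof eventually_elim
    case (elim k)
    have "dist x (discretise k x) \<le> e / 2 + (1/2) ^ M"
      by (rule cadlag_dist_le) (use e elim in auto)
    then show ?case using M by (simp add: dist_commute)
  qed
qed

text \<open>Each discretisation is a function of finitely many rounded values of the path, and the
  discretisations converge to the path in the Skorohod metric.\<close>

lemma borel_measurable_cadlagI:
  assumes X: "\<And>t. 0 \<le> t \<Longrightarrow> (\<lambda>\<omega>. path_of (X \<omega>) t) \<in> borel_measurable M"
  shows "X \<in> borel_measurable M"
proof (rule borel_measurable_LIMSEQ_metric)
  show "(\<lambda>k. discretise k (X \<omega>)) \<longlonglongrightarrow> X \<omega>" for \<omega> by (rule discretise_tendsto)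
  fix k :: nat
  let ?L = "\<lambda>\<omega>. map (\<lambda>i. \<lfloor>path_of (X \<omega>) (real i / real k) * real k\<rfloor>) [0..<k * k]"
  have "?L \<in> measurable M (count_space UNIV)"
    unfolding measurable_count_space_eq2_countable
  proof (intro conjI ballI)
    fix l :: "int list"
    have "?L -` {l} \<inter> space M = (if length l = k * k
        then {\<omega>\<in>space M. \<forall>i\<in>{..<k * k}. \<lfloor>path_of (X \<omega>) (real i / real k) * real k\<rfloor> = l ! i} else {})"
      by (auto simp: list_eq_iff_nth_eq)
    also have "\<dots> \<in> sets M"
    proof -
      have [measurable]: "(\<lambda>\<omega>. path_of (X \<omega>) (real i / real k)) \<in> borel_measurable M" for i by (rule X) simp
      have "{\<omega>\<in>space M. \<forall>i\<in>{..<k * k}. \<lfloor>path_of (X \<omega>) (real i / real k) * real k\<rfloor> = l ! i} \<in> sets M"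
        by measurable
      then show ?thesis by simp
    qed
    finally show "?L -` {l} \<inter> space M \<in> sets M" .
  qed simp
  then have "(\<lambda>\<omega>. grid_path k (?L \<omega>)) \<in> borel_measurable M"
    by (rule measurable_compose) simp
  then show "(\<lambda>\<omega>. discretise k (X \<omega>)) \<in> borel_measurable M"
    by (simp add: discretise_def)
qed

section \<open>Empirical distributions sampled in order\<close>

text \<open>Bounding \<open>\<kappa> l\<close> by its first and last values in the block compares both the count of
  \<open>\<kappa> l + v l \<le> t\<close> and the sum of \<open>F (t - \<kappa> l)\<close> with their values for constant \<open>\<kappa>\<close>.\<close>

lemma block_empirical_bound:
  fixes F :: "real \<Rightarrow> real" and v \<kappa> :: "nat \<Rightarrow> real" and i j :: nat
  assumes F: "mono F"
    and mono: "\<And>l l'. l \<in> {i<..j} \<Longrightarrow> l' \<in> {i<..j} \<Longrightarrow> l \<le> l' \<Longrightarrow> \<kappa> l \<le> \<kappa> l'"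
    and ij: "i < j"
    and c: "\<And>x. \<bar>\<Sum>l\<in>{i<..j}. of_bool (v l \<le> x) - F x\<bar> \<le> c"
  shows "\<bar>\<Sum>l\<in>{i<..j}. of_bool (\<kappa> l + v l \<le> t) - F (t - \<kappa> l)\<bar>
    \<le> real (j - i) * (F (t - \<kappa> (Suc i)) - F (t - \<kappa> j)) + c"
proof -
  let ?B = "real (j - i)" and ?a = "t - \<kappa> (Suc i)" and ?b = "t - \<kappa> j"
  have between: "?b \<le> t - \<kappa> l" "t - \<kappa> l \<le> ?a" if "l \<in> {i<..j}" for l
    using that ij by (auto intro!: mono)
  have cF: "\<bar>(\<Sum>l\<in>{i<..j}. of_bool (v l \<le> x)) - ?B * F x\<bar> \<le> c" for x
    using c[of x] by (simp add: sum_subtractf)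
  have "(\<Sum>l\<in>{i<..j}. of_bool (\<kappa> l + v l \<le> t)) \<le> (\<Sum>l\<in>{i<..j}. of_bool (v l \<le> ?a) :: real)"
    by (intro sum_mono) (use between(2) in fastforce)
  moreover have "(\<Sum>l\<in>{i<..j}. of_bool (v l \<le> ?b)) \<le> (\<Sum>l\<in>{i<..j}. of_bool (\<kappa> l + v l \<le> t) :: real)"
    by (intro sum_mono) (use between(1) in fastforce)
  moreover have "?B * F ?b \<le> (\<Sum>l\<in>{i<..j}. F (t - \<kappa> l))"
    using sum_mono[of "{i<..j}" "\<lambda>_. F ?b" "\<lambda>l. F (t - \<kappa> l)"] between(1) F by (simp add: monoD)
  moreover have "(\<Sum>l\<in>{i<..j}. F (t - \<kappa> l)) \<le> ?B * F ?a"
    using sum_mono[of "{i<..j}" "\<lambda>l. F (t - \<kappa> l)" "\<lambda>_. F ?a"] between(2) F by (simp add: monoD)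
  ultimately show ?thesis
    using cF[of ?a] cF[of ?b] unfolding sum_subtractf right_diff_distrib by linarith
qed

lemma sum_diff_initial: "(i :: nat) \<le> j \<Longrightarrow> (\<Sum>l\<in>{i<..j}. f l) = (\<Sum>l=1..j. f l) - (\<Sum>l=1..i. f l :: real)"
proof -
  assume "i \<le> j"
  then have "{1..j} = {1..i} \<union> {i<..j}" unfolding set_eq_iff by simp arith
  then show ?thesis by (simp add: sum.union_disjoint ivl_disj_int)
qed

text \<open>The quantification over all nondecreasing \<open>\<kappa>\<close> allows starting times that depend on the samples
  themselves.\<close>

definition samples_close :: "(real \<Rightarrow> real) \<Rightarrow> (nat \<Rightarrow> real) \<Rightarrow> nat \<Rightarrow> real \<Rightarrow> bool" where
  "samples_close F v K c \<longleftrightarrow> (\<forall>\<kappa> t. (\<forall>i j. 1 \<le> i \<longrightarrow> i \<le> j \<longrightarrow> j \<le> K \<longrightarrow> \<kappa> i \<le> \<kappa> j) \<longrightarrow>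
     \<bar>\<Sum>i=1..K. of_bool (\<kappa> i + v i \<le> t) - F (t - \<kappa> i)\<bar> \<le> c)"

lemma samples_closeD:
  assumes "samples_close F v K c" "\<And>i j. 1 \<le> i \<Longrightarrow> i \<le> j \<Longrightarrow> j \<le> K \<Longrightarrow> \<kappa> i \<le> \<kappa> j"
  shows "\<bar>\<Sum>i=1..K. of_bool (\<kappa> i + v i \<le> t) - F (t - \<kappa> i)\<bar> \<le> c"
  using assms unfolding samples_close_def by blast

text \<open>Over the blocks the masses \<open>F (t - \<kappa> (Suc i)) - F (t - \<kappa> j)\<close> telescope to at most 1, so that the widths
  of the blocks cost only \<open>B\<close> in total; the last, incomplete block costs another \<open>B\<close>.\<close>

lemma ordered_empirical_bound:
  fixes F :: "real \<Rightarrow> real" and v \<kappa> :: "nat \<Rightarrow> real" and B K m :: nat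
  assumes F: "mono F" "\<And>x. 0 \<le> F x" "\<And>x. F x \<le> 1"
    and mono: "\<And>i j. 1 \<le> i \<Longrightarrow> i \<le> j \<Longrightarrow> j \<le> K \<Longrightarrow> \<kappa> i \<le> \<kappa> j"
    and c: "\<And>k x. k \<le> m \<Longrightarrow> \<bar>\<Sum>i=1..k * B. of_bool (v i \<le> x) - F x\<bar> \<le> c"
    and B: "0 < B" and K: "K \<le> m * B"
  shows "\<bar>\<Sum>i=1..K. of_bool (\<kappa> i + v i \<le> t) - F (t - \<kappa> i)\<bar> \<le> 2 * real B + 2 * real m * c"
proof -
  define S where "S k = (\<Sum>i=1..k. of_bool (\<kappa> i + v i \<le> t) - F (t - \<kappa> i))" for k
  define g where "g j = (if j = 0 then 1 else F (t - \<kappa> (j * B)))" for j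
  have c0: "0 \<le> c" using c[of 0] by simp
  have S: "\<bar>S (j * B)\<bar> \<le> real B * (1 - g j) + 2 * real j * c" if "j * B \<le> K" for j
    using that
  proof (induction j)
    case 0
    then show ?case by (simp add: S_def g_def)
  next
    case (Suc j)
    have lt: "j * B < Suc j * B" using B by simp
    have "Suc j * B \<le> m * B" using Suc.prems K by simp
    then have jm: "Suc j \<le> m" using B by (simp only: mult_le_cancel2)
    have "\<bar>S (Suc j * B) - S (j * B)\<bar>
        \<le> real (Suc j * B - j * B) * (F (t - \<kappa> (Suc (j * B))) - F (t - \<kappa> (Suc j * B))) + 2 * c"
      unfolding S_def sum_diff_initial[OF less_imp_le[OF lt], symmetric]
    proof (rule block_empirical_bound[OF F(1) _ lt])
      show "\<kappa> l \<le> \<kappa> l'" if "l \<in> {j * B<..Suc j * B}" "l' \<in> {j * B<..Suc j * B}" "l \<le> l'" for l l'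
        using that Suc.prems by (intro mono) auto
      show "\<bar>\<Sum>l\<in>{j * B<..Suc j * B}. of_bool (v l \<le> x) - F x\<bar> \<le> 2 * c" for x
        using c[of "Suc j" x] c[of j x] jm unfolding sum_diff_initial[OF less_imp_le[OF lt]] by linarith
    qed
    also have "Suc j * B - j * B = B" by simp
    also have "real B * (F (t - \<kappa> (Suc (j * B))) - F (t - \<kappa> (Suc j * B))) \<le> real B * (g j - g (Suc j))"
    proof (intro mult_left_mono diff_mono)
      show "F (t - \<kappa> (Suc (j * B))) \<le> g j"
        using F Suc.prems B by (auto simp: g_def intro!: monoD[OF F(1)] mono)
    qed (simp_all add: g_def)
    finally have "\<bar>S (Suc j * B) - S (j * B)\<bar> \<le> real B * (g j - g (Suc j)) + 2 * c" by simp
    moreover have "\<bar>S (j * B)\<bar> \<le> real B * (1 - g j) + 2 * real j * c"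
      using Suc.prems by (intro Suc.IH) simp
    ultimately have "\<bar>S (Suc j * B)\<bar> \<le> real B * (1 - g j) + 2 * real j * c + (real B * (g j - g (Suc j)) + 2 * c)"
      by linarith
    then show ?case by (simp add: algebra_simps)
  qed
  let ?j = "K div B"
  have jK: "?j * B \<le> K" by simp
  have "?j * B \<le> m * B" using jK K by linarith
  then have jm: "?j \<le> m" using B by simp
  have "\<bar>S K - S (?j * B)\<bar> \<le> (\<Sum>i\<in>{?j * B<..K}. \<bar>of_bool (\<kappa> i + v i \<le> t) - F (t - \<kappa> i)\<bar>)"
    unfolding S_def sum_diff_initial[OF jK, symmetric] by (rule sum_abs)
  also have "\<dots> \<le> (\<Sum>i\<in>{?j * B<..K}. 1)"
  proof (rule sum_mono)
    fix i
    show "\<bar>of_bool (\<kappa> i + v i \<le> t) - F (t - \<kappa> i)\<bar> \<le> 1"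
      using F(2,3)[of "t - \<kappa> i"] by (auto simp: abs_le_iff)
  qed
  also have "\<dots> \<le> real B"
    using B mod_less_divisor[OF B, of K] by (simp add: minus_div_mult_eq_mod)
  finally have "\<bar>S K\<bar> \<le> real B + \<bar>S (?j * B)\<bar>" by linarith
  also have "\<dots> \<le> real B + (real B * 1 + 2 * real m * c)"
  proof -
    have "0 \<le> g ?j" using F(2) by (simp add: g_def)
    then have "real B * (1 - g ?j) \<le> real B * 1" by (intro mult_left_mono) auto
    moreover have "2 * real ?j * c \<le> 2 * real m * c" using jm c0 by (intro mult_right_mono mult_left_mono) auto
    ultimately show ?thesis using S[OF jK] by linarith
  qed
  finally show ?thesis by (simp add: S_def)
qed

context real_distribution
begin

lemma cdf_strict_le: "measure M {..<x} \<le> cdf M x"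
  unfolding cdf_def by (rule finite_measure_mono) auto

text \<open>Bisection: every point \<open>x\<close> has neighbours \<open>p < x < q\<close> such that little mass lies in the open intervals
  \<open>(p, x)\<close> and \<open>(x, q)\<close>.  An atom at \<open>x\<close> is harmless, as \<open>x\<close> itself belongs to the grid.\<close>

lemma finite_quantile_grid_interval:
  assumes e: "0 < e" and "a \<le> b"
  shows "\<exists>X. finite X \<and> (\<forall>x\<in>{a..b}. \<exists>p\<in>X. \<exists>q\<in>X. p \<le> x \<and> x < q \<and> measure M {..<q} - cdf M p \<le> e)"
  using \<open>a \<le> b\<close>
proof (induction rule: Bolzano)
  case (trans a b c)
  then obtain X Y where "finite X" "finite Y"
    "\<forall>x\<in>{a..b}. \<exists>p\<in>X. \<exists>q\<in>X. p \<le> x \<and> x < q \<and> measure M {..<q} - cdf M p \<le> e"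
    "\<forall>x\<in>{b..c}. \<exists>p\<in>Y. \<exists>q\<in>Y. p \<le> x \<and> x < q \<and> measure M {..<q} - cdf M p \<le> e" by blast
  then have "\<forall>x\<in>{a..c}. \<exists>p\<in>X \<union> Y. \<exists>q\<in>X \<union> Y. p \<le> x \<and> x < q \<and> measure M {..<q} - cdf M p \<le> e"
    by (metis UnCI atLeastAtMost_iff linorder_le_cases)
  then show ?case using \<open>finite X\<close> \<open>finite Y\<close> by blast
next
  case (local x)
  have "\<forall>\<^sub>F y in at_right x. cdf M y < cdf M x + e"
    using cdf_is_right_cont[of x] e by (intro order_tendstoD(2)[where y = "cdf M x"]) (auto simp: continuous_within)
  then obtain q where q: "x < q" "\<And>y. x < y \<Longrightarrow> y < q \<Longrightarrow> cdf M y < cdf M x + e"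
    unfolding eventually_at_right[OF less_add_one[of x]] by blast
  have "\<forall>\<^sub>F y in at_left x. measure M {..<x} - e < cdf M y"
    using cdf_at_left[of x] e by (intro order_tendstoD(1)[where y = "measure M {..<x}"]) auto
  then obtain p where p: "p < x" "\<And>y. p < y \<Longrightarrow> y < x \<Longrightarrow> measure M {..<x} - e < cdf M y"
    unfolding eventually_at_left[of "x - 1" x, simplified] by blast
  define p' q' where "p' = (p + x) / 2" and "q' = (x + q) / 2"
  have p': "p' < x" "measure M {..<x} - cdf M p' \<le> e" using p(1) p(2)[of p'] by (auto simp: p'_def)
  have q': "x < q'" "measure M {..<q'} - cdf M x \<le> e"
    using q(1) q(2)[of q'] cdf_strict_le[of q'] by (auto simp: q'_def)
  show ?case
  proof (intro exI[of _ "min (x - p') (q' - x)"] conjI allI impI)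
    show "0 < min (x - p') (q' - x)" using p'(1) q'(1) by simp
    fix u w :: real assume uw: "u \<le> x \<and> x \<le> w \<and> w - u < min (x - p') (q' - x)"
    have "\<exists>a\<in>{p', x, q'}. \<exists>b\<in>{p', x, q'}. a \<le> y \<and> y < b \<and> measure M {..<b} - cdf M a \<le> e"
      if "y \<in> {u..w}" for y
    proof (cases "y < x")
      case True
      then show ?thesis using that uw p' by (intro bexI[of _ p'] bexI[of _ x]) auto
    next
      case False
      then show ?thesis using that uw q' by (intro bexI[of _ x] bexI[of _ q']) auto
    qed
    then show "\<exists>X. finite X \<and> (\<forall>y\<in>{u..w}. \<exists>a\<in>X. \<exists>b\<in>X. a \<le> y \<and> y < b \<and> measure M {..<b} - cdf M a \<le> e)"
      by (intro exI[of _ "{p', x, q'}"]) auto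
  qed
qed

text \<open>Control of the empirical distribution function and of its left limits on a finite grid, chosen
  in advance, gives uniform control: between neighbouring grid points both functions are squeezed.\<close>

lemma uniform_from_finite_grid:
  assumes nonneg: "AE s in M. 0 \<le> s" and e: "0 < e"
  obtains X where "finite X"
    "\<And>(v :: nat \<Rightarrow> real) k c x. (\<And>i. 1 \<le> i \<Longrightarrow> 0 \<le> v i) \<Longrightarrow> 0 \<le> c \<Longrightarrow>
      (\<And>y. y \<in> X \<Longrightarrow> \<bar>\<Sum>i=1..k. of_bool (v i \<le> y) - cdf M y\<bar> \<le> c) \<Longrightarrow>
      (\<And>y. y \<in> X \<Longrightarrow> \<bar>\<Sum>i=1..k. of_bool (v i < y) - measure M {..<y}\<bar> \<le> c) \<Longrightarrow>
      \<bar>\<Sum>i=1..k. of_bool (v i \<le> x) - cdf M x\<bar> \<le> c + e * real k"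
proof -
  have "\<forall>\<^sub>F x in at_top. 1 - e < cdf M x"
    using e by (intro order_tendstoD(1)[OF cdf_lim_at_top_prob]) simp
  then obtain b where b: "\<And>x. b \<le> x \<Longrightarrow> 1 - e < cdf M x" unfolding eventually_at_top_linorder by blast
  define T where "T = max b 0"
  have T: "0 \<le> T" "1 - e < cdf M T" using b[of T] by (auto simp: T_def)
  obtain X where X: "finite X"
    "\<And>x. x \<in> {0..T} \<Longrightarrow> \<exists>p\<in>X. \<exists>q\<in>X. p \<le> x \<and> x < q \<and> measure M {..<q} - cdf M p \<le> e"
    using finite_quantile_grid_interval[OF e T(1)] by blast
  have neg: "cdf M x = 0" if "x < 0" for x
  proof -
    have "{..x} \<in> null_sets M"
      using nonneg that by (subst AE_iff_null_sets) (auto elim: eventually_mono)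
    then show ?thesis by (simp add: cdf_def measure_eq_emeasure_eq_ennreal null_setsD1 enn2real_eq_0_iff measure_def)
  qed
  show thesis
  proof (rule that[of "insert T X"])
    show "finite (insert T X)" using X(1) by simp
    fix v :: "nat \<Rightarrow> real" and k c x
    assume v: "\<And>i. 1 \<le> i \<Longrightarrow> 0 \<le> v i" and c: "0 \<le> c"
      and le: "\<And>y. y \<in> insert T X \<Longrightarrow> \<bar>\<Sum>i=1..k. of_bool (v i \<le> y) - cdf M y\<bar> \<le> c"
      and less: "\<And>y. y \<in> insert T X \<Longrightarrow> \<bar>\<Sum>i=1..k. of_bool (v i < y) - measure M {..<y}\<bar> \<le> c"
    let ?n = "\<lambda>x. \<Sum>i=1..k. of_bool (v i \<le> x) :: real" and ?m = "\<lambda>x. \<Sum>i=1..k. of_bool (v i < x) :: real"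
    have le': "\<bar>?n y - k * cdf M y\<bar> \<le> c" and less': "\<bar>?m y - k * measure M {..<y}\<bar> \<le> c" if "y \<in> insert T X" for y
      using le[OF that] less[OF that] by (simp_all add: sum_subtractf)
    have mono: "?n p \<le> ?n x" if "p \<le> x" for p
      by (intro sum_mono) (use that in auto)
    have "\<bar>?n x - k * cdf M x\<bar> \<le> c + e * k"
    proof (cases "x < 0")
      case True
      have "?n x = 0" using v True by (intro sum.neutral) fastforce
      then show ?thesis using neg[OF True] c e by simp
    next
      case x0: False
      show ?thesis
      proof (cases "x \<le> T")
        case True
        then obtain p q where pq: "p \<in> X" "q \<in> X" "p \<le> x" "x < q" "measure M {..<q} - cdf M p \<le> e"
          using X(2)[of x] x0 by auto
        have "?n x \<le> ?m q" by (intro sum_mono) (use pq in auto)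
        moreover have "cdf M x \<le> measure M {..<q}"
          unfolding cdf_def using pq by (intro finite_measure_mono) auto
        moreover have "cdf M p \<le> cdf M x" using pq by (intro cdf_nondecreasing)
        moreover have "k * (measure M {..<q} - cdf M p) \<le> k * e" using pq by (intro mult_left_mono) auto
        moreover have "k * cdf M x \<le> k * measure M {..<q}" "k * cdf M p \<le> k * cdf M x"
          using calculation by (auto intro!: mult_left_mono)
        ultimately show ?thesis
          using mono[OF pq(3)] le'[of p] less'[of q] pq(1,2) by (simp add: algebra_simps)
      next
        case False
        then have "T \<le> x" by simp
        have "?n x \<le> (\<Sum>i=1..k. 1)" by (intro sum_mono) auto
        moreover have "k * (1 - e) \<le> k * cdf M T" "k * cdf M T \<le> k * cdf M x"
          using T \<open>T \<le> x\<close> by (auto intro!: mult_left_mono cdf_nondecreasing)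
        moreover have "k * cdf M x \<le> k" using cdf_bounded_prob[of x] by (simp add: mult_left_le)
        ultimately show ?thesis
          using mono[OF \<open>T \<le> x\<close>] le'[of T] c by (simp add: algebra_simps)
      qed
    qed
    then show "\<bar>\<Sum>i=1..k. of_bool (v i \<le> x) - cdf M x\<bar> \<le> c + e * real k"
      by (simp add: sum_subtractf)
  qed
qed

end


context prob_space
begin

lemma hoeffding_of_bool:
  fixes v :: "nat \<Rightarrow> 'a \<Rightarrow> real" and k :: nat
  assumes indep: "indep_vars (\<lambda>_. borel) v {1..}" and P: "Measurable.pred borel P"
    and p: "\<And>i. 1 \<le> i \<Longrightarrow> expectation (\<lambda>\<omega>. of_bool (P (v i \<omega>))) = (p :: real)"
    and k: "0 < k" and e: "0 \<le> e"
  shows "prob {\<omega>\<in>space M. e \<le> \<bar>\<Sum>i=1..k. of_bool (P (v i \<omega>)) - p\<bar>} \<le> 2 * exp (- 2 * e\<^sup>2 / k)"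
proof -
  have [measurable]: "(\<lambda>x. of_bool (P x) :: real) \<in> borel_measurable borel" using P by measurable
  have "indep_vars (\<lambda>_. borel) (\<lambda>i \<omega>. of_bool (P (v i \<omega>)) :: real) {1..k}"
    using indep_vars_subset[OF indep] by (rule indep_vars_compose2) auto
  then interpret Hoeffding_ineq M "{1..k}" "\<lambda>i \<omega>. of_bool (P (v i \<omega>)) :: real" "\<lambda>_. 0" "\<lambda>_. 1" "k * p"
    by unfold_locales (auto simp: p)
  show ?thesis
    using Hoeffding_ineq_abs_ge[OF e] k by (simp add: sum_subtractf)
qed

text \<open>By Hoeffding's inequality the empirical frequencies are exponentially unlikely to be off at any of
  finitely many block ends and half-lines; their number does not grow with \<open>n\<close>.\<close>

lemma empirical_uniform_law:
  fixes v :: "nat \<Rightarrow> 'a \<Rightarrow> real"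
  assumes indep: "indep_vars (\<lambda>_. borel) v {1..}"
    and nonneg: "\<And>i \<omega>. 1 \<le> i \<Longrightarrow> \<omega> \<in> space M \<Longrightarrow> 0 \<le> v i \<omega>"
    and distr: "\<And>i. 1 \<le> i \<Longrightarrow> cdf (distr M borel (v i)) = F"
    and e: "0 < e" and \<delta>: "0 < \<delta>"
  shows "mostly \<delta> (\<lambda>n \<omega>. \<forall>K. real K \<le> real C * real n \<longrightarrow> samples_close F (\<lambda>i. v i \<omega>) K (e * real n))"
proof -
  have v [measurable]: "v i \<in> borel_measurable M" if "1 \<le> i" for i
    using indep that unfolding indep_vars_def by auto
  define \<nu> where "\<nu> = distr M borel (v 1)"
  interpret \<nu>: real_distribution \<nu> unfolding \<nu>_def by (rule real_distribution_distr) simp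
  have F: "F = cdf \<nu>" by (simp add: \<nu>_def distr)
  have \<nu>_eq: "distr M borel (v i) = \<nu>" if "1 \<le> i" for i
    by (rule cdf_unique) (use that distr[OF that] F \<nu>.real_distribution_axioms in \<open>auto intro: real_distribution_distr\<close>)
  have \<nu>_nonneg: "AE s in \<nu>. 0 \<le> s"
    unfolding \<nu>_def by (subst AE_distr_iff) (use nonneg in auto)
  have exp_le: "expectation (\<lambda>\<omega>. of_bool (v i \<omega> \<in> A)) = measure \<nu> A" if "1 \<le> i" "A \<in> sets borel" for i A
  proof -
    have "expectation (\<lambda>\<omega>. of_bool (v i \<omega> \<in> A)) = expectation (indicator (v i -` A \<inter> space M))"
      by (intro Bochner_Integration.integral_cong) (auto simp: indicator_def)
    also have "\<dots> = prob (v i -` A \<inter> space M)" by simp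
    also have "\<dots> = measure (distr M borel (v i)) A" using that by (subst measure_distr) auto
    finally show ?thesis using that by (simp add: \<nu>_eq)
  qed
  \<comment> \<open>A block is at most a fraction \<open>e / 4\<close> of \<open>n\<close>, so that its width costs at most \<open>e n / 2\<close>.\<close>
  define m0 where "m0 = nat \<lceil>8 / e\<rceil> + 1"
  have m0: "8 / e \<le> real m0" "0 < m0" using e by (auto simp: m0_def) linarith
  define m where "m = (C + 1) * m0"
  have m: "0 < m" using m0 by (simp add: m_def)
  define B where "B n = n div m0 + 1" for n
  \<comment> \<open>The tolerance \<open>c n\<close> at the grid points and the interpolation error \<open>d\<close> times at most \<open>2 (C + 1) n\<close>
    samples are equal; together with the factor \<open>2 m\<close> they cost the other \<open>e n / 2\<close>.\<close>
  define d where "d = e / (16 * real m * real (C + 1))"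
  have d: "0 < d" using e m by (simp add: d_def)
  define c where "c = e / (8 * real m)"
  have c: "0 < c" using e m by (simp add: c_def)
  obtain X where X: "finite X" and grid:
    "\<And>(v :: nat \<Rightarrow> real) k c x. (\<And>i. 1 \<le> i \<Longrightarrow> 0 \<le> v i) \<Longrightarrow> 0 \<le> c \<Longrightarrow>
      (\<And>y. y \<in> X \<Longrightarrow> \<bar>\<Sum>i=1..k. of_bool (v i \<le> y) - cdf \<nu> y\<bar> \<le> c) \<Longrightarrow>
      (\<And>y. y \<in> X \<Longrightarrow> \<bar>\<Sum>i=1..k. of_bool (v i < y) - measure \<nu> {..<y}\<bar> \<le> c) \<Longrightarrow>
      \<bar>\<Sum>i=1..k. of_bool (v i \<le> x) - cdf \<nu> x\<bar> \<le> c + d * real k"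
    using \<nu>.uniform_from_finite_grid[OF \<nu>_nonneg d] by metis
  define D where "D n j A = {\<omega>\<in>space M. c * real n \<le> \<bar>\<Sum>i=1..j * B n. of_bool (v i \<omega> \<in> A) - measure \<nu> A\<bar>}" for n j A
  define I where "I = {1..m} \<times> ((\<lambda>y. {..y}) ` X \<union> (\<lambda>y. {..<y}) ` X)"
  have I: "finite I" "\<And>j A. (j, A) \<in> I \<Longrightarrow> 1 \<le> j \<and> j \<le> m \<and> A \<in> sets borel"
    using X by (auto simp: I_def)
  define bad where "bad n = (\<Union>(j, A)\<in>I. D n j A)" for n
  have D: "D n j A \<in> events" if "A \<in> sets borel" for n j A
  proof -
    have [measurable]: "A \<in> sets borel" by fact
    have "(\<lambda>\<omega>. \<Sum>i=1..j * B n. of_bool (v i \<omega> \<in> A) - measure \<nu> A) \<in> borel_measurable M"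
      by (intro borel_measurable_sum) measurable
    then show ?thesis unfolding D_def by measurable
  qed
  have blocks: "real (j * B n) \<le> 2 * real (C + 1) * real n" if "j \<le> m" "m0 \<le> n" for j n
  proof -
    have "j * B n \<le> m * B n" using that by simp
    also have "\<dots> = (C + 1) * (m0 * (n div m0) + m0)" by (simp add: m_def B_def algebra_simps)
    also have "\<dots> \<le> (C + 1) * (n + n)" using that by (intro mult_left_mono add_mono) auto
    finally have "real (j * B n) \<le> real ((C + 1) * (n + n))" by (rule of_nat_mono)
    then show ?thesis by (simp add: algebra_simps)
  qed
  have D_prob: "prob (D n j A) \<le> 2 * exp (- (c\<^sup>2 / real (C + 1)) * real n)"
    if "(j, A) \<in> I" "m0 \<le> n" for n j A
  proof -
    have jA: "1 \<le> j" "j \<le> m" "A \<in> sets borel" using I(2)[OF that(1)] by auto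
    have n: "0 < real n" using that(2) m0(2) by simp
    have k: "0 < j * B n" using jA by (simp add: B_def)
    have "prob (D n j A) \<le> 2 * exp (- 2 * (c * real n)\<^sup>2 / real (j * B n))"
      unfolding D_def
    proof (rule hoeffding_of_bool[OF indep, where P = "\<lambda>x. x \<in> A"])
      show "Measurable.pred borel (\<lambda>x. x \<in> A)" using jA(3) by simp
      show "0 \<le> c * real n" using c by simp
    qed (fact exp_le[OF _ jA(3)] k)+
    also have "2 * (c * real n)\<^sup>2 / (2 * real (C + 1) * real n) \<le> 2 * (c * real n)\<^sup>2 / real (j * B n)"
      using blocks[OF jA(2) that(2)] k n by (intro divide_left_mono) auto
    then have "2 * exp (- 2 * (c * real n)\<^sup>2 / real (j * B n))
        \<le> 2 * exp (- (2 * (c * real n)\<^sup>2 / (2 * real (C + 1) * real n)))" by simp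
    also have "2 * (c * real n)\<^sup>2 / (2 * real (C + 1) * real n) = c\<^sup>2 / real (C + 1) * real n"
    proof -
      have gen: "2 * (c * x)\<^sup>2 / (2 * q * x) = c\<^sup>2 / q * x" if "0 < x" "0 < q" for x q :: real
        using that by (simp add: power2_eq_square field_simps)
      show ?thesis by (rule gen[OF n]) simp
    qed
    finally show ?thesis by simp
  qed
  have bad_prob: "prob (bad n) \<le> real (card I) * (2 * exp (- (c\<^sup>2 / real (C + 1)) * real n))" if "m0 \<le> n" for n
  proof -
    have "prob (bad n) \<le> (\<Sum>i\<in>I. prob (case i of (j, A) \<Rightarrow> D n j A))"
      unfolding bad_def by (rule finite_measure_subadditive_finite[OF I(1)]) (use D I(2) in fastforce)
    also have "\<dots> \<le> (\<Sum>i\<in>I. 2 * exp (- (c\<^sup>2 / real (C + 1)) * real n))"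
      using D_prob that by (intro sum_mono) auto
    finally show ?thesis by simp
  qed
  have lim: "(\<lambda>n. prob (bad n)) \<longlonglongrightarrow> 0"
  proof (rule tendsto_sandwich[OF _ _ tendsto_const])
    show "\<forall>\<^sub>F n in sequentially. 0 \<le> prob (bad n)" by simp
    show "\<forall>\<^sub>F n in sequentially. prob (bad n) \<le> real (card I) * (2 * exp (- (c\<^sup>2 / real (C + 1)) * real n))"
      using eventually_ge_at_top[of m0] by eventually_elim (rule bad_prob)
    have "0 < c\<^sup>2 / real (C + 1)" using c by simp
    then have "(\<lambda>n. exp (- (c\<^sup>2 / real (C + 1)) * real n)) \<longlonglongrightarrow> 0"
      by (intro filterlim_compose[OF exp_at_bot] filterlim_tendsto_neg_mult_at_bot[OF tendsto_const _ filterlim_real_sequentially]) simp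
    from tendsto_mult_right_zero[OF tendsto_mult_right_zero[OF this, of 2], of "real (card I)"]
    show "(\<lambda>n. real (card I) * (2 * exp (- (c\<^sup>2 / real (C + 1)) * real n))) \<longlonglongrightarrow> 0" .
  qed
  show ?thesis
  proof (rule mostlyI[of bad])
    show "bad n \<in> events" for n
      unfolding bad_def using D I(2) by (intro sets.finite_UN[OF I(1)]) fastforce
    show "\<forall>\<^sub>F n in sequentially. prob (bad n) \<le> \<delta>"
      using order_tendstoD(2)[OF lim \<delta>] by eventually_elim simp
    show "\<forall>\<^sub>F n in sequentially. \<forall>\<omega>\<in>space M - bad n. \<forall>K. real K \<le> real C * real n \<longrightarrow>
       samples_close F (\<lambda>i. v i \<omega>) K (e * real n)"
      using eventually_ge_at_top[of "max m0 (nat \<lceil>8 / e\<rceil>)"]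
    proof eventually_elim
      case (elim n)
      then have n: "m0 \<le> n" "8 / e \<le> real n" by auto
      show ?case
        unfolding samples_close_def
      proof (intro ballI allI impI)
        fix \<omega> K and \<kappa> :: "nat \<Rightarrow> real" and t
        assume w: "\<omega> \<in> space M - bad n" and K: "real K \<le> real C * real n"
          and mono: "\<forall>i j. 1 \<le> i \<longrightarrow> i \<le> j \<longrightarrow> j \<le> K \<longrightarrow> \<kappa> i \<le> (\<kappa> j :: real)"
        have "\<bar>\<Sum>i=1..K. of_bool (\<kappa> i + v i \<omega> \<le> t) - F (t - \<kappa> i)\<bar>
            \<le> 2 * real (B n) + 2 * real m * (2 * c * real n)"
          unfolding F
        proof (rule ordered_empirical_bound)
          show "mono (cdf \<nu>)" by (intro monoI \<nu>.cdf_nondecreasing)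
          show "0 \<le> cdf \<nu> x" "cdf \<nu> x \<le> 1" for x by (simp_all add: \<nu>.cdf_nonneg \<nu>.cdf_bounded_prob)
          show "\<kappa> i \<le> \<kappa> j" if "1 \<le> i" "i \<le> j" "j \<le> K" for i j using mono that by blast
          show "0 < B n" by (simp add: B_def)
          have "n \<le> m0 * (n div m0) + m0" using mod_less_divisor[OF m0(2), of n] by (metis add_left_mono less_imp_le mult_div_mod_eq)
          then have "C * n \<le> (C + 1) * (m0 * (n div m0) + m0)" by (intro mult_mono) auto
          also have "\<dots> = m * B n" by (simp add: m_def B_def algebra_simps)
          finally have "C * n \<le> m * B n" .
          moreover have "K \<le> C * n" using K by (simp flip: of_nat_mult)
          ultimately show "K \<le> m * B n" by simp
          fix j x assume j: "j \<le> m"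
          have DA: "\<bar>\<Sum>i=1..j * B n. of_bool (v i \<omega> \<in> A) - measure \<nu> A\<bar> \<le> c * real n"
            if "A \<in> (\<lambda>y. {..y}) ` X \<union> (\<lambda>y. {..<y}) ` X" for A
          proof (cases "j = 0")
            case True then show ?thesis using c by simp
          next
            case False
            then have "(j, A) \<in> I" using that j by (simp add: I_def)
            then have "\<omega> \<notin> D n j A" using w by (auto simp: bad_def)
            then show ?thesis using w by (auto simp: D_def)
          qed
          have "\<bar>\<Sum>i=1..j * B n. of_bool (v i \<omega> \<le> x) - cdf \<nu> x\<bar> \<le> c * real n + d * real (j * B n)"
          proof (rule grid)
            show "0 \<le> v i \<omega>" if "1 \<le> i" for i using nonneg[OF that] w by simp
            show "0 \<le> c * real n" using c by simp
            show "\<bar>\<Sum>i=1..j * B n. of_bool (v i \<omega> \<le> y) - cdf \<nu> y\<bar> \<le> c * real n" if "y \<in> X" for y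
              using DA[of "{..y}"] that by (simp add: cdf_def)
            show "\<bar>\<Sum>i=1..j * B n. of_bool (v i \<omega> < y) - measure \<nu> {..<y}\<bar> \<le> c * real n" if "y \<in> X" for y
              using DA[of "{..<y}"] that by simp
          qed
          also have "d * real (j * B n) \<le> d * (2 * real (C + 1) * real n)"
            using blocks[OF j n(1)] d by (intro mult_left_mono) auto
          also have "\<dots> = c * real n"
          proof -
            have gen: "e / (16 * x * y) * (2 * y * z) = e / (8 * x) * z" if "0 < x" "0 < y" for x y z :: real
              using that by (simp add: field_simps)
            show ?thesis unfolding d_def c_def by (rule gen) (use m in auto)
          qed
          finally show "\<bar>\<Sum>i=1..j * B n. of_bool (v i \<omega> \<le> x) - cdf \<nu> x\<bar> \<le> 2 * c * real n" by simp
        qed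
        also have "2 * real m * (2 * c * real n) = e / 2 * real n" using m by (simp add: c_def)
        also have "2 * real (B n) \<le> e / 2 * real n"
        proof -
          have "real (n div m0) \<le> real n / real m0" 
            using of_int_floor_le[of "real n / real m0"] by (simp add: floor_divide_of_nat_eq)
          also have "\<dots> \<le> real n / (8 / e)" using m0 e by (intro divide_left_mono) auto
          finally have "real (n div m0) \<le> e / 8 * real n" by (simp add: field_simps)
          moreover have "1 \<le> e / 8 * real n" using n(2) e by (simp add: field_simps)
          ultimately show ?thesis by (simp add: B_def)
        qed
        finally show "\<bar>\<Sum>i=1..K. of_bool (\<kappa> i + v i \<omega> \<le> t) - F (t - \<kappa> i)\<bar> \<le> e * real n" by simp
      qed
    qed
  qed
qed

end

section \<open>The queue path by path\<close>

lemma of_bool_sum_right_eventually: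
  fixes x :: "'i \<Rightarrow> real"
  assumes "finite I"
  shows "\<forall>\<^sub>F u in at_right t. (\<Sum>i\<in>I. of_bool (x i > u)) = (\<Sum>i\<in>I. of_bool (x i > t) :: nat)"
proof -
  have "\<forall>\<^sub>F u in at_right t. \<forall>i\<in>I. x i > u \<longleftrightarrow> x i > t"
  proof (rule eventually_ball_finite[OF assms], safe)
    fix i
    show "\<forall>\<^sub>F u in at_right t. (x i > u) = (x i > t)"
    proof (cases "x i > t")
      case True
      show ?thesis using eventually_at_right_real[OF True] by eventually_elim (use True in auto)
    next
      case False
      then show ?thesis by (auto simp: eventually_at_filter)
    qed
  qed
  then show ?thesis by eventually_elim (auto intro: sum.cong)
qed

lemma of_bool_sum_eventually_0:
  fixes x :: "'i \<Rightarrow> real"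
  assumes "finite I"
  shows "\<forall>\<^sub>F u in at_top. (\<Sum>i\<in>I. of_bool (x i > u)) = (0 :: nat)"
proof -
  have "\<forall>\<^sub>F u in at_top. \<forall>i\<in>I. \<not> x i > u"
    by (rule eventually_ball_finite[OF assms]) (auto simp: not_less eventually_ge_at_top)
  then show ?thesis by eventually_elim auto
qed

text \<open>For an upward closed set that is closed under limits from the right the infimum is attained.\<close>

lemma Inf_le_iff_mem:
  fixes S :: "real set"
  assumes "S \<noteq> {}" "bdd_below S" and up: "\<And>t u. t \<in> S \<Longrightarrow> t \<le> u \<Longrightarrow> u \<in> S"
    and right: "(\<forall>\<^sub>F u in at_right t. u \<in> S) \<Longrightarrow> t \<in> S"
  shows "Inf S \<le> t \<longleftrightarrow> t \<in> S"
proof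
  assume le: "Inf S \<le> t"
  have "u \<in> S" if "t < u" for u
  proof -
    have "Inf S < u" using le that by simp
    then obtain s where "s \<in> S" "s < u" using cInf_lessD[OF assms(1)] by blast
    then show ?thesis using up by force
  qed
  then show "t \<in> S" by (intro right) (auto simp: eventually_at_filter)
next
  assume "t \<in> S"
  then show "Inf S \<le> t" using assms(2) by (rule cInf_lower)
qed

locale queue_path =
  fixes n q :: nat and a :: "real \<Rightarrow> nat" and r v :: "nat \<Rightarrow> real"
  assumes servers: "1 \<le> n" and a: "counting_path a" and v: "\<And>j. 1 \<le> j \<Longrightarrow> 0 \<le> v j"
begin

abbreviation start :: "nat \<Rightarrow> real" where
  "start \<equiv> service_start n q a r v"

abbreviation residual_busy :: "real \<Rightarrow> nat" where
  "residual_busy t \<equiv> (\<Sum>i = 1..min q n. of_bool (r i > t))"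

definition ahead :: "nat \<Rightarrow> real \<Rightarrow> nat" where
  "ahead j t = residual_busy t + (\<Sum>l\<in>{1..<j}. of_bool (start l + v l > t))"

text \<open>The condition for starting service persists once it holds, and the counts are right-continuous.\<close>

lemma start_le_iff: "start j \<le> t \<longleftrightarrow> present_from n q a j \<le> t \<and> ahead j t < n"
proof -
  let ?S = "{t. present_from n q a j \<le> t \<and> ahead j t < n}"
  have anti: "ahead j u \<le> ahead j t" if "t \<le> u" for t u
    unfolding ahead_def using that by (intro add_mono sum_mono) auto
  have "start j = Inf ?S"
    by (subst service_start.simps) (simp add: ahead_def)
  moreover have "Inf ?S \<le> t \<longleftrightarrow> t \<in> ?S"
  proof (rule Inf_le_iff_mem)
    have "\<forall>\<^sub>F u in at_top. residual_busy u = 0"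
      "\<forall>\<^sub>F u in at_top. (\<Sum>l\<in>{1..<j}. of_bool (start l + v l > u)) = (0 :: nat)"
      by (intro of_bool_sum_eventually_0; simp)+
    then have "\<forall>\<^sub>F u in at_top. u \<in> ?S"
      using eventually_ge_at_top[of "present_from n q a j"]
      by eventually_elim (use servers in \<open>auto simp: ahead_def\<close>)
    then show "?S \<noteq> {}" by (auto dest!: eventually_happens'[rotated])
    show "bdd_below ?S" by (rule bdd_belowI[of _ "present_from n q a j"]) simp
    show "u \<in> ?S" if "s \<in> ?S" "s \<le> u" for s u
      using that anti[of s u] by auto
    assume ev: "\<forall>\<^sub>F u in at_right t. u \<in> ?S"
    have "\<forall>\<^sub>F u in at_right t. residual_busy u = residual_busy t"
      "\<forall>\<^sub>F u in at_right t. (\<Sum>l\<in>{1..<j}. of_bool (start l + v l > u)) = (\<Sum>l\<in>{1..<j}. of_bool (start l + v l > t) :: nat)"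
      by (intro of_bool_sum_right_eventually; simp)+
    with ev have *: "\<forall>\<^sub>F u in at_right t. present_from n q a j \<le> u \<and> ahead j t < n"
      by eventually_elim (auto simp: ahead_def)
    then have "ahead j t < n"
      using eventually_happens'[OF trivial_limit_at_right_real *] by blast
    moreover have "present_from n q a j \<le> t"
      by (rule tendsto_lowerbound[OF tendsto_ident_at]) (use * in \<open>auto elim: eventually_mono simp: trivial_limit_at_right_real\<close>)
    ultimately show "t \<in> ?S" by simp
  qed
  ultimately show ?thesis by simp
qed

lemma a_mono: "0 \<le> s \<Longrightarrow> s \<le> t \<Longrightarrow> a s \<le> a t"
  using a by (auto simp: counting_path_def mono_on_def)

lemma arrival_time_le_iff:
  assumes u: "0 \<le> u" "i \<le> a u" and t: "0 \<le> t"
  shows "arrival_time a i \<le> t \<longleftrightarrow> i \<le> a t"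
proof -
  have "Inf {t. 0 \<le> t \<and> i \<le> a t} \<le> t \<longleftrightarrow> t \<in> {t. 0 \<le> t \<and> i \<le> a t}"
  proof (rule Inf_le_iff_mem)
    assume ev: "\<forall>\<^sub>F u in at_right t. u \<in> {t. 0 \<le> t \<and> i \<le> a t}"
    from ev counting_path_right[OF a t] have "\<forall>\<^sub>F u in at_right t. i \<le> a t"
      by eventually_elim auto
    then show "t \<in> {t. 0 \<le> t \<and> i \<le> a t}"
      using eventually_happens'[OF trivial_limit_at_right_real] t by blast
  next
    show "{t. 0 \<le> t \<and> i \<le> a t} \<noteq> {}" using u by blast
    show "bdd_below {t. 0 \<le> t \<and> i \<le> a t}" by (rule bdd_belowI[of _ 0]) simp
    show "w \<in> {t. 0 \<le> t \<and> i \<le> a t}" if "s \<in> {t. 0 \<le> t \<and> i \<le> a t}" "s \<le> w" for s w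
      using that a_mono[of s w] by auto
  qed
  then show ?thesis using t by (simp add: arrival_time_def)
qed

lemma arrival_time_nonneg:
  assumes "0 \<le> u" "i \<le> a u" shows "0 \<le> arrival_time a i"
  unfolding arrival_time_def by (rule cInf_greatest) (use assms in auto)

text \<open>Customers who wait initially count as having appeared at time 0; the subtraction is truncated.\<close>

definition appeared :: "real \<Rightarrow> nat" where
  "appeared t = (q - n) + a t"

lemma appeared_mono: "0 \<le> s \<Longrightarrow> s \<le> t \<Longrightarrow> appeared s \<le> appeared t"
  unfolding appeared_def using a_mono by simp

lemma present_from_le_iff:
  assumes u: "0 \<le> u" "j \<le> appeared u" and t: "0 \<le> t"
  shows "present_from n q a j \<le> t \<longleftrightarrow> j \<le> appeared t"
  using arrival_time_le_iff[of u "j - (q - n)" t] u t by (auto simp: present_from_def appeared_def)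

lemma present_from_nonneg: "0 \<le> u \<Longrightarrow> j \<le> appeared u \<Longrightarrow> 0 \<le> present_from n q a j"
  using arrival_time_nonneg[of u "j - (q - n)"] by (auto simp: present_from_def appeared_def)

lemma start_ge_present: "present_from n q a j \<le> start j"
  using start_le_iff[of j "start j"] by simp

lemma start_mono:
  assumes u: "0 \<le> u" "k \<le> appeared u" and jk: "j \<le> k"
  shows "start j \<le> start k"
proof -
  have k: "present_from n q a k \<le> start k" "ahead k (start k) < n"
    using start_le_iff[of k "start k"] by simp_all
  have nn: "0 \<le> present_from n q a k" by (rule present_from_nonneg[OF u])
  have "k \<le> appeared (present_from n q a k)"
    using present_from_le_iff[OF u nn] by simp
  then have "present_from n q a j \<le> present_from n q a k"
    using present_from_le_iff[OF u(1) _ nn, of j] u(2) jk by simp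
  moreover have "ahead j (start k) \<le> ahead k (start k)"
    unfolding ahead_def using jk by (intro add_left_mono sum_mono2) auto
  ultimately show ?thesis using k unfolding start_le_iff by linarith
qed

definition entered :: "real \<Rightarrow> nat" where
  "entered t = card {j \<in> {1..appeared t}. start j \<le> t}"

lemma queue_length_eq:
  "queue_length n q a r v t = residual_busy t + (\<Sum>j = 1..appeared t. of_bool (start j + v j > t))"
proof -
  have eq: "{1..appeared t} = {1..q - n} \<union> {1 + (q - n)..a t + (q - n)}"
    unfolding appeared_def by auto
  have "(\<Sum>j = 1..appeared t. of_bool (start j + v j > t)) =
      (\<Sum>j = 1..q - n. of_bool (start j + v j > t))
      + (\<Sum>j = 1 + (q - n)..a t + (q - n). of_bool (start j + v j > t) :: nat)"
    unfolding eq by (rule sum.union_disjoint) auto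
  also have "(\<Sum>j = 1 + (q - n)..a t + (q - n). of_bool (start j + v j > t) :: nat) =
      (\<Sum>i = 1..a t. of_bool (start ((q - n) + i) + v ((q - n) + i) > t))"
    by (subst sum.shift_bounds_cl_nat_ivl) (simp add: add.commute)
  finally show ?thesis
    by (simp add: queue_length_def initial_wait_def arrival_wait_def)
qed

text \<open>Since no server idles while customers wait, exactly the excess of the queue length over the
  number of servers is waiting.\<close>

lemma entered_add_waiting:
  assumes t: "0 \<le> t"
  shows "entered t + (queue_length n q a r v t - n) = appeared t"
proof -
  let ?J = "appeared t"
  have ahead_le: "ahead j t + of_bool (start j + v j > t) \<le> n" if "start j \<le> t" for j
    using that start_le_iff[of j t] by (auto simp: of_bool_def)
  have ahead_Suc: "ahead (Suc j) t = ahead j t + of_bool (start j + v j > t)" if "1 \<le> j" for j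
    using that by (simp add: ahead_def)
  have ahead_1: "ahead 1 t \<le> n"
  proof -
    have "residual_busy t \<le> (\<Sum>i = 1..min q n. 1)" by (intro sum_mono) auto
    then show ?thesis by (simp add: ahead_def)
  qed
  have Q: "queue_length n q a r v t = ahead (Suc ?J) t"
    unfolding queue_length_eq ahead_def by (simp add: atLeastLessThanSuc_atLeastAtMost)
  have ahead_served: "ahead (Suc j) t \<le> n" if "\<And>l. 1 \<le> l \<Longrightarrow> l \<le> j \<Longrightarrow> start l \<le> t" for j
  proof (cases j)
    case 0
    then show ?thesis using ahead_1 by simp
  next
    case (Suc i)
    then show ?thesis using ahead_le[OF that[of j]] ahead_Suc[of j] by simp
  qed
  show ?thesis
  proof (cases "\<forall>j\<in>{1..?J}. start j \<le> t")
    case True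
    then have "{j \<in> {1..?J}. start j \<le> t} = {1..?J}" by auto
    moreover have "queue_length n q a r v t \<le> n"
      unfolding Q using True by (intro ahead_served) auto
    ultimately show ?thesis by (simp add: entered_def)
  next
    case False
    define m where "m = (LEAST j. 1 \<le> j \<and> j \<le> ?J \<and> t < start j)"
    have "\<exists>j. 1 \<le> j \<and> j \<le> ?J \<and> t < start j" using False by (auto simp: not_le)
    then have m: "1 \<le> m \<and> m \<le> ?J \<and> t < start m" unfolding m_def by (rule LeastI_ex)
    have below: "start j \<le> t" if "1 \<le> j" "j < m" for j
      using not_less_Least[OF that(2)[unfolded m_def]] that m by auto
    have above: "t < start j" if "m \<le> j" "j \<le> ?J" for j
      using start_mono[OF t that(2,1)] m by linarith
    have set: "{j \<in> {1..?J}. start j \<le> t} = {1..<m}"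
    proof (intro set_eqI iffI)
      fix j assume j: "j \<in> {j \<in> {1..?J}. start j \<le> t}"
      then show "j \<in> {1..<m}" using above[of j] by (auto simp: not_less[symmetric])
    next
      fix j assume "j \<in> {1..<m}"
      then show "j \<in> {j \<in> {1..?J}. start j \<le> t}" using below[of j] m by auto
    qed
    have "ahead m t \<le> n"
      using ahead_served[of "m - 1"] below m by simp
    moreover have "n \<le> ahead m t"
      using start_le_iff[of m t] present_from_le_iff[OF t _ t, of m] m by auto
    moreover have "ahead (Suc ?J) t = ahead m t + (Suc ?J - m)"
    proof -
      have eq: "{1..<Suc ?J} = {1..<m} \<union> {m..<Suc ?J}" using m by auto
      have "(\<Sum>l\<in>{1..<Suc ?J}. of_bool (start l + v l > t)) =
          (\<Sum>l\<in>{1..<m}. of_bool (start l + v l > t)) + (\<Sum>l\<in>{m..<Suc ?J}. of_bool (start l + v l > t) :: nat)"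
        unfolding eq by (rule sum.union_disjoint) auto
      also have "(\<Sum>l\<in>{m..<Suc ?J}. of_bool (start l + v l > t) :: nat) = (\<Sum>l\<in>{m..<Suc ?J}. 1)"
      proof (rule sum.cong[OF refl])
        fix l assume "l \<in> {m..<Suc ?J}"
        then show "of_bool (start l + v l > t) = (1 :: nat)"
          using above[of l] v[of l] m by auto
      qed
      finally show ?thesis by (simp add: ahead_def)
    qed
    ultimately show ?thesis unfolding Q entered_def set using m by simp
  qed
qed

lemma card_started_by:
  assumes "u \<le> t" "0 \<le> t"
  shows "card {j \<in> {1..appeared t}. start j \<le> u} = (if u < 0 then 0 else entered u)"
proof (cases "u < 0")
  case True
  have "{j \<in> {1..appeared t}. start j \<le> u} = {}"
  proof (intro equals0I)
    fix j assume "j \<in> {j \<in> {1..appeared t}. start j \<le> u}"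
    then show False using start_ge_present[of j] present_from_nonneg[OF assms(2), of j] True by simp
  qed
  then show ?thesis using True by simp
next
  case False
  have "{j \<in> {1..appeared t}. start j \<le> u} = {j \<in> {1..appeared u}. start j \<le> u}"
  proof (intro set_eqI iffI)
    fix j assume j: "j \<in> {j \<in> {1..appeared t}. start j \<le> u}"
    then have "present_from n q a j \<le> u" using start_ge_present[of j] by auto
    then show "j \<in> {j \<in> {1..appeared u}. start j \<le> u}"
      using j present_from_le_iff[OF assms(2), of j u] False by auto
  next
    fix j assume "j \<in> {j \<in> {1..appeared u}. start j \<le> u}"
    then show "j \<in> {j \<in> {1..appeared t}. start j \<le> u}"
      using appeared_mono[of u t] False assms by auto
  qed
  then show ?thesis using False by (simp add: entered_def)
qed

end

section \<open>The queue nearly solves the fluid equation\<close>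

lemma scaled_excess:
  assumes "1 \<le> n"
  shows "real (x - n) / real n = max (real x / real n - 1) 0"
proof (cases "n \<le> x")
  case True
  then have "1 \<le> real x / real n" using assms by simp
  then show ?thesis using True assms by (simp add: of_nat_diff diff_divide_distrib)
next
  case False
  then have "real x / real n \<le> 1" using assms by simp
  then show ?thesis using False by simp
qed

context queue_path
begin

abbreviation scaled_arrivals :: cadlag where
  "scaled_arrivals \<equiv> cadlag_of (\<lambda>t. real (a t) / real n)"

abbreviation scaled_queue :: cadlag where
  "scaled_queue \<equiv> cadlag_of (\<lambda>t. real (queue_length n q a r v t) / real n)"

lemmas path_scaled = path_scaled_arrivals[OF a] path_scaled_queue_length[OF a]

lemma scaled_entered:
  assumes "0 \<le> u"
  shows "real (entered u) / real n
    = max (real q / real n - 1) 0 + path_of scaled_arrivals u - path_of (excess scaled_queue) u"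
proof -
  have "real (entered u) + real (queue_length n q a r v u - n) = real (q - n) + real (a u)"
    using entered_add_waiting[OF assms] unfolding appeared_def by (metis of_nat_add)
  then have "real (entered u) / real n + real (queue_length n q a r v u - n) / real n
      = real (q - n) / real n + real (a u) / real n"
    by (simp flip: add_divide_distrib)
  then show ?thesis
    using assms unfolding scaled_excess[OF servers] by (simp add: path_excess path_scaled)
qed

text \<open>Averaging over the law of a service time the number of service starts that lie at least one
  service time back: the customers are counted once one by one, once through the queue length.\<close>

lemma sum_cdf_starts:
  assumes "service_law \<nu>" and t: "0 \<le> t"
  shows "(\<Sum>j = 1..appeared t. cdf \<nu> (t - start j)) / real n
    = max (real q / real n - 1) 0 * cdf \<nu> t + convolution \<nu> (path_of scaled_arrivals) t
      - convolution \<nu> (path_of (excess scaled_queue)) t"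
proof -
  interpret service_law \<nu> by fact
  let ?J = "{1..appeared t}" and ?x = "max (real q / real n - 1) 0"
  have ind: "integrable \<nu> (indicator {..u} :: real \<Rightarrow> real)" for u
    by (simp add: emeasure_eq_measure)
  have "(\<Sum>j\<in>?J. cdf \<nu> (t - start j)) / real n = (\<Sum>j\<in>?J. LINT s|\<nu>. indicator {..t - start j} s) / real n"
    by (simp add: cdf_def)
  also have "\<dots> = (LINT s|\<nu>. (\<Sum>j\<in>?J. indicator {..t - start j} s) / real n)"
    using ind by (simp add: Bochner_Integration.integral_sum)
  also have "\<dots> = (LINT s|\<nu>. ?x * indicator {..t} s + path_of scaled_arrivals (t - s)
      - path_of (excess scaled_queue) (t - s))"
  proof (rule integral_cong_AE)
    show "AE s in \<nu>. (\<Sum>j\<in>?J. indicator {..t - start j} s) / real n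
      = ?x * indicator {..t} s + path_of scaled_arrivals (t - s) - path_of (excess scaled_queue) (t - s)"
      using nonneg
    proof eventually_elim
      case (elim s)
      have "(\<Sum>j\<in>?J. indicator {..t - start j} s :: real) = (\<Sum>j\<in>?J. of_bool (start j \<le> t - s))"
        by (intro sum.cong) (auto simp: indicator_def)
      also have "\<dots> = real (card {j \<in> ?J. start j \<le> t - s})"
      proof -
        have "?J \<inter> {j. start j \<le> t - s} = {j \<in> ?J. start j \<le> t - s}" by blast
        then show ?thesis by (simp only: sum_of_bool_eq finite_atLeastAtMost)
      qed
      also have "\<dots> = (if t - s < 0 then 0 else real (entered (t - s)))"
        using card_started_by[of "t - s" t] elim t by simp
      finally show ?case
        using scaled_entered[of "t - s"] by (simp add: path_neg)
    qed
  qed measurable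
  also have "\<dots> = ?x * cdf \<nu> t + convolution \<nu> (path_of scaled_arrivals) t - convolution \<nu> (path_of (excess scaled_queue)) t"
    using ind conv_path_integrable by (simp add: convolution_def cdf_def)
  finally show ?thesis .
qed

text \<open>Split the queue length into those initially in service and those who appeared, write each indicator of
  presence as 1 minus an indicator of departure, and replace the latter by the
  value of the distribution function at the time elapsed since the start of service; what results is
  the right-hand side of the fluid equation.\<close>

lemma queue_fluid_error:
  assumes "service_law \<nu>" and t: "0 \<le> t"
  shows "\<bar>path_of scaled_queue t - (service_law.fluid_input \<nu> F\<^sub>0 (real q / real n) scaled_arrivals t
       + convolution \<nu> (path_of (excess scaled_queue)) t)\<bar>
    \<le> (\<bar>\<Sum>i = 1..min q n. of_bool (r i \<le> t) - F\<^sub>0 t\<bar>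
       + \<bar>\<Sum>j = 1..appeared t. of_bool (start j + v j \<le> t) - cdf \<nu> (t - start j)\<bar>) / real n"
    (is "_ \<le> (\<bar>?S\<bar> + \<bar>?Z\<bar>) / _")
proof -
  interpret service_law \<nu> by fact
  have flip: "of_bool (x > t) = 1 - (of_bool (x \<le> t) :: real)" for x
    by (cases "x \<le> t") auto
  have min: "min (real q / real n) 1 = real (min q n) / real n"
    using servers by (simp add: min_def)
  have J: "real (appeared t) / real n = max (real q / real n - 1) 0 + path_of scaled_arrivals t"
    using t by (simp add: appeared_def add_divide_distrib scaled_excess[OF servers] path_scaled)
  have "real (queue_length n q a r v t) = (\<Sum>i = 1..min q n. 1 - of_bool (r i \<le> t))
      + (\<Sum>j = 1..appeared t. 1 - of_bool (start j + v j \<le> t))"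
    unfolding queue_length_eq of_nat_add of_nat_sum of_nat_of_bool flip ..
  also have "\<dots> = (real (min q n) * (1 - F\<^sub>0 t) - ?S)
      + (real (appeared t) - (\<Sum>j = 1..appeared t. cdf \<nu> (t - start j)) - ?Z)"
    unfolding sum_subtractf by (simp add: algebra_simps)
  finally have "path_of scaled_queue t = real (min q n) / real n * (1 - F\<^sub>0 t) - ?S / real n
      + (real (appeared t) / real n - (\<Sum>j = 1..appeared t. cdf \<nu> (t - start j)) / real n - ?Z / real n)"
    using t by (simp add: path_scaled add_divide_distrib diff_divide_distrib)
  then have eq: "path_of scaled_queue t - (fluid_input F\<^sub>0 (real q / real n) scaled_arrivals t
       + convolution \<nu> (path_of (excess scaled_queue)) t) = - ((?S + ?Z) / real n)"
    unfolding sum_cdf_starts[OF assms] J fluid_input_def min by (simp add: algebra_simps add_divide_distrib)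
  have "\<bar>?S + ?Z\<bar> / real n \<le> (\<bar>?S\<bar> + \<bar>?Z\<bar>) / real n"
    by (intro divide_right_mono abs_triangle_ineq) simp
  then show ?thesis unfolding eq by simp
qed

lemma queue_near_fluid_map:
  assumes \<nu>: "service_law \<nu>" and F\<^sub>0: "is_cadlag F\<^sub>0" "\<And>t. 0 \<le> F\<^sub>0 t" "\<And>t. F\<^sub>0 t \<le> 1"
    and r: "samples_close F\<^sub>0 r (min q n) (d * real n)"
    and v: "\<And>t. 0 \<le> t \<Longrightarrow> t \<le> T \<Longrightarrow> samples_close (cdf \<nu>) v (appeared t) (d * real n)"
    and T: "0 \<le> T" and "t \<le> T"
  shows "\<bar>path_of scaled_queue t
      - path_of (service_law.fluid_map \<nu> F\<^sub>0 (real q / real n) scaled_arrivals) t\<bar>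
    \<le> exp T / (1 - service_law.discount \<nu>) * (2 * d)"
proof (rule service_law.fluid_map_stability[OF \<nu> F\<^sub>0 _ \<open>t \<le> T\<close> T])
  fix t assume t: "0 \<le> t" "t \<le> T"
  let ?S = "\<Sum>i = 1..min q n. of_bool (r i \<le> t) - F\<^sub>0 t"
  let ?Z = "\<Sum>j = 1..appeared t. of_bool (start j + v j \<le> t) - cdf \<nu> (t - start j)"
  have "\<bar>?S\<bar> \<le> d * real n" using samples_closeD[OF r, of "\<lambda>_. 0" t] by simp
  moreover have "\<bar>?Z\<bar> \<le> d * real n"
    by (rule samples_closeD[OF v[OF t]]) (rule start_mono[OF t(1)])
  ultimately have "(\<bar>?S\<bar> + \<bar>?Z\<bar>) / real n \<le> (2 * d * real n) / real n"
    by (intro divide_right_mono) auto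
  then have "(\<bar>?S\<bar> + \<bar>?Z\<bar>) / real n \<le> 2 * d" using servers by simp
  then show "\<bar>path_of scaled_queue t - (service_law.fluid_input \<nu> F\<^sub>0 (real q / real n) scaled_arrivals t
      + convolution \<nu> (path_of (excess scaled_queue)) t)\<bar> \<le> 2 * d"
    using queue_fluid_error[OF \<nu> t(1), of F\<^sub>0] by linarith
qed

end

section \<open>Measurability of the queue length\<close>

lemma measurable_add_nat:
  fixes f g :: "'a \<Rightarrow> nat"
  assumes "f \<in> measurable M (count_space UNIV)" "g \<in> measurable M (count_space UNIV)"
  shows "(\<lambda>x. f x + g x) \<in> measurable M (count_space UNIV)"
  using assms by measurable

locale random_queue =
  fixes M :: "'w measure" and n :: nat and Q :: "'w \<Rightarrow> nat" and A :: "'w \<Rightarrow> real \<Rightarrow> nat"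
    and r v :: "nat \<Rightarrow> 'w \<Rightarrow> real"
  assumes n: "1 \<le> n" and counting: "\<And>\<omega>. \<omega> \<in> space M \<Longrightarrow> counting_path (A \<omega>)"
    and v_nonneg: "\<And>i \<omega>. 1 \<le> i \<Longrightarrow> \<omega> \<in> space M \<Longrightarrow> 0 \<le> v i \<omega>"
    and Q [measurable]: "Q \<in> measurable M (count_space UNIV)"
    and A: "\<And>t. 0 \<le> t \<Longrightarrow> (\<lambda>\<omega>. A \<omega> t) \<in> measurable M (count_space UNIV)"
    and r: "\<And>i. 1 \<le> i \<Longrightarrow> r i \<in> borel_measurable M"
    and v: "\<And>i. 1 \<le> i \<Longrightarrow> v i \<in> borel_measurable M"
begin

abbreviation start :: "nat \<Rightarrow> nat \<Rightarrow> 'w \<Rightarrow> real" where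
  "start q j \<omega> \<equiv> service_start n q (A \<omega>) (\<lambda>i. r i \<omega>) (\<lambda>i. v i \<omega>) j"

abbreviation queue_at :: "real \<Rightarrow> 'w \<Rightarrow> nat" where
  "queue_at t \<omega> \<equiv> queue_length n (Q \<omega>) (A \<omega>) (\<lambda>i. r i \<omega>) (\<lambda>i. v i \<omega>) t"

lemma queue_path: "\<omega> \<in> space M \<Longrightarrow> queue_path n (A \<omega>) (\<lambda>i. v i \<omega>)"
  by unfold_locales (use n counting v_nonneg in auto)

text \<open>A customer who never arrives has the conventional arrival time \<open>Inf {}\<close>, a constant.\<close>

lemma arrival_time_measurable: "(\<lambda>\<omega>. arrival_time (A \<omega>) i) \<in> borel_measurable M"
proof (rule borel_measurable_iff_le[THEN iffD2], safe)
  fix t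
  have [measurable]: "(\<lambda>\<omega>. A \<omega> (real k)) \<in> measurable M (count_space UNIV)" for k by (rule A) simp
  have [measurable]: "(\<lambda>\<omega>. A \<omega> (max t 0)) \<in> measurable M (count_space UNIV)" by (rule A) simp
  have "arrival_time (A \<omega>) i \<le> t \<longleftrightarrow>
      (if \<exists>k. i \<le> A \<omega> (real k) then 0 \<le> t \<and> i \<le> A \<omega> (max t 0) else Inf {} \<le> t)" if w: "\<omega> \<in> space M" for \<omega>
  proof -
    interpret path: queue_path n 0 "A \<omega>" "\<lambda>_. 0" "\<lambda>i. v i \<omega>" by (rule queue_path[OF w])
    show ?thesis
    proof (cases "\<exists>k. i \<le> A \<omega> (real k)")
      case True
      then obtain k where k: "i \<le> A \<omega> (real k)" by blast
      show ?thesis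
        using True path.arrival_time_nonneg[OF _ k] path.arrival_time_le_iff[OF _ k, of t] by (cases "0 \<le> t") auto
    next
      case False
      have "\<not> i \<le> A \<omega> s" if "0 \<le> s" for s
      proof -
        obtain k where "s \<le> real k" using real_arch_simple by blast
        then show ?thesis using path.a_mono[OF that, of "real k"] False by (meson order_trans)
      qed
      then have empty: "{t. 0 \<le> t \<and> i \<le> A \<omega> t} = {}" by auto
      show ?thesis unfolding arrival_time_def empty using False by simp
    qed
  qed
  then have "{\<omega> \<in> space M. arrival_time (A \<omega>) i \<le> t} =
      {\<omega> \<in> space M. (if \<exists>k. i \<le> A \<omega> (real k) then 0 \<le> t \<and> i \<le> A \<omega> (max t 0) else Inf {} \<le> t)}"
    by (intro Collect_cong conj_cong refl)
  also have "\<dots> \<in> sets M" by measurable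
  finally show "{\<omega> \<in> space M. arrival_time (A \<omega>) i \<le> t} \<in> sets M" .
qed

lemma service_start_measurable:
  "(\<lambda>\<omega>. start q j \<omega>) \<in> borel_measurable M"
proof (induction j rule: less_induct)
  case (less j)
  have [measurable]: "(\<lambda>\<omega>. present_from n q (A \<omega>) j) \<in> borel_measurable M"
    unfolding present_from_def using arrival_time_measurable by simp
  show ?case
  proof (rule borel_measurable_iff_le[THEN iffD2], safe)
    fix t
    let ?ahead = "\<lambda>\<omega>. (\<Sum>i = 1..min q n. of_bool (r i \<omega> > t))
      + (\<Sum>l\<in>{1..<j}. of_bool (start q l \<omega> + v l \<omega> > t)) :: nat"
    have [measurable]: "?ahead \<in> measurable M (count_space UNIV)"
    proof (intro measurable_add_nat measurable_sum_nat)
      show "(\<lambda>\<omega>. of_bool (r i \<omega> > t) :: nat) \<in> measurable M (count_space UNIV)" if "i \<in> {1..min q n}" for i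
      proof -
        have [measurable]: "r i \<in> borel_measurable M" using that by (intro r) simp
        show ?thesis by measurable
      qed
      show "(\<lambda>\<omega>. of_bool (start q l \<omega> + v l \<omega> > t) :: nat)
          \<in> measurable M (count_space UNIV)" if "l \<in> {1..<j}" for l
      proof -
        have [measurable]: "v l \<in> borel_measurable M"
          "(\<lambda>\<omega>. start q l \<omega>) \<in> borel_measurable M"
          using that by (auto intro!: v less)
        show ?thesis by measurable
      qed
    qed
    have "{\<omega> \<in> space M. start q j \<omega> \<le> t} =
        {\<omega> \<in> space M. present_from n q (A \<omega>) j \<le> t \<and> ?ahead \<omega> < n}"
    proof (rule Collect_cong, rule conj_cong[OF refl])
      fix \<omega> assume w: "\<omega> \<in> space M"
      interpret path: queue_path n q "A \<omega>" "\<lambda>i. r i \<omega>" "\<lambda>i. v i \<omega>" by (rule queue_path[OF w])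
      show "(start q j \<omega> \<le> t) =
        (present_from n q (A \<omega>) j \<le> t \<and> ?ahead \<omega> < n)"
        using path.start_le_iff[of j t] by (simp add: path.ahead_def)
    qed
    also have "\<dots> \<in> sets M" by measurable
    finally show "{\<omega> \<in> space M. start q j \<omega> \<le> t} \<in> sets M" .
  qed
qed

lemma queue_length_measurable:
  assumes t: "0 \<le> t"
  shows "(\<lambda>\<omega>. queue_at t \<omega>) \<in> measurable M (count_space UNIV)"
proof -
  let ?f = "\<lambda>q k \<omega>. (\<Sum>i = 1..min q n. of_bool (r i \<omega> > t))
      + (\<Sum>l = 1..(q - n) + k. of_bool (start q l \<omega> + v l \<omega> > t)) :: nat"
  have f: "?f q k \<in> measurable M (count_space UNIV)" for q k
  proof (intro measurable_add_nat measurable_sum_nat)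
    show "(\<lambda>\<omega>. of_bool (r i \<omega> > t) :: nat) \<in> measurable M (count_space UNIV)" if "i \<in> {1..min q n}" for i
    proof -
      have [measurable]: "r i \<in> borel_measurable M" using that by (intro r) simp
      show ?thesis by measurable
    qed
    show "(\<lambda>\<omega>. of_bool (start q l \<omega> + v l \<omega> > t) :: nat)
        \<in> measurable M (count_space UNIV)" if "l \<in> {1..(q - n) + k}" for l
    proof -
      have [measurable]: "v l \<in> borel_measurable M" using that by (intro v) simp
      note [measurable] = service_start_measurable
      show ?thesis by measurable
    qed
  qed
  have meas: "(\<lambda>\<omega>. ?f (Q \<omega>) (A \<omega> t) \<omega>) \<in> measurable M (count_space UNIV)"
    by (rule measurable_compose_countable[OF measurable_compose_countable[OF f A[OF t]] Q])
  have eq: "queue_at t \<omega> = ?f (Q \<omega>) (A \<omega> t) \<omega>"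
    if w: "\<omega> \<in> space M" for \<omega>
  proof -
    interpret path: queue_path n "Q \<omega>" "A \<omega>" "\<lambda>i. r i \<omega>" "\<lambda>i. v i \<omega>" by (rule queue_path[OF w])
    show ?thesis unfolding path.queue_length_eq path.appeared_def ..
  qed
  show ?thesis by (subst measurable_cong, rule eq, assumption, rule meas)
qed

lemma scaled_queue_measurable:
  "(\<lambda>\<omega>. cadlag_of (\<lambda>t. real (queue_at t \<omega>) / real n))
     \<in> borel_measurable M"
proof (rule borel_measurable_cadlagI)
  fix t :: real assume t: "0 \<le> t"
  note [measurable] = queue_length_measurable[OF t]
  have meas: "(\<lambda>\<omega>. real (queue_at t \<omega>) / real n) \<in> borel_measurable M"
    by measurable
  have eq: "path_of (cadlag_of (\<lambda>t. real (queue_at t \<omega>) / real n)) t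
      = real (queue_at t \<omega>) / real n" if "\<omega> \<in> space M" for \<omega>
    using t by (simp add: path_scaled_queue_length[OF counting[OF that]])
  show "(\<lambda>\<omega>. path_of (cadlag_of (\<lambda>t. real (queue_at t \<omega>) / real n)) t)
      \<in> borel_measurable M"
    by (subst measurable_cong, rule eq, assumption, rule meas)
qed

end

section \<open>The fluid limit\<close>

text \<open>In general evaluation at a positive time is discontinuous in \<open>J\<^sub>1\<close> at paths that jump there.\<close>

lemma isCont_eval:
  assumes "continuous_on {0..} (path_of a)"
  shows "isCont (\<lambda>x. path_of x t) a"
  unfolding continuous_at_eps_delta
proof (intro allI impI)
  fix e :: real assume "0 < e"
  then have "0 < e / 2" by simp
  from uniformly_close_near_continuous[OF assms this, of t]
  obtain d where d: "0 < d" "\<And>y u. dist y a < d \<Longrightarrow> u \<le> t \<Longrightarrow> \<bar>path_of y u - path_of a u\<bar> \<le> e / 2"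
    by blast
  show "\<exists>d>0. \<forall>y. dist y a < d \<longrightarrow> dist (path_of y t) (path_of a t) < e"
  proof (intro exI[of _ d] conjI allI impI d(1))
    fix y assume "dist y a < d"
    from d(2)[OF this order_refl] show "dist (path_of y t) (path_of a t) < e"
      using \<open>0 < e\<close> by (simp add: dist_real_def)
  qed
qed

lemma isCont_eval_snd:
  assumes "continuous_on {0..} (path_of (snd z))"
  shows "isCont (\<lambda>z :: 'a::metric_space \<times> cadlag. path_of (snd z) t) z"
  by (rule isCont_o2[where f = snd and g = "\<lambda>x. path_of x t"]) (intro continuous_intros isCont_eval assms)+

lemma borel_measurable_eval_snd:
  assumes "X \<in> borel_measurable M"
  shows "(\<lambda>\<omega>. path_of (snd (X \<omega>) :: cadlag) t) \<in> borel_measurable M"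
proof -
  have "(\<lambda>\<omega>. snd (X \<omega>)) \<in> borel_measurable M"
    by (intro measurable_compose[OF assms] borel_measurable_continuous_onI continuous_on_snd continuous_on_id)
  then show ?thesis by (rule measurable_compose[OF _ borel_measurable_eval])
qed

lemma borel_measurable_fst:
  fixes X :: "'a \<Rightarrow> 'b::topological_space \<times> 'c::topological_space"
  assumes "X \<in> borel_measurable M"
  shows "(\<lambda>\<omega>. fst (X \<omega>)) \<in> borel_measurable M"
  by (intro measurable_compose[OF assms] borel_measurable_continuous_onI continuous_on_fst continuous_on_id)

lemma path_mono_if_rational:
  assumes rat: "\<And>s t. s \<in> \<rat> \<Longrightarrow> t \<in> \<rat> \<Longrightarrow> s \<le> t \<Longrightarrow> path_of a s \<le> path_of a t" and "s \<le> t"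
  shows "path_of a s \<le> path_of a t"
proof (rule ccontr)
  assume neg: "\<not> path_of a s \<le> path_of a t"
  then have "s < t" using \<open>s \<le> t\<close> by (cases "s = t") auto
  define c where "c = (path_of a s + path_of a t) / 2"
  have c: "path_of a t < c" "c < path_of a s" using neg by (auto simp: c_def)
  from order_tendstoD(1)[OF path_tendsto_right c(2)]
  obtain s' where s': "s < s'" "\<And>u. s < u \<Longrightarrow> u < s' \<Longrightarrow> c < path_of a u"
    unfolding eventually_at_right[OF less_add_one[of s]] by blast
  from order_tendstoD(2)[OF path_tendsto_right c(1)]
  obtain t' where t': "t < t'" "\<And>u. t < u \<Longrightarrow> u < t' \<Longrightarrow> path_of a u < c"
    unfolding eventually_at_right[OF less_add_one[of t]] by blast
  obtain p where p: "p \<in> \<rat>" "s < p" "p < min s' t" using Rats_dense_in_real[of s "min s' t"] s' \<open>s < t\<close> by auto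
  obtain q where q: "q \<in> \<rat>" "t < q" "q < t'" using Rats_dense_in_real[OF t'(1)] by auto
  have "c < path_of a p" using s'(2)[of p] p by simp
  moreover have "path_of a p \<le> path_of a q" using p q by (intro rat) auto
  ultimately show False using t'(2)[of q] q by simp
qed

context prob_space
begin

text \<open>Monotonicity at two given times is preserved by the limit, being a closed condition on the values
  at these times, which depend continuously on the path near a continuous path.\<close>

lemma limit_path_mono:
  fixes X :: "nat \<Rightarrow> 'a \<Rightarrow> 'b::metric_space \<times> cadlag"
  assumes cd: "converges_in_distribution M X X'"
    and mono: "\<And>n \<omega> s t. \<omega> \<in> space M \<Longrightarrow> s \<le> t \<Longrightarrow> path_of (snd (X n \<omega>)) s \<le> path_of (snd (X n \<omega>)) t"
    and cont: "AE \<omega> in M. continuous_on {0..} (path_of (snd (X' \<omega>)))"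
  shows "AE \<omega> in M. \<forall>s t. s \<le> t \<longrightarrow> path_of (snd (X' \<omega>)) s \<le> path_of (snd (X' \<omega>)) t"
proof -
  have X': "X' \<in> borel_measurable M" using cd by (simp add: converges_in_distribution_def)
  have pair: "AE \<omega> in M. path_of (snd (X' \<omega>)) s \<le> path_of (snd (X' \<omega>)) t" if st: "s \<le> t" for s t
  proof -
    let ?g = "\<lambda>z :: 'b \<times> cadlag. max 0 (min 1 (path_of (snd z) s - path_of (snd z) t))"
    have g: "(\<lambda>\<omega>. ?g (X' \<omega>)) \<in> borel_measurable M"
      by (intro borel_measurable_max borel_measurable_min borel_measurable_diff borel_measurable_const
          borel_measurable_eval_snd X')
    have lt: "expectation (\<lambda>\<omega>. ?g (X' \<omega>)) - e < 0" if "0 < e" for e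
    proof -
      have "\<forall>\<^sub>F n :: nat in sequentially. expectation (\<lambda>\<omega>. ?g (X' \<omega>)) - e < expectation (\<lambda>_. 0)"
      proof (rule converges_in_distribution_lower_bound[OF cd, where g = ?g and B = 1])
        show "AE \<omega> in M. isCont ?g (X' \<omega>)"
          using cont by eventually_elim (intro continuous_intros isCont_eval_snd)
        show "mostly d (\<lambda>n \<omega>. ?g (X n \<omega>) - d \<le> 0)" if "0 < d" for d
        proof (rule mostly_always)
          show "?g (X n \<omega>) - d \<le> 0" if "\<omega> \<in> space M" for n \<omega>
            using mono[OF _ st, of \<omega> n] that \<open>0 < d\<close> by auto
        qed (use that in simp)
      qed (use g that in auto)
      then show ?thesis by simp
    qed
    have int: "integrable M (\<lambda>\<omega>. ?g (X' \<omega>))" using g by (rule integrable_bounded[of _ 1]) auto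
    have "expectation (\<lambda>\<omega>. ?g (X' \<omega>)) \<le> 0"
    proof (rule field_le_epsilon)
      show "expectation (\<lambda>\<omega>. ?g (X' \<omega>)) \<le> 0 + e" if "0 < e" for e using lt[OF that] by linarith
    qed
    moreover have "0 \<le> expectation (\<lambda>\<omega>. ?g (X' \<omega>))" by (intro Bochner_Integration.integral_nonneg) simp
    ultimately have "expectation (\<lambda>\<omega>. ?g (X' \<omega>)) = 0" by simp
    then have "AE \<omega> in M. ?g (X' \<omega>) = 0"
      using integral_nonneg_eq_0_iff_AE[OF int] by simp
    then show ?thesis
    proof eventually_elim
      case (elim \<omega>)
      have "x \<le> y" if "max 0 (min 1 (x - y)) = 0" for x y :: real using that by (simp add: max_def min_def split: if_splits)
      from this[OF elim] show ?case .
    qed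
  qed
  have "AE \<omega> in M. s \<le> t \<longrightarrow> path_of (snd (X' \<omega>)) s \<le> path_of (snd (X' \<omega>)) t" for s t
  proof (cases "s \<le> t")
    case True
    from pair[OF True] show ?thesis by eventually_elim simp
  qed simp
  then have "AE \<omega> in M. \<forall>s\<in>\<rat>. \<forall>t\<in>\<rat>. s \<le> t \<longrightarrow> path_of (snd (X' \<omega>)) s \<le> path_of (snd (X' \<omega>)) t"
    by (subst AE_ball_countable[OF countable_rat], subst AE_ball_countable[OF countable_rat]) simp
  then show ?thesis
  proof eventually_elim
    case (elim \<omega>)
    show ?case
    proof (intro allI impI)
      fix s t :: real assume st: "s \<le> t"
      show "path_of (snd (X' \<omega>)) s \<le> path_of (snd (X' \<omega>)) t"
        by (rule path_mono_if_rational[OF _ st]) (use elim in blast)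
    qed
  qed
qed

text \<open>The function \<open>max 0 (1 - m / C)\<close> of the size \<open>m\<close> of the pair is continuous at continuous paths, lies below
  the indicator of \<open>m < C\<close>, and its expectation at the limit tends to 1 as \<open>C\<close> grows.\<close>

lemma tight_at_time:
  fixes X :: "nat \<Rightarrow> 'a \<Rightarrow> real \<times> cadlag"
  assumes cd: "converges_in_distribution M X X'"
    and cont: "AE \<omega> in M. continuous_on {0..} (path_of (snd (X' \<omega>)))"
    and e: "0 < e"
  obtains C :: nat where "mostly e (\<lambda>n \<omega>. \<bar>fst (X n \<omega>)\<bar> + \<bar>path_of (snd (X n \<omega>)) t\<bar> < real C)"
proof -
  define m where "m z = \<bar>fst z\<bar> + \<bar>path_of (snd z) t\<bar>" for z :: "real \<times> cadlag"
  have X: "\<And>n. X n \<in> borel_measurable M" "X' \<in> borel_measurable M"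
    using cd by (auto simp: converges_in_distribution_def)
  have m_meas: "(\<lambda>\<omega>. m (Y \<omega>)) \<in> borel_measurable M" if "Y \<in> borel_measurable M" for Y
    unfolding m_def using that
    by (intro borel_measurable_add borel_measurable_abs borel_measurable_fst borel_measurable_eval_snd)
  have m0: "0 \<le> m z" for z by (simp add: m_def)
  let ?g = "\<lambda>C z. max 0 (1 - m z / real (Suc C))"
  have g: "0 \<le> ?g C z" "?g C z \<le> 1" for C z using m0 by auto
  have gX: "(\<lambda>\<omega>. ?g C (X' \<omega>)) \<in> borel_measurable M" for C
    using m_meas[OF X(2)] by measurable
  have "(\<lambda>C. expectation (\<lambda>\<omega>. ?g C (X' \<omega>))) \<longlonglongrightarrow> expectation (\<lambda>\<omega>. 1)"
  proof (rule integral_dominated_convergence)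
    show "AE \<omega> in M. (\<lambda>C. ?g C (X' \<omega>)) \<longlonglongrightarrow> 1"
    proof (intro AE_I2)
      fix \<omega>
      have "(\<lambda>C. m (X' \<omega>) * inverse (real (Suc C))) \<longlonglongrightarrow> m (X' \<omega>) * 0"
        by (intro tendsto_mult_left LIMSEQ_inverse_real_of_nat)
      then have "(\<lambda>C. max 0 (1 - m (X' \<omega>) * inverse (real (Suc C)))) \<longlonglongrightarrow> max 0 (1 - m (X' \<omega>) * 0)"
        by (intro tendsto_max tendsto_diff tendsto_const)
      then show "(\<lambda>C. ?g C (X' \<omega>)) \<longlonglongrightarrow> 1" by (simp add: divide_inverse)
    qed
    show "AE \<omega> in M. norm (?g C (X' \<omega>)) \<le> 1" for C using g[of _ C] by simp
    show "integrable M (\<lambda>_. 1 :: real)" by simp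
  qed (use gX in auto)
  then have "(\<lambda>C. expectation (\<lambda>\<omega>. ?g C (X' \<omega>))) \<longlonglongrightarrow> 1" by (simp add: prob_space)
  then have "\<forall>\<^sub>F C in sequentially. 1 - e / 2 < expectation (\<lambda>\<omega>. ?g C (X' \<omega>))"
    using e by (intro order_tendstoD(1)) auto
  from eventually_happens'[OF sequentially_bot this]
  obtain C where C: "1 - e / 2 < expectation (\<lambda>\<omega>. ?g C (X' \<omega>))" by blast
  let ?A = "\<lambda>n. {\<omega>\<in>space M. m (X n \<omega>) < real (Suc C)}"
  have A: "?A n \<in> events" for n using m_meas[OF X(1), of n] by measurable
  have "\<forall>\<^sub>F n in sequentially. expectation (\<lambda>\<omega>. ?g C (X' \<omega>)) - e / 2 < expectation (indicator (?A n))"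
  proof (rule converges_in_distribution_lower_bound[OF cd, where g = "?g C" and B = 1])
    show "AE \<omega> in M. isCont (?g C) (X' \<omega>)"
      using cont unfolding m_def
      by eventually_elim (intro continuous_intros isCont_eval_snd, auto)
    show "mostly d (\<lambda>n \<omega>. ?g C (X n \<omega>) - d \<le> indicator (?A n) \<omega>)" if "0 < d" for d
    proof (rule mostly_always)
      fix n \<omega> assume w: "\<omega> \<in> space M"
      show "?g C (X n \<omega>) - d \<le> indicator (?A n) \<omega>"
      proof (cases "m (X n \<omega>) < real (Suc C)")
        case True
        then have "indicator (?A n) \<omega> = (1 :: real)" using w by simp
        then show ?thesis using g(2)[of "X n \<omega>" C] that by linarith
      next
        case False
        then have "1 \<le> m (X n \<omega>) / real (Suc C)" by (simp add: le_divide_eq del: of_nat_Suc)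
        then have "?g C (X n \<omega>) = 0" by simp
        then show ?thesis using that by (simp add: indicator_def)
      qed
    qed (use that in auto)
    show "(\<lambda>\<omega>. indicator (?A n) \<omega> :: real) \<in> borel_measurable M" for n using A[of n] by measurable
    show "\<bar>?g C z\<bar> \<le> 1" for z using g[of z C] by simp
    show "\<bar>indicator (?A n) \<omega> :: real\<bar> \<le> 1" for n \<omega> by (simp add: indicator_def)
    show "(\<lambda>\<omega>. ?g C (X' \<omega>)) \<in> borel_measurable M" by (rule gX)
    show "AE \<omega> in M. ?g C (X' \<omega>) = ?g C (X' \<omega>)" by simp
    show "0 < e / 2" using e by simp
  qed
  then have "\<forall>\<^sub>F n in sequentially. prob (space M - ?A n) \<le> e"
  proof eventually_elim
    case (elim n)
    have "prob (space M - ?A n) = 1 - prob (?A n)" by (rule prob_compl[OF A])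
    moreover have "expectation (indicator (?A n)) = prob (?A n)" using A[of n] by simp
    ultimately show ?case using elim C by linarith
  qed
  then have "mostly e (\<lambda>n \<omega>. m (X n \<omega>) < real (Suc C))"
    by (intro mostlyI[of "\<lambda>n. space M - ?A n"] sets.compl_sets A) (auto intro!: always_eventually)
  then show thesis using that[of "Suc C"] unfolding m_def by simp
qed

end

lemma nat_measurable_if_real:
  assumes "(\<lambda>x. real (f x)) \<in> borel_measurable M"
  shows "f \<in> measurable M (count_space UNIV)"
proof -
  have "(\<lambda>x. nat \<lfloor>real (f x)\<rfloor>) \<in> measurable M (count_space UNIV)"
    using assms by measurable
  then show ?thesis by simp
qed

theorem theorem4p1:
  fixes M :: "'w measure"
    and Q0 :: "nat \<Rightarrow> 'w \<Rightarrow> nat"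
    and A :: "nat \<Rightarrow> 'w \<Rightarrow> real \<Rightarrow> nat"
    and res :: "nat \<Rightarrow> 'w \<Rightarrow> real"
    and \<eta> :: "nat \<Rightarrow> 'w \<Rightarrow> real"
    and F\<^sub>0 F :: "real \<Rightarrow> real"
    and Qbar0 :: "'w \<Rightarrow> real"
    and Abar :: "'w \<Rightarrow> cadlag"
  assumes "prob_space M"
    and arrivals: "\<And>N \<omega>. N \<ge> 1 \<Longrightarrow> \<omega> \<in> space M \<Longrightarrow> counting_path (A N \<omega>)"
    and res_indep: "prob_space.indep_vars M (\<lambda>_. borel) res {1..}"
    and res_nonneg: "\<And>i \<omega>. i \<ge> 1 \<Longrightarrow> \<omega> \<in> space M \<Longrightarrow> res i \<omega> \<ge> 0"
    and res_distr: "\<And>i. i \<ge> 1 \<Longrightarrow> cdf (distr M borel (res i)) = F\<^sub>0"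
    and service_indep: "prob_space.indep_vars M (\<lambda>_. borel) \<eta> {1..}"
    and service_nonneg: "\<And>i \<omega>. i \<ge> 1 \<Longrightarrow> \<omega> \<in> space M \<Longrightarrow> \<eta> i \<omega> \<ge> 0"
    and service_distr: "\<And>i. i \<ge> 1 \<Longrightarrow> cdf (distr M borel (\<eta> i)) = F"
    and service_mean: "\<And>i. i \<ge> 1 \<Longrightarrow> has_bochner_integral M (\<eta> i) 1"
    and indep: "\<And>N. N \<ge> 1 \<Longrightarrow> indep_vars3 M
          borel (\<lambda>\<omega>. (real (Q0 N \<omega>), cadlag_of (\<lambda>t. real (A N \<omega> t))))
          (Pi\<^sub>M {1..} (\<lambda>_. borel)) (\<lambda>\<omega>. \<lambda>i\<in>{1..}. res i \<omega>)
          (Pi\<^sub>M {1..} (\<lambda>_. borel)) (\<lambda>\<omega>. \<lambda>i\<in>{1..}. \<eta> i \<omega>)"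
    and conv: "converges_in_distribution M
          (\<lambda>n \<omega>. let N = Suc n in
             (real (Q0 N \<omega>) / real N, cadlag_of (\<lambda>t. real (A N \<omega> t) / real N)))
          (\<lambda>\<omega>. (Qbar0 \<omega>, Abar \<omega>))"
    and cont: "AE \<omega> in M. continuous_on {0..} (path_of (Abar \<omega>))"
  shows "(AE \<omega> in M. \<exists>!x. fluid_solution F\<^sub>0 F (Qbar0 \<omega>) (Abar \<omega>) x) \<and>
    (\<exists>Qbar :: 'w \<Rightarrow> cadlag.
       (AE \<omega> in M. fluid_solution F\<^sub>0 F (Qbar0 \<omega>) (Abar \<omega>) (Qbar \<omega>)) \<and>
       converges_in_distribution M
         (\<lambda>n \<omega>. let N = Suc n in
            cadlag_of (\<lambda>t. real (queue_length N (Q0 N \<omega>) (A N \<omega>)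
                    (\<lambda>i. res i \<omega>) (\<lambda>i. \<eta> i \<omega>) t) / real N))
         Qbar)"
proof -
  interpret prob_space M by fact
  define \<nu> where "\<nu> = distr M borel (\<eta> 1)"
  define \<mu> where "\<mu> = distr M borel (res 1)"
  have res [measurable]: "res i \<in> borel_measurable M" if "1 \<le> i" for i
    using res_indep that unfolding indep_vars_def by auto
  have \<eta> [measurable]: "\<eta> i \<in> borel_measurable M" if "1 \<le> i" for i
    using service_indep that unfolding indep_vars_def by auto
  interpret \<mu>: real_distribution \<mu> unfolding \<mu>_def by (rule real_distribution_distr) simp
  interpret \<nu>: real_distribution \<nu> unfolding \<nu>_def by (rule real_distribution_distr) simp
  interpret \<nu>: service_law \<nu>
  proof
    show "AE s in \<nu>. 0 \<le> s"
      unfolding \<nu>_def by (subst AE_distr_iff) (use service_nonneg in auto)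
    show "\<not> (AE s in \<nu>. s = 0)"
    proof
      assume "AE s in \<nu>. s = 0"
      then have "AE \<omega> in M. \<eta> 1 \<omega> = 0" unfolding \<nu>_def by (subst (asm) AE_distr_iff) auto
      then have "expectation (\<eta> 1) = 0" by (rule integral_eq_zero_AE)
      then show False using has_bochner_integral_integral_eq[OF service_mean[of 1]] by simp
    qed
  qed
  have F: "F = cdf \<nu>" and F0: "F\<^sub>0 = cdf \<mu>"
    using service_distr[of 1] res_distr[of 1] by (simp_all add: \<nu>_def \<mu>_def)
  have F0_law: "is_cadlag F\<^sub>0" "\<And>t. 0 \<le> F\<^sub>0 t" "\<And>t. F\<^sub>0 t \<le> 1"
    unfolding F0 by (simp_all add: \<mu>.is_cadlag_cdf \<mu>.cdf_nonneg \<mu>.cdf_bounded_prob)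

  define X where "X n \<omega> = (real (Q0 (Suc n) \<omega>) / real (Suc n), cadlag_of (\<lambda>t. real (A (Suc n) \<omega> t) / real (Suc n)))" for n \<omega>
  define X' where "X' \<omega> = (Qbar0 \<omega>, Abar \<omega>)" for \<omega>
  define \<Phi> where "\<Phi> = (\<lambda>(q, a). \<nu>.fluid_map F\<^sub>0 q a)"
  have cd: "converges_in_distribution M X X'"
    using conv unfolding X_def X'_def Let_def by simp
  have X_meas: "X n \<in> borel_measurable M" "X' \<in> borel_measurable M" for n
    using cd by (auto simp: converges_in_distribution_def)
  have pathX: "path_of (snd (X n \<omega>)) t = (if t < 0 then 0 else real (A (Suc n) \<omega> t) / real (Suc n))"
    if "\<omega> \<in> space M" for n \<omega> t
    using path_scaled_arrivals[OF arrivals[OF _ that], of "Suc n" "real (Suc n)"] by (simp add: X_def)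
  have contX': "AE \<omega> in M. continuous_on {0..} (path_of (snd (X' \<omega>)))"
    using cont by (simp add: X'_def)
  have isCont_\<Phi>: "isCont \<Phi> z" if "continuous_on {0..} (path_of (snd z))" for z
    using \<nu>.isCont_fluid_map[OF F0_law that, of "fst z"] by (simp add: \<Phi>_def)

  have mono: "AE \<omega> in M. \<forall>s t. s \<le> t \<longrightarrow> path_of (Abar \<omega>) s \<le> path_of (Abar \<omega>) t"
  proof -
    have "AE \<omega> in M. \<forall>s t. s \<le> t \<longrightarrow> path_of (snd (X' \<omega>)) s \<le> path_of (snd (X' \<omega>)) t"
    proof (rule limit_path_mono[OF cd _ contX'])
      fix n \<omega> and s t :: real assume w: "\<omega> \<in> space M" and st: "s \<le> t"
      have "mono_on {0..} (A (Suc n) \<omega>)" using arrivals[OF _ w, of "Suc n"] by (simp add: counting_path_def)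
      then have "0 \<le> s \<Longrightarrow> A (Suc n) \<omega> s \<le> A (Suc n) \<omega> t" using st by (simp add: mono_on_def)
      then show "path_of (snd (X n \<omega>)) s \<le> path_of (snd (X n \<omega>)) t"
        using st by (auto simp: pathX[OF w] divide_right_mono)
    qed
    then show ?thesis by (simp add: X'_def)
  qed
  have solution: "AE \<omega> in M. \<forall>x. fluid_solution F\<^sub>0 F (Qbar0 \<omega>) (Abar \<omega>) x \<longleftrightarrow> x = \<Phi> (X' \<omega>)"
    using mono
  proof eventually_elim
    case (elim \<omega>)
    then show ?case
      unfolding F \<Phi>_def X'_def using \<nu>.fluid_solution_iff_fluid_map[OF F0_law, of "Abar \<omega>"] by simp
  qed

  \<comment> \<open>The solution map is only known to be continuous at continuous arrival paths, so the arrivals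
    are replaced by the zero path on a null set to get a measurable solution.\<close>
  obtain N where N: "N \<in> null_sets M"
    "{\<omega>\<in>space M. \<not> continuous_on {0..} (path_of (Abar \<omega>))} \<subseteq> N"
    using cont by (auto elim!: AE_E simp: null_sets_def)
  define Y where "Y \<omega> = (if \<omega> \<in> N then (0, cadlag_of (\<lambda>_. 0)) else X' \<omega>)" for \<omega>
  have Y_eq: "AE \<omega> in M. Y \<omega> = X' \<omega>"
    using AE_not_in[OF N(1)] by eventually_elim (simp add: Y_def)
  have Y_cont: "continuous_on {0..} (path_of (snd (Y \<omega>)))" if "\<omega> \<in> space M" for \<omega>
    using N(2) that by (auto simp: Y_def X'_def path_cadlag_of is_cadlag_const)
  have \<Phi>Y_meas: "(\<lambda>\<omega>. \<Phi> (Y \<omega>)) \<in> borel_measurable M"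
  proof -
    let ?S = "{z :: real \<times> cadlag. continuous_on {0..} (path_of (snd z))}"
    have "Y \<in> borel_measurable M"
      unfolding Y_def using N(1) X_meas(2) by (intro measurable_If_set) auto
    then have "Y \<in> measurable M (restrict_space borel ?S)"
      using Y_cont by (intro measurable_restrict_space2) auto
    moreover have "\<Phi> \<in> borel_measurable (restrict_space borel ?S)"
      by (rule borel_measurable_continuous_on_restrict, rule continuous_at_imp_continuous_on) (use isCont_\<Phi> in blast)
    ultimately show ?thesis by (rule measurable_compose)
  qed

  define W where "W n \<omega> = cadlag_of (\<lambda>t. real (queue_length (Suc n) (Q0 (Suc n) \<omega>) (A (Suc n) \<omega>)
                    (\<lambda>i. res i \<omega>) (\<lambda>i. \<eta> i \<omega>) t) / real (Suc n))" for n \<omega>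
  have W_meas: "W n \<in> borel_measurable M" for n
  proof -
    have fst_X: "(\<lambda>\<omega>. real (Q0 (Suc n) \<omega>)) \<in> borel_measurable M"
    proof -
      have "(\<lambda>\<omega>. fst (X n \<omega>) * real (Suc n)) \<in> borel_measurable M"
        by (intro borel_measurable_times borel_measurable_fst X_meas) simp
      then show ?thesis by (simp add: X_def del: of_nat_Suc)
    qed
    have snd_X: "(\<lambda>\<omega>. real (A (Suc n) \<omega> t)) \<in> borel_measurable M" if t: "0 \<le> t" for t
    proof -
      have "(\<lambda>\<omega>. path_of (snd (X n \<omega>)) t * real (Suc n)) \<in> borel_measurable M"
        by (intro borel_measurable_times borel_measurable_eval_snd X_meas) simp
      moreover have "path_of (snd (X n \<omega>)) t * real (Suc n) = real (A (Suc n) \<omega> t)" if "\<omega> \<in> space M" for \<omega>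
        using t by (simp add: pathX[OF that] del: of_nat_Suc)
      ultimately show ?thesis by (rule measurable_cong[THEN iffD1, rotated])
    qed
    interpret random_queue M "Suc n" "Q0 (Suc n)" "A (Suc n)" res \<eta>
    proof
      show "Q0 (Suc n) \<in> measurable M (count_space UNIV)"
        using fst_X by (rule nat_measurable_if_real)
      show "(\<lambda>\<omega>. A (Suc n) \<omega> t) \<in> measurable M (count_space UNIV)" if "0 \<le> t" for t
        using snd_X[OF that] by (rule nat_measurable_if_real)
    qed (use arrivals service_nonneg res \<eta> in auto)
    show ?thesis unfolding W_def by (rule scaled_queue_measurable)
  qed
  have W_cd: "converges_in_distribution M W (\<lambda>\<omega>. \<Phi> (Y \<omega>))"
  proof (rule converges_in_distribution_map[OF cd W_meas \<Phi>Y_meas])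
    show "AE \<omega> in M. \<Phi> (Y \<omega>) = \<Phi> (X' \<omega>)" using Y_eq by eventually_elim simp
    show "AE \<omega> in M. isCont \<Phi> (X' \<omega>)" using contX' by eventually_elim (rule isCont_\<Phi>)
    fix e :: real assume e: "0 < e"
    obtain m where m: "(1/2) ^ m < e / 2" using real_arch_pow_inv[of "e / 2" "1/2"] e by auto
    define c where "c = exp (real m) / (1 - \<nu>.discount)"
    have c: "0 < c" using \<nu>.discount_less_1 by (simp add: c_def)
    \<comment> \<open>An error \<open>2 d\<close> in the fluid equation up to time \<open>m\<close> costs \<open>2 c d = e / 2\<close> in the solution, and
      later times contribute less than \<open>e / 2\<close> to the distance.\<close>
    define d where "d = e / (4 * c)"
    have d: "0 < d" using e c by (simp add: d_def)
    have e2: "0 < e / 2" using e by simp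
    obtain C :: nat where "mostly (e / 2) (\<lambda>n \<omega>. \<bar>fst (X n \<omega>)\<bar> + \<bar>path_of (snd (X n \<omega>)) (real m)\<bar> < real C)"
      using tight_at_time[OF cd contX' e2] by blast
    moreover have e4: "0 < e / 4" using e by simp
    have "mostly (e / 4) (\<lambda>n \<omega>. \<forall>K. real K \<le> real 1 * real n \<longrightarrow>
        samples_close F\<^sub>0 (\<lambda>i. res i \<omega>) K (d * real n))"
      by (rule empirical_uniform_law[OF res_indep _ _ d e4]) (rule res_nonneg res_distr | assumption)+
    moreover have "mostly (e / 4) (\<lambda>n \<omega>. \<forall>K. real K \<le> real C * real n \<longrightarrow>
        samples_close F (\<lambda>i. \<eta> i \<omega>) K (d * real n))"
      by (rule empirical_uniform_law[OF service_indep _ _ d e4]) (rule service_nonneg service_distr | assumption)+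
    ultimately have "mostly (e / 2 + (e / 4 + e / 4)) (\<lambda>n \<omega>.
        \<bar>fst (X n \<omega>)\<bar> + \<bar>path_of (snd (X n \<omega>)) (real m)\<bar> < real C \<and>
        (\<forall>K. real K \<le> real 1 * real (Suc n) \<longrightarrow> samples_close F\<^sub>0 (\<lambda>i. res i \<omega>) K (d * real (Suc n))) \<and>
        (\<forall>K. real K \<le> real C * real (Suc n) \<longrightarrow> samples_close F (\<lambda>i. \<eta> i \<omega>) K (d * real (Suc n))))"
      by (intro mostly_conj mostly_Suc)
    then show "mostly e (\<lambda>n \<omega>. dist (W n \<omega>) (\<Phi> (X n \<omega>)) \<le> e)"
    proof (rule mostly_mono)
      fix n \<omega> assume wM: "\<omega> \<in> space M"
      assume good: "\<bar>fst (X n \<omega>)\<bar> + \<bar>path_of (snd (X n \<omega>)) (real m)\<bar> < real C \<and>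
        (\<forall>K. real K \<le> real 1 * real (Suc n) \<longrightarrow> samples_close F\<^sub>0 (\<lambda>i. res i \<omega>) K (d * real (Suc n))) \<and>
        (\<forall>K. real K \<le> real C * real (Suc n) \<longrightarrow> samples_close F (\<lambda>i. \<eta> i \<omega>) K (d * real (Suc n)))"
      interpret queue_path "Suc n" "Q0 (Suc n) \<omega>" "A (Suc n) \<omega>" "\<lambda>i. res i \<omega>" "\<lambda>i. \<eta> i \<omega>"
        by unfold_locales (use arrivals[OF _ wM] service_nonneg[OF _ wM] in auto)
      have W: "W n \<omega> = scaled_queue" and X: "X n \<omega> = (real (Q0 (Suc n) \<omega>) / real (Suc n), scaled_arrivals)"
        by (simp_all add: W_def X_def)
      have "dist (W n \<omega>) (\<Phi> (X n \<omega>)) \<le> e / 2 + (1/2) ^ m"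
      proof (rule cadlag_dist_le_uniform)
        fix t assume t: "0 \<le> t" "t \<le> real m"
        have "\<bar>path_of scaled_queue t - path_of (\<nu>.fluid_map F\<^sub>0 (real (Q0 (Suc n) \<omega>) / real (Suc n)) scaled_arrivals) t\<bar>
            \<le> exp (real m) / (1 - \<nu>.discount) * (2 * d)"
        proof (rule queue_near_fluid_map[OF \<nu>.service_law_axioms F0_law])
          show "samples_close F\<^sub>0 (\<lambda>i. res i \<omega>) (min (Q0 (Suc n) \<omega>) (Suc n)) (d * real (Suc n))"
            using good by simp
          fix t assume t: "0 \<le> t" "t \<le> real m"
          have "real (appeared t) \<le> real (Q0 (Suc n) \<omega>) + real (A (Suc n) \<omega> (real m))"
            unfolding appeared_def using a_mono[OF t] by linarith
          also have "\<dots> = (fst (X n \<omega>) + path_of (snd (X n \<omega>)) (real m)) * real (Suc n)"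
            by (simp add: X path_scaled distrib_right del: of_nat_Suc)
          also have "\<dots> \<le> real C * real (Suc n)"
            using good by (intro mult_right_mono) linarith+
          finally show "samples_close (cdf \<nu>) (\<lambda>i. \<eta> i \<omega>) (appeared t) (d * real (Suc n))"
            using good unfolding F[symmetric] by blast
        qed (use t in auto)
        also have "\<dots> = e / 2" using c by (simp add: d_def flip: c_def)
        finally show "\<bar>path_of (W n \<omega>) t - path_of (\<Phi> (X n \<omega>)) t\<bar> \<le> e / 2"
          by (simp add: W X \<Phi>_def)
      qed
      then show "dist (W n \<omega>) (\<Phi> (X n \<omega>)) \<le> e" using m by linarith
    qed (use e in simp)
  qed
  show ?thesis
  proof (intro conjI exI)
    show "AE \<omega> in M. \<exists>!x. fluid_solution F\<^sub>0 F (Qbar0 \<omega>) (Abar \<omega>) x"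
      using solution by eventually_elim simp
    show "AE \<omega> in M. fluid_solution F\<^sub>0 F (Qbar0 \<omega>) (Abar \<omega>) (\<Phi> (Y \<omega>))"
      using solution Y_eq by eventually_elim simp
    show "converges_in_distribution M
         (\<lambda>n \<omega>. let N = Suc n in
            cadlag_of (\<lambda>t. real (queue_length N (Q0 N \<omega>) (A N \<omega>)
                    (\<lambda>i. res i \<omega>) (\<lambda>i. \<eta> i \<omega>) t) / real N)) (\<lambda>\<omega>. \<Phi> (Y \<omega>))"
      using W_cd unfolding W_def Let_def .
  qed
qed

end
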